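(* For all integers $j\geq 0$ and $k\geq 1$ the following hold. (1) There exist a constant $C(q,k)$ and a sequence of integers $(l_k)_{k\geq 1}$ with $l_k\to\infty$ as $k\to\infty$ such that for all $j\geq C(q,k)$, $$E_{j,k}\in\widetilde{M}^{\leq (q^k-1)/(q-1)}_{(q^k-1)(q^j+1)/(q-1),\,k}\setminus \widetilde{M}^{\leq l_k}_{(q^k-1)(q^j+1)/(q-1),\,k}.$$ (2) For all $j\geq 0$, $k\geq1$: $\mathrm{ord}_{u=0}E_{j,k}=q^j(q^{2k}-1)/(q^2-1)$. (3) For all $j\geq 0$, $k\geq 1$: $E_{j,k}\in A[[u]]$ and $E_{j,k}$ is normalised. (4) For $k=1$ (any $q$), and for $k=2$ when $q\geq 3$, we have $E_{j,k}=f_{(q^k-1)/(q-1),\,(q^k-1)(q^j+1)/(q-1),\,k}$ for all $j\geq 0$.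
   Context: Let $q=p^e$ be a power of a prime $p$, $A=\mathbb{F}_q[\theta]$, $K=\mathbb{F}_q(\theta)$. For $i\in\mathbb{Z}$ put $[i]=\theta^{q^i}-\theta$ (so $[0]=0$, $[-1]=\theta^{1/q}-\theta$). Let $u$ be the usual uniformiser at infinity for Drinfeld modular forms for $\mathbf{GL}_2(A)$, and let $E,g,h\in A[[u]]$ be the $u$-expansions of, respectively, Gekeler's false Eisenstein series (weight $2$, type $1$, depth $1$), the normalised Eisenstein series of weight $q-1$ and type $0$, and the Poincaré series $h$ of weight $q+1$ and type $1$; they begin $E=u+u^{q^2-2q+2}+\cdots$, $g=1-[1]u^{q-1}-[1]u^{q^3-2q^2+2q-1}+\cdots$, $h=-u-u^{q^2-2q+2}+\cdots$, and are algebraically independent over $K(u)$. Put $\Delta=-h^{q-1}$. For $w\in\mathbb{Z}$ and $m\in\mathbb{Z}/(q-1)\mathbb{Z}$, let $M_{w,m}$ be the $K$-span in $K[[u]]$ of the monomials $g^ah^b$ ($a,b\geq 0$) with $a(q-1)+b(q+1)=w$ and $b\equiv m \pmod{q-1}$, and for $l\geq 0$ let $\widetilde{M}^{\leq l}_{w,m}=M_{w,m}\oplus M_{w-2,m-1}E\oplus\cdots\oplus M_{w-2l,m-l}E^l$ (Drinfeld quasi-modular forms of weight $w$, type $m$, depth $\leq l$). A nonzero series $\sum_{i\geq i_0}c_iu^i$ with $c_{i_0}\neq0$ is normalised if $c_{i_0}=1$. A nonzero $f\in\widetilde{M}^{\leq l}_{w,m}$ is extremal if $\mathrm{ord}_{u=0}f$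 is maximal among nonzero elements of $\widetilde{M}^{\leq l}_{w,m}$; when $\widetilde{M}^{\leq l}_{w,m}\neq 0$, $f_{l,w,m}$ denotes the unique normalised extremal form in it. Define $E_{j,1}$ for $j\in\mathbb{Z}$ (in the perfect closure of $K((u))$) by $E_{0,1}=E$, $E_{1,1}=-(Eg+h)/[1]$, for $j\geq 0$: $E_{j+2,1}=-\frac{1}{[j+2]}(\Delta^{q^j}E_{j,1}+g^{q^{j+1}}E_{j+1,1})$, and for $j\leq 1$: $E_{j-2,1}=-\frac{1}{\Delta^{q^{j-2}}}([j]E_{j,1}+g^{q^{j-1}}E_{j-1,1})$. Let $B_k(t)=\prod_{0\leq i<j<k}(t^{q^j}-t^{q^i})\in\mathbb{F}_q[t]$. For $k\geq 1$, $j\in\mathbb{Z}$, let $E_{j,k}=\frac{1}{B_k(\theta)}\det\bigl(E_{j-a+b,1}^{q^{a}}\bigr)_{0\leq a,b\leq k-1}$ (row $a$, column $b$); for $k=1$ this is $E_{j,1}$. *)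

theory Defs
  imports
    "HOL-Library.Cardinality"
    "HOL-Number_Theory.Residues"
    "HOL-Computational_Algebra.Computational_Algebra"
    "HOL-Algebra.Algebraic_Closure_Type"
    "Jordan_Normal_Form.Determinant"
begin

text \<open>
  The finite field \<open>\<F>\<^sub>q\<close> is an arbitrary type \<open>'a :: finite_field\<close> with \<open>q = CARD('a)\<close>;
  \<open>A = \<F>\<^sub>q[\<theta>]\<close> is \<open>'a poly\<close> (with \<open>\<theta>\<close> the polynomial variable), \<open>K = \<F>\<^sub>q(\<theta>)\<close> is
  \<open>'a poly fract\<close>, \<open>K[[u]]\<close> is \<open>'a poly fract fps\<close> and \<open>K((u))\<close> is \<open>'a poly fract fls\<close>.
  The perfect closure of \<open>K((u))\<close> is taken inside the library's algebraic closure of \<open>K((u))\<close>.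
\<close>

hide_const (open) Divisibility.prime

type_synonym 'a ratfun = "'a poly fract"
type_synonym 'a closure_field = "'a poly fract fls alg_closure"

definition theta :: "'a::finite_field poly" where
  "theta = [:0, 1:]"

definition const_A :: "'a::finite_field poly \<Rightarrow> 'a ratfun fps" where
  "const_A a = fps_const (to_fract a)"

definition emb :: "'a::finite_field ratfun fps \<Rightarrow> 'a closure_field" where
  "emb f = to_ac (fps_to_fls f)"

definition integral_series :: "'a::finite_field ratfun fps set" where
  "integral_series = {f. \<forall>n. fps_nth f n \<in> range to_fract}"


subsection \<open>The \<open>u\<close>-expansions of \<open>E\<close>, \<open>g\<close> and \<open>h\<close>\<close>

text \<open>
  The Carlitz module \<open>a \<mapsto> C\<^sub>a(X) \<in> A[X]\<close>: the \<open>\<F>\<^sub>q\<close>-linear map with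
  \<open>C\<^sub>\<theta>(X) = \<theta> X + X\<^sup>q\<close> and \<open>C\<^bsub>\<theta>b\<^esub> = C\<^sub>\<theta> \<circ> C\<^sub>b\<close>.
\<close>

definition carlitz_theta :: "'a::finite_field poly poly" where
  "carlitz_theta = monom theta 1 + monom 1 (CARD('a))"

definition carlitz :: "'a::finite_field poly \<Rightarrow> 'a poly poly" where
  "carlitz a = (\<Sum>i\<le>degree a. smult [:coeff a i:] ((pcompose carlitz_theta ^^ i) (monom 1 1)))"

text \<open>
  With \<open>d = deg a\<close>, the reciprocal polynomial is \<open>f\<^sub>a(u) = C\<^sub>a(1/u) u^(q^d)\<close>. For the usual
  uniformiser \<open>u = u(z)\<close> one has \<open>1/u(az) = C\<^sub>a(1/u(z))\<close>, so that the expansion of \<open>u(az)\<close> in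
  \<open>u\<close> is \<open>u\<^sub>a = u^(q^d) / f\<^sub>a(u)\<close>.
\<close>

definition carlitz_recip :: "'a::finite_field poly \<Rightarrow> 'a ratfun fps" where
  "carlitz_recip a = fps_of_poly (map_poly to_fract (reflect_poly (carlitz a)))"

definition u_mult :: "'a::finite_field poly \<Rightarrow> 'a ratfun fps" where
  "u_mult a = fps_X ^ (CARD('a) ^ degree a) * inverse (carlitz_recip a)"

definition monics_below :: "nat \<Rightarrow> 'a::finite_field poly set" where
  "monics_below d = {a. lead_coeff a = 1 \<and> degree a < d}"

text \<open>
  The three expansions, as \<open>u\<close>-adic limits (all sums and products are over monic \<open>a \<in> A\<close>):

  \<^item> \<open>E = \<Sum> a u\<^sub>a\<close>, from \<open>E(z) = \<pi>\<^sup>-\<^sup>1 \<Sum>\<^sub>a \<Sum>\<^sub>b a / (az + b)\<close> (with \<open>\<pi>\<close> the Carlitz period, \<open>a\<close> monic,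
    \<open>b \<in> A\<close>) and \<open>\<Sum>\<^sub>b 1 / (z + b) = \<pi> u(z)\<close>;
  \<^item> \<open>g = 1 - [1] \<Sum> u\<^sub>a\<^sup>q\<^sup>-\<^sup>1\<close>, from the Eisenstein series \<open>\<Sum> (az + b)\<^sup>1\<^sup>-\<^sup>q\<close> over \<open>(a, b) \<noteq> (0, 0)\<close>,
    scaled to have constant term \<open>1\<close>, and \<open>\<Sum>\<^sub>b (z + b)\<^sup>1\<^sup>-\<^sup>q = (\<pi> u(z))\<^sup>q\<^sup>-\<^sup>1\<close>;
  \<^item> \<open>h = -u \<Prod> f\<^sub>a(u)^(q\<^sup>2 - 1)\<close>, Gekeler's product expansion of the Poincare series of weight
    \<open>q + 1\<close> and type \<open>1\<close> (E.-U. Gekeler, On the coefficients of Drinfeld modular forms,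
    Invent. Math. 93, 1988, which also contains the other two expansions).
\<close>

definition E_series :: "'a::finite_field ratfun fps" where
  "E_series = lim (\<lambda>d. \<Sum>a\<in>monics_below d. const_A a * u_mult a)"

definition g_series :: "'a::finite_field ratfun fps" where
  "g_series = 1 - const_A (theta ^ CARD('a) - theta) *
     lim (\<lambda>d. \<Sum>a\<in>monics_below d. u_mult a ^ (CARD('a) - 1))"

definition h_series :: "'a::finite_field ratfun fps" where
  "h_series = - (fps_X * lim (\<lambda>d. \<Prod>a\<in>monics_below d. carlitz_recip a ^ (CARD('a)\<^sup>2 - 1)))"

definition Delta_series :: "'a::finite_field ratfun fps" where
  "Delta_series = - (h_series ^ (CARD('a) - 1))"


subsection \<open>Quasi-modular forms and extremal forms\<close>

text \<open>The type \<open>m \<in> \<int>/(q - 1)\<int>\<close> is represented by an arbitrary integer.\<close>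

definition modular_forms :: "int \<Rightarrow> int \<Rightarrow> 'a::finite_field ratfun fps set" where
  "modular_forms w m = module.span (\<lambda>c f. fps_const c * f)
     {g_series ^ a * h_series ^ b | a b.
        int a * (int CARD('a) - 1) + int b * (int CARD('a) + 1) = w \<and>
        [int b = m] (mod (int CARD('a) - 1))}"

definition quasi_modular_forms :: "nat \<Rightarrow> int \<Rightarrow> int \<Rightarrow> 'a::finite_field ratfun fps set" where
  "quasi_modular_forms l w m =
     {(\<Sum>i\<le>l. F i * E_series ^ i) | F. \<forall>i\<le>l. F i \<in> modular_forms (w - 2 * int i) (m - int i)}"

definition normalised :: "'a::finite_field ratfun fps \<Rightarrow> bool" where
  "normalised f \<longleftrightarrow> f \<noteq> 0 \<and> fps_nth f (subdegree f) = 1"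

definition extremal :: "nat \<Rightarrow> int \<Rightarrow> int \<Rightarrow> 'a::finite_field ratfun fps \<Rightarrow> bool" where
  "extremal l w m f \<longleftrightarrow> f \<in> quasi_modular_forms l w m \<and> f \<noteq> 0 \<and>
     (\<forall>f'\<in>(quasi_modular_forms l w m :: 'a ratfun fps set). f' \<noteq> 0 \<longrightarrow> subdegree f' \<le> subdegree f)"

definition extremal_form :: "nat \<Rightarrow> int \<Rightarrow> int \<Rightarrow> 'a::finite_field ratfun fps" where
  "extremal_form l w m = (THE f. extremal l w m f \<and> normalised f)"

lemma vector_space_fps: "vector_space (\<lambda>(c :: 'a::field) f. fps_const c * f)"
  by unfold_locales (simp_all add: algebra_simps flip: fps_const_add fps_const_mult)

lemma finite_subdegrees:
  fixes T :: "'a::field fps set"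
  assumes "finite T"
    and sub: "V \<subseteq> module.span (\<lambda>c f. fps_const c * f) T"
  shows "finite (subdegree ` (V - {0}))"
proof (rule ccontr)
  interpret vector_space "\<lambda>(c :: 'a) f. fps_const c * f" by (rule vector_space_fps)
  assume "infinite (subdegree ` (V - {0}))"
  then obtain S where S: "S \<subseteq> subdegree ` (V - {0})" "finite S" "card S = Suc (card T)"
    using infinite_arbitrarily_large by blast
  then obtain F where F: "F \<subseteq> V - {0}" "inj_on subdegree F" "S = subdegree ` F"
    using subset_image_inj by metis
  have fin: "finite F" using F(2,3) S(2) finite_imageD by blast
  have card: "card F = Suc (card T)" using F(2,3) S(3) card_image by metis
  have "independent F"
    unfolding independent_explicit_finite_subsets
  proof (intro allI impI ballI)
    fix G c v
    assume G: "G \<subseteq> F" "finite G" and sum: "(\<Sum>v\<in>G. fps_const (c v) * v) = 0" and v: "v \<in> G"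
    show "c v = 0"
    proof (rule ccontr)
      assume "c v \<noteq> 0"
      define G' where "G' = {v\<in>G. c v \<noteq> 0}"
      have G': "finite G'" "G' \<noteq> {}" using G v \<open>c v \<noteq> 0\<close> by (auto simp: G'_def)
      obtain w where w: "w \<in> G'" "\<And>x. x \<in> G' \<Longrightarrow> subdegree w \<le> subdegree x"
        using ex_min_if_finite[of "subdegree ` G'"] G' by (auto simp: not_less)
      have "fps_nth (\<Sum>v\<in>G. fps_const (c v) * v) (subdegree w) =
              (\<Sum>v\<in>G. if v = w then c w * fps_nth w (subdegree w) else 0)"
        unfolding fps_sum_nth
      proof (rule sum.cong)
        fix x assume x: "x \<in> G"
        show "fps_nth (fps_const (c x) * x) (subdegree w) =
                (if x = w then c w * fps_nth w (subdegree w) else 0)"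
        proof (cases "x = w \<or> c x = 0")
          case False
          hence "x \<in> G'" using x by (simp add: G'_def)
          hence "subdegree w \<le> subdegree x" by (rule w(2))
          moreover have "subdegree w \<noteq> subdegree x"
            using F(2) G(1) x w(1) False by (auto simp: G'_def inj_on_def)
          ultimately have "subdegree w < subdegree x" by linarith
          hence "fps_nth x (subdegree w) = 0" by (rule nth_less_subdegree_zero)
          thus ?thesis using False by simp
        next
          case True
          thus ?thesis by (cases "x = w") simp_all
        qed
      qed simp
      also have "\<dots> = c w * fps_nth w (subdegree w)"
        using w(1) G(2) by (simp add: G'_def)
      finally have "c w * fps_nth w (subdegree w) = 0" by (simp add: sum)
      moreover have "w \<noteq> 0" "c w \<noteq> 0" using w(1) G(1) F(1) by (auto simp: G'_def)
      ultimately show False by simp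
    qed
  qed
  hence "card F \<le> card T"
    by (rule independent_span_bound[OF \<open>finite T\<close>, THEN conjunct2]) (use F(1) sub in auto)
  thus False using card by simp
qed

lemma subspace_quasi_modular_forms:
  "module.subspace (\<lambda>c f. fps_const c * f) (quasi_modular_forms l w m :: 'a::finite_field ratfun fps set)"
proof -
  interpret vector_space "\<lambda>(c :: 'a ratfun) f. fps_const c * f" by (rule vector_space_fps)
  have M: "subspace (modular_forms w m :: 'a ratfun fps set)" for w m
    unfolding modular_forms_def by (rule subspace_span)
  show ?thesis
  proof (rule subspaceI)
    show "0 \<in> (quasi_modular_forms l w m :: 'a ratfun fps set)"
      unfolding quasi_modular_forms_def mem_Collect_eq
      by (rule exI[of _ "\<lambda>_. 0"]) (simp add: subspace_0[OF M])
  next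
    fix x y :: "'a ratfun fps"
    assume "x \<in> quasi_modular_forms l w m" "y \<in> quasi_modular_forms l w m"
    then obtain F G where
      "x = (\<Sum>i\<le>l. F i * E_series ^ i)" "\<forall>i\<le>l. F i \<in> modular_forms (w - 2 * int i) (m - int i)"
      "y = (\<Sum>i\<le>l. G i * E_series ^ i)" "\<forall>i\<le>l. G i \<in> modular_forms (w - 2 * int i) (m - int i)"
      unfolding quasi_modular_forms_def by auto
    thus "x + y \<in> quasi_modular_forms l w m"
      unfolding quasi_modular_forms_def mem_Collect_eq
      by (intro exI[of _ "\<lambda>i. F i + G i"])
         (simp add: subspace_add[OF M] sum.distrib distrib_right)
  next
    fix c :: "'a ratfun" and x :: "'a ratfun fps"
    assume "x \<in> quasi_modular_forms l w m"
    then obtain F where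
      "x = (\<Sum>i\<le>l. F i * E_series ^ i)" "\<forall>i\<le>l. F i \<in> modular_forms (w - 2 * int i) (m - int i)"
      unfolding quasi_modular_forms_def by auto
    thus "fps_const c * x \<in> quasi_modular_forms l w m"
      unfolding quasi_modular_forms_def mem_Collect_eq
      by (intro exI[of _ "\<lambda>i. fps_const c * F i"])
         (simp add: subspace_scale[OF M] sum_distrib_left mult.assoc)
  qed
qed

lemma quasi_modular_forms_finite_span:
  "\<exists>T. finite T \<and> (quasi_modular_forms l w m :: 'a::finite_field ratfun fps set)
         \<subseteq> module.span (\<lambda>c f. fps_const c * f) T"
proof -
  interpret vector_space "\<lambda>(c :: 'a ratfun) f. fps_const c * f" by (rule vector_space_fps)
  define N where "N = nat \<bar>w\<bar> + 2 * l"
  define T :: "'a ratfun fps set" where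
    "T = (\<lambda>(a, b, i). g_series ^ a * h_series ^ b * E_series ^ i) ` ({..N} \<times> {..N} \<times> {..l})"
  have q: "int CARD('a) \<ge> 2"
  proof -
    have "card {0, 1 :: 'a} \<le> CARD('a)" by (rule card_mono) auto
    thus ?thesis by simp
  qed
  have M: "f * E_series ^ i \<in> span T"
    if "f \<in> modular_forms (w - 2 * int i) (m - int i)" "i \<le> l" for f i
  proof -
    from that(1) show ?thesis
      unfolding modular_forms_def
    proof (induction rule: span_induct_alt)
      case base
      show ?case by (simp add: span_zero)
    next
      case (step c x y)
      then obtain a b where x: "x = g_series ^ a * h_series ^ b" and
        ab: "int a * (int CARD('a) - 1) + int b * (int CARD('a) + 1) = w - 2 * int i" by auto
      have "int a * 1 \<le> int a * (int CARD('a) - 1)" "int b * 1 \<le> int b * (int CARD('a) + 1)"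
        using q by (intro mult_left_mono; simp)+
      moreover have "int a * 1 \<ge> 0" "int b * 1 \<ge> 0" by simp_all
      ultimately have "int a + int b \<le> \<bar>w\<bar>" using ab by linarith
      hence "a \<le> N" "b \<le> N" by (auto simp: N_def)
      hence "x * E_series ^ i \<in> T"
        unfolding T_def x using that(2) by (intro image_eqI[of _ _ "(a, b, i)"]) auto
      hence "fps_const c * (x * E_series ^ i) + y * E_series ^ i \<in> span T"
        using step by (intro span_add span_scale) (auto intro: span_base)
      thus ?case by (simp add: algebra_simps)
    qed
  qed
  have "(quasi_modular_forms l w m :: 'a ratfun fps set) \<subseteq> span T"
    unfolding quasi_modular_forms_def by (auto intro!: span_sum M)
  moreover have "finite T" by (simp add: T_def)
  ultimately show ?thesis by blast
qed

lemma ex1_extremal_form: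
  assumes "quasi_modular_forms l w m \<noteq> ({0} :: 'a::finite_field ratfun fps set)"
  shows "\<exists>!f :: 'a ratfun fps. extremal l w m f \<and> normalised f"
proof -
  interpret vector_space "\<lambda>(c :: 'a ratfun) f. fps_const c * f" by (rule vector_space_fps)
  let ?V = "quasi_modular_forms l w m :: 'a ratfun fps set"
  have V: "subspace ?V" by (rule subspace_quasi_modular_forms)
  have fin: "finite (subdegree ` (?V - {0}))"
    using quasi_modular_forms_finite_span finite_subdegrees by metis
  moreover have "?V - {0} \<noteq> {}" using assms subspace_0[OF V] by auto
  ultimately have "Max (subdegree ` (?V - {0})) \<in> subdegree ` (?V - {0})" by (intro Max_in) auto
  then obtain f where "Max (subdegree ` (?V - {0})) = subdegree f" "f \<in> ?V - {0}" by (rule imageE)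
  hence f: "f \<in> ?V" "f \<noteq> 0" "subdegree f = Max (subdegree ` (?V - {0}))" by simp_all
  have max: "subdegree f' \<le> subdegree f" if "f' \<in> ?V" "f' \<noteq> 0" for f'
    unfolding f(3) using fin that by (intro Max_ge) auto
  define f1 where "f1 = fps_const (inverse (fps_nth f (subdegree f))) * f"
  have nz: "fps_nth f (subdegree f) \<noteq> 0" using f(2) by simp
  have f1: "f1 \<in> ?V"
    unfolding f1_def by (rule subspace_scale[OF V f(1)])
  have f1': "f1 \<noteq> 0" "subdegree f1 = subdegree f" "fps_nth f1 (subdegree f) = 1"
    using f(2) nz by (simp_all add: f1_def)
  have "extremal l w m f1"
    unfolding extremal_def f1'(2) using f1 f1'(1) max by blast
  moreover have "normalised f1"
    unfolding normalised_def f1'(2) using f1'(1,3) by blast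
  moreover have "f2 = f3"
    if "extremal l w m f2 \<and> normalised f2" "extremal l w m f3 \<and> normalised f3"
    for f2 f3 :: "'a ratfun fps"
  proof (rule ccontr)
    assume "f2 \<noteq> f3"
    have norm: "normalised f2" "normalised f3" using that by auto
    have sd: "subdegree f2 = subdegree f3"
      using that by (auto simp: extremal_def intro!: antisym)
    have "f2 - f3 \<in> ?V" using that subspace_diff[OF V] by (auto simp: extremal_def)
    hence le: "subdegree (f2 - f3) \<le> subdegree f2"
      using that \<open>f2 \<noteq> f3\<close> by (auto simp: extremal_def)
    have "fps_nth (f2 - f3) n = 0" if "n \<le> subdegree f2" for n
    proof (cases "n = subdegree f2")
      case True
      thus ?thesis using norm sd by (simp add: normalised_def)
    next
      case False
      hence "n < subdegree f2" "n < subdegree f3" using that sd by linarith+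
      hence "fps_nth f2 n = 0" "fps_nth f3 n = 0" by (blast intro: nth_less_subdegree_zero)+
      thus ?thesis by simp
    qed
    from this[OF le] have "fps_nth (f2 - f3) (subdegree (f2 - f3)) = 0" .
    hence "f2 - f3 = 0" by (subst (asm) nth_subdegree_zero_iff)
    thus False using \<open>f2 \<noteq> f3\<close> by simp
  qed
  ultimately show ?thesis by (intro ex1I[of _ f1]) blast+
qed


subsection \<open>The forms \<open>E\<^bsub>j,k\<^esub>\<close>\<close>

text \<open>
  \<open>frob i x\<close> is \<open>x^(q^i)\<close> for \<open>i \<in> \<int>\<close>; roots are unique by \<open>root_unique\<close> below.
\<close>

definition frob :: "int \<Rightarrow> 'a::finite_field closure_field \<Rightarrow> 'a closure_field" where
  "frob i x = (if i \<ge> 0 then x ^ (CARD('a) ^ nat i) else (THE y. y ^ (CARD('a) ^ nat (- i)) = x))"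

lemma CHAR_eq_prime:
  assumes "prime p" "CARD('a::finite_field) = p ^ e"
  shows "CHAR('a) = p"
proof -
  have "prime CHAR('a)"
    by (rule prime_CHAR_semidom) (simp add: CHAR_pos)
  moreover have "CHAR('a) dvd p ^ e"
    using CHAR_dvd_CARD[where ?'a = 'a] assms(2) by simp
  ultimately show ?thesis
    using assms(1) by (metis prime_dvd_power primes_dvd_imp_eq)
qed

lemma CHAR_ratfun: "CHAR('a::finite_field ratfun) = CHAR('a)"
proof -
  have "(of_nat n = (0 :: 'a ratfun)) \<longleftrightarrow> (of_nat n = (0 :: 'a poly))" for n
    by (simp add: Fraction_Field.of_nat_fract Zero_fract_def eq_fract)
  hence "CHAR('a ratfun) = CHAR('a poly)"
    by (intro CHAR_eqI) (simp_all add: of_nat_eq_0_iff_char_dvd)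
  thus ?thesis by simp
qed

lemma root_unique:
  fixes x :: "'a::finite_field closure_field"
  assumes "prime p" "CARD('a) = p ^ e"
  shows "\<exists>!y. y ^ (CARD('a) ^ n) = x"
proof -
  have char: "CHAR('a closure_field) = p"
    using CHAR_eq_prime[OF assms] by (simp add: CHAR_ratfun)
  have N: "CARD('a) ^ n = CHAR('a closure_field) ^ (e * n)"
    unfolding char by (simp add: assms(2) power_mult)
  have pr: "prime CHAR('a closure_field)" unfolding char by (rule assms(1))
  have "y = z" if "y ^ (CARD('a) ^ n) = z ^ (CARD('a) ^ n)" for y z :: "'a closure_field"
  proof -
    have "y ^ (CARD('a) ^ n) = (z + (y - z)) ^ (CARD('a) ^ n)" by simp
    also have "\<dots> = z ^ (CARD('a) ^ n) + (y - z) ^ (CARD('a) ^ n)"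
      using freshmans_dream'[OF pr N] by blast
    finally have "(y - z) ^ (CARD('a) ^ n) = 0" using that by simp
    thus ?thesis by simp
  qed
  moreover have "\<exists>y. y ^ (CARD('a) ^ n) = x"
    by (rule nth_root_exists) simp
  ultimately show ?thesis by metis
qed

definition bracket :: "int \<Rightarrow> 'a::finite_field closure_field" where
  "bracket i = frob i (emb (const_A theta)) - emb (const_A theta)"

function E1 :: "int \<Rightarrow> 'a::finite_field closure_field" where
  "E1 j =
    (if j = 0 then emb E_series
     else if j = 1 then - (emb (E_series * g_series + h_series) / bracket 1)
     else if j \<ge> 2 then
       - (1 / bracket j) *
         (frob (j - 2) (emb Delta_series) * E1 (j - 2) + frob (j - 1) (emb g_series) * E1 (j - 1))
     else
       - (1 / frob j (emb Delta_series)) *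
         (bracket (j + 2) * E1 (j + 2) + frob (j + 1) (emb g_series) * E1 (j + 1)))"
  by auto
termination
  by (relation "measure (\<lambda>j. nat \<bar>2 * j - 1\<bar>)") auto

declare E1.simps [simp del]

text \<open>\<open>B_poly k\<close> is \<open>B\<^sub>k(\<theta>)\<close>, an element of \<open>A\<close>.\<close>

definition B_poly :: "nat \<Rightarrow> 'a::finite_field poly" where
  "B_poly k = (\<Prod>(i, j)\<in>{(i, j). i < j \<and> j < k}. theta ^ (CARD('a) ^ j) - theta ^ (CARD('a) ^ i))"

definition E_form :: "int \<Rightarrow> nat \<Rightarrow> 'a::finite_field closure_field" where
  "E_form j k =
     det (mat k k (\<lambda>(a, b). frob (int a) (E1 (j - int a + int b)))) / emb (const_A (B_poly k))"

end

theory Submission imports Defs "Subresultants.Subresultant_Gcd" "Berlekamp_Zassenhaus.Unique_Factorization_Poly"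
begin

text \<open>
  Summing the relations among the \<open>C\<^sub>c(1/u) = 1/u\<^sub>c\<close> over the monic \<open>c\<close> of degree less than \<open>d\<close> and letting
  \<open>d \<rightarrow> \<infinity>\<close> shows that the series \<open>\<Sum> c^(q^s) u\<^sub>c^(q^n)\<close> satisfy the recursion of the \<open>E\<^bsub>j,1\<^esub>\<close>, so that
  \<open>E\<^bsub>j,1\<^esub>^(q^s)\<close> is the one with \<open>n = j + s\<close>. Newton interpolation at the nodes \<open>\<theta>^(q^a)\<close> splits the factor
  \<open>B\<^sub>k(\<theta>)\<close> off the determinant; the remaining determinant is integral, and by the rearrangement
  inequality a single permutation contributes its leading term. This gives order and normalisation.

  With \<open>\<gamma>^(q-1) = g\<close>, a form of weight \<open>w\<close> is \<open>\<gamma>^w\<close> times a polynomial in \<open>\<eta> = h/\<gamma>^(q+1)\<close> and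
  \<open>\<epsilon> = E/\<gamma>\<^sup>2\<close> of bounded weight. The resultant of two such polynomials with respect to \<open>\<epsilon>\<close> is a polynomial
  in \<open>\<eta>\<close> whose degree is bounded by the weights, while its order in \<open>u\<close> is at least the smaller of the
  two orders. Applied against the \<open>E\<^bsub>j,k\<^esub>\<close>, which vanish to a high order, this yields the transcendence of
  \<open>\<epsilon>\<close> over \<open>K(\<eta>)\<close>, hence the depth can be read off the degree in \<open>\<epsilon>\<close>. It also shows that a form
  of larger order than \<open>E\<^bsub>j,k\<^esub>\<close> has a common factor with it; for \<open>k \<le> 2\<close> proper factors of \<open>E\<^bsub>j,k\<^esub>\<close> are excluded by
  comparing them with \<open>E\<^bsub>j+1,1\<^esub>\<close> and \<open>E\<^bsub>j+2,1\<^esub>\<close> in the same way.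
\<close>

text \<open>The recursion belongs to the generating series Y(t), the sum of c(t) u_c over the monic
  c. As c has coefficients in F_q, its value at t = \<theta>^(q^s) is c^(q^s), so one relation
  between the coefficients of Y(t) serves all s. Cut off at degree d, these coefficients form a
  vector \<open>y\<close> that is dual to the first row of the Moore matrix of the
  C_(\<theta>^i)(1/u). That matrix is invertible, so vectors can be compared through their pairings
  with its rows, which are power sums of the C_c(1/u); this gives exact relations at each level d.
  The obstacle is that g is given by a sum and h by a product, with nothing to link them. The link
  is a second vector \<open>z\<close>, built from \<open>y\<close> and g: its q-th powers are
  proportional to \<open>y\<close>, and its value at t = \<theta> is a quotient of products of the
  C_c(1/u), the approximation of -h. The restriction q \<ge> 3 for k = 2 comes from the inequality 2
  (q^k - 1)/(q - 1) \<le> q^k: under it, the resultant of E_(j,k) with a form of larger order has to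
  vanish.\<close>

section \<open>Power sums over F_q and polynomials of bounded degree\<close>

lemma card_finite_field_ge_2: "CARD('a::finite_field) \<ge> 2"
proof -
  have "card {0, 1 :: 'a} \<le> CARD('a)" by (rule card_mono) auto
  thus ?thesis by simp
qed

text \<open>For 0 < n < q - 1 the polynomial X^n - 1 has too few roots to vanish at all units, so
  some unit \<open>a\<close> has \<open>a ^ n \<noteq> 1\<close>; substituting a x for x multiplies
  the sum by \<open>a ^ n\<close>. For n = 0 the sum is q, which is 0 in the field.\<close>

lemma sum_power_finite_field:
  assumes "n < CARD('a) - 1"
  shows "(\<Sum>x\<in>(UNIV :: 'a::finite_field set). x ^ n) = 0"
proof (cases "n = 0")
  case True
  have "of_nat CARD('a) = (0 :: 'a)"
    using CHAR_dvd_CARD[where ?'a = 'a] by (simp add: of_nat_eq_0_iff_char_dvd)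
  thus ?thesis using True by simp
next
  case False
  define f :: "'a poly" where "f = monom 1 n - 1"
  have f0: "f \<noteq> 0" 
  proof
    assume "f = 0"
    hence "coeff f n = 0" by simp
    thus False using False by (simp add: f_def)
  qed
  have "degree f \<le> n" unfolding f_def by (rule degree_diff_le) (simp_all add: degree_monom_le)
  hence "card {x. poly f x = 0} \<le> n" using card_poly_roots_bound[OF f0] by linarith
  also have "n < card (UNIV - {0 :: 'a})" using assms by (simp add: card_Diff_singleton)
  finally have "\<not> (UNIV - {0 :: 'a}) \<subseteq> {x. poly f x = 0}"
    by (metis card_mono finite_code leD)
  then obtain a where a: "a \<noteq> 0" "poly f a \<noteq> 0" by blast
  hence a1: "a ^ n \<noteq> 1" by (simp add: f_def poly_monom)
  have "(\<Sum>x\<in>(UNIV :: 'a set). x ^ n) = (\<Sum>x\<in>UNIV. (a * x) ^ n)"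
    by (rule sum.reindex_bij_witness[of _ "\<lambda>x. a * x" "\<lambda>x. x / a"]) (use a in auto)
  also have "\<dots> = a ^ n * (\<Sum>x\<in>UNIV. x ^ n)" by (simp add: power_mult_distrib sum_distrib_left)
  finally show ?thesis using a1 by simp
qed

text \<open>Bounding the coefficients rather than the degree includes the zero polynomial for every
  \<open>d\<close>, so that \<open>lows d\<close> is a vector space of dimension d, with
  \<open>lows 0 = {0}\<close>.\<close>

definition lows :: "nat \<Rightarrow> 'a::zero poly set" where
  "lows d = {c. \<forall>i\<ge>d. coeff c i = 0}"

lemma lows_0: "lows 0 = {0 :: 'a::zero poly}"
  by (auto simp: lows_def poly_eq_iff)

lemma bij_lows_Suc:
  "bij_betw (\<lambda>(l, c). c + monom l d) (UNIV \<times> lows d) (lows (Suc d) :: 'a::comm_ring_1 poly set)"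
proof (rule bij_betw_byWitness[where f' = "\<lambda>c. (coeff c d, c - monom (coeff c d) d)"])
  show "\<forall>x\<in>UNIV \<times> lows d. (\<lambda>c. (coeff c d, c - monom (coeff c d) d)) 
          (case x of (l, c) \<Rightarrow> c + monom l d) = (x :: 'a \<times> 'a poly)"
    by (auto simp: lows_def)
  show "\<forall>c\<in>lows (Suc d). (case (coeff c d, c - monom (coeff c d) d) of (l, c) \<Rightarrow> c + monom l d) = (c :: 'a poly)"
    by auto
  show "(\<lambda>(l, c). c + monom l d) ` (UNIV \<times> lows d) \<subseteq> (lows (Suc d) :: 'a poly set)"
    by (auto simp: lows_def)
  show "(\<lambda>c. (coeff c d, c - monom (coeff c d) d)) ` lows (Suc d) \<subseteq> (UNIV \<times> lows d :: ('a \<times> 'a poly) set)"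
  proof -
    have "c - monom (coeff c d) d \<in> lows d" if "c \<in> lows (Suc d)" for c :: "'a poly"
      unfolding lows_def mem_Collect_eq
    proof (intro allI impI)
      fix i assume "i \<ge> d"
      thus "coeff (c - monom (coeff c d) d) i = 0"
        using that by (cases "i = d") (auto simp: lows_def)
    qed
    thus ?thesis by auto
  qed
qed

lemma finite_lows: "finite (lows d :: 'a::finite_field poly set)"
proof (induction d)
  case (Suc d)
  thus ?case using bij_betw_finite[OF bij_lows_Suc[of d, where ?'a = 'a]] by simp
qed (simp add: lows_0)

lemma sum_lows_Suc:
  "(\<Sum>c\<in>lows (Suc d). F (c :: 'a::comm_ring_1 poly)) = (\<Sum>l\<in>UNIV. \<Sum>c\<in>lows d. F (c + monom l d))"
  by (subst sum.reindex_bij_betw[OF bij_lows_Suc, symmetric])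
     (simp add: sum.cartesian_product case_prod_unfold)

lemma prod_lows_Suc:
  "(\<Prod>c\<in>lows (Suc d). F (c :: 'a::comm_ring_1 poly)) = (\<Prod>l\<in>UNIV. \<Prod>c\<in>lows d. F (c + monom l d))"
  by (subst prod.reindex_bij_betw[OF bij_lows_Suc, symmetric])
     (simp add: prod.cartesian_product case_prod_unfold)

lemma degree_add_monom_lows:
  assumes "c \<in> lows d"
  shows "degree (c + monom (1::'a::finite_field) d) = d"
  using assms by (intro antisym degree_le le_degree) (auto simp: lows_def)

lemma monics_below_Suc:
  "monics_below (Suc d) = monics_below d \<union> (\<lambda>c. c + monom (1::'a::finite_field) d) ` lows d"
    (is "?L = ?R")
proof (intro equalityI subsetI)
  fix c :: "'a poly" assume c: "c \<in> ?L"
  show "c \<in> ?R"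
  proof (cases "degree c < d")
    case True
    thus ?thesis using c by (auto simp: monics_below_def)
  next
    case False
    hence d: "degree c = d" "coeff c d = 1" using c by (auto simp: monics_below_def less_Suc_eq)
    have "c - monom 1 d \<in> lows d" using d by (auto simp: lows_def coeff_eq_0)
    hence "(c - monom 1 d) + monom 1 d \<in> ?R" by blast
    thus ?thesis by simp
  qed
next
  fix c :: "'a poly" assume "c \<in> ?R"
  thus "c \<in> ?L"
  proof
    assume "c \<in> (\<lambda>c. c + monom 1 d) ` lows d"
    then obtain c' where "c' \<in> lows d" "c = c' + monom 1 d" by blast
    thus ?thesis using degree_add_monom_lows[of c' d] 
      by (auto simp: monics_below_def lows_def)
  qed (auto simp: monics_below_def)
qed

lemma monics_below_disjoint:
  "monics_below d \<inter> (\<lambda>c. c + monom (1::'a::finite_field) d) ` lows d = {}"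
  using degree_add_monom_lows by (fastforce simp: monics_below_def)

lemma monics_below_0: "monics_below 0 = {}"
  by (simp add: monics_below_def)

lemma finite_monics_below: "finite (monics_below d :: 'a::finite_field poly set)"
  by (induction d) (simp_all add: monics_below_0 monics_below_Suc finite_lows)

lemma sum_monics_below_Suc:
  "(\<Sum>c\<in>monics_below (Suc d). F (c :: 'a::finite_field poly)) =
     (\<Sum>c\<in>monics_below d. F c) + (\<Sum>c\<in>lows d. F (c + monom 1 d))"
  unfolding monics_below_Suc
  by (subst sum.union_disjoint[OF finite_monics_below _ monics_below_disjoint])
     (simp_all add: finite_lows sum.reindex inj_on_def)

lemma prod_monics_below_Suc:
  "(\<Prod>c\<in>monics_below (Suc d). F (c :: 'a::finite_field poly)) =
     (\<Prod>c\<in>monics_below d. F c) * (\<Prod>c\<in>lows d. F (c + monom 1 d))"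
  unfolding monics_below_Suc
  by (subst prod.union_disjoint[OF finite_monics_below _ monics_below_disjoint])
     (simp_all add: finite_lows prod.reindex inj_on_def)

subsection \<open>The Carlitz module in an abstract field\<close>

text \<open>
  Here \<open>th\<close> and \<open>xx\<close> stand for \<open>\<theta>\<close> and \<open>1/u\<close>. In an abstract field the identities for degree
  less than \<open>d\<close> are purely algebraic; convergence only enters later.
\<close>

locale carlitz_field =
  fixes \<iota> :: "'a::finite_field \<Rightarrow> 'b::field" and th xx :: 'b and q :: nat
  assumes q_def: "q = CARD('a)"
    and \<iota>_1: "\<iota> 1 = 1" and \<iota>_add: "\<iota> (x + y) = \<iota> x + \<iota> y" and \<iota>_mult: "\<iota> (x * y) = \<iota> x * \<iota> y"
    and frob: "((u :: 'b) + v) ^ q = u ^ q + v ^ q"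
begin

lemma q_ge_2: "q \<ge> 2" using card_finite_field_ge_2[where ?'a = 'a] by (simp add: q_def)

lemma q_pos [simp]: "q > 0" "q \<noteq> 0" using q_ge_2 by simp_all

lemma \<iota>_0 [simp]: "\<iota> 0 = 0" 
proof -
  have "\<iota> 0 + \<iota> 0 = \<iota> 0 + 0" using \<iota>_add[of 0 0] by simp
  thus ?thesis by (subst (asm) add_left_cancel)
qed

lemma \<iota>_minus: "\<iota> (- x) = - \<iota> x" using \<iota>_add[of x "-x"] by (simp add: eq_neg_iff_add_eq_0 add.commute)

lemma \<iota>_power: "\<iota> (x ^ n) = \<iota> x ^ n"
  by (induction n) (simp_all add: \<iota>_1 \<iota>_mult)

lemma \<iota>_eq_0_iff [simp]: "\<iota> x = 0 \<longleftrightarrow> x = 0"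
proof
  assume "\<iota> x = 0"
  hence "\<iota> (x * inverse x) = 0" by (simp add: \<iota>_mult)
  thus "x = 0" using \<iota>_1 by (cases "x = 0") auto
qed simp

lemma inj_\<iota>: "inj \<iota>"
proof (rule injI)
  fix x y assume "\<iota> x = \<iota> y"
  hence "\<iota> (x - y) = 0" using \<iota>_add[of x "-y"] by (simp add: \<iota>_minus)
  thus "x = y" by simp
qed

lemma \<iota>_sum: "\<iota> (sum f A) = (\<Sum>x\<in>A. \<iota> (f x))"
  by (induction A rule: infinite_finite_induct) (simp_all add: \<iota>_add)

lemma \<iota>_q [simp]: "\<iota> x ^ q = \<iota> x"
  by (simp add: q_def finite_field_power_card_eq_same flip: \<iota>_power)

lemma \<iota>_q_power [simp]: "\<iota> x ^ (q ^ n) = \<iota> x"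
  by (simp add: q_def finite_field_power_card_power_eq_same[OF refl] flip: \<iota>_power)

lemma frob_power: "((u :: 'b) + v) ^ (q ^ n) = u ^ (q ^ n) + v ^ (q ^ n)"
  by (induction n arbitrary: u v) (simp_all add: power_mult frob)

lemma frob_minus: "(- (u :: 'b)) ^ (q ^ n) = - (u ^ (q ^ n))"
  using frob_power[of u "-u" n] by (simp add: eq_neg_iff_add_eq_0 add.commute[of "u ^ q ^ n"] power_0_left)

lemma frob_diff: "((u :: 'b) - v) ^ (q ^ n) = u ^ (q ^ n) - v ^ (q ^ n)"
  using frob_power[of u "-v" n] by (simp add: frob_minus)

lemma frob_sum: "(sum f A :: 'b) ^ (q ^ n) = (\<Sum>x\<in>A. f x ^ (q ^ n))"
  by (induction A rule: infinite_finite_induct) (simp_all add: frob_power power_0_left)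

lemmas frob1 = frob_minus[of _ 1, simplified] frob_diff[of _ _ 1, simplified] frob_sum[of _ _ 1, simplified]

lemma sum_\<iota>_power: "n < q - 1 \<Longrightarrow> (\<Sum>x\<in>UNIV. \<iota> x ^ n) = 0"
  using sum_power_finite_field[of n, where ?'a = 'a] by (simp add: q_def flip: \<iota>_sum \<iota>_power)

text \<open>For \<open>u \<noteq> 0\<close> this is the factorisation of X^q - X over F_q, evaluated
  at T/u and rescaled by u^q. Both sides are monic of degree q in X, so their difference has smaller
  degree but vanishes on F_q.\<close>

lemma prod_translates: "(\<Prod>l\<in>UNIV. T + \<iota> l * u) = T ^ q - u ^ (q - 1) * T"
proof (cases "u = 0")
  case True
  thus ?thesis using q_ge_2 by (simp add: q_def)
next
  case False
  define f where "f = (\<Prod>l\<in>UNIV. [:\<iota> l, 1:])"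
  define g where "g = monom 1 q - [:0, 1 :: 'b:]"
  have df: "degree f = q" unfolding f_def by (subst degree_prod_eq_sum_degree) (auto simp: q_def)
  have lf: "lead_coeff f = 1" unfolding f_def by (simp add: lead_coeff_prod)
  have "degree (f - g) < q"
  proof (rule le_less_trans)
    show "degree (f - g) \<le> q - 1"
    proof (rule degree_le, intro allI impI)
      fix i assume i: "q - 1 < i"
      show "coeff (f - g) i = 0"
      proof (cases "i = q")
        case True
        thus ?thesis using df lf q_ge_2 by (simp add: g_def coeff_pCons split: nat.split)
      next
        case False
        hence "i > q" using i by simp
        thus ?thesis using df q_ge_2 by (simp add: g_def coeff_eq_0 coeff_pCons split: nat.split)
      qed
    qed
    show "q - 1 < q" using q_ge_2 by simp
  qed
  moreover have "\<iota> ` UNIV \<subseteq> {x. poly (f - g) x = 0}"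
  proof safe
    fix l
    have "poly f (\<iota> l) = (\<Prod>m\<in>UNIV. \<iota> m + \<iota> l)" by (simp add: f_def poly_prod)
    also have "\<dots> = 0" by (rule prod_zero) (auto intro!: exI[of _ "-l"] simp: \<iota>_minus)
    finally show "poly (f - g) (\<iota> l) = 0" by (simp add: g_def poly_monom)
  qed
  moreover have "card (\<iota> ` UNIV) = q" using inj_\<iota> by (simp add: card_image q_def)
  ultimately have "f - g = 0"
    using card_poly_roots_bound[of "f - g"] card_mono[OF poly_roots_finite[of "f - g"]]
    by (metis le_trans leD)
  hence "poly f (T / u) = poly g (T / u)" by simp
  hence "(\<Prod>l\<in>UNIV. \<iota> l + T / u) = (T / u) ^ q - T / u"
    by (simp add: f_def g_def poly_prod poly_monom)
  hence "u ^ q * (\<Prod>l\<in>UNIV. \<iota> l + T / u) = u ^ q * ((T / u) ^ q - T / u)" by simp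
  also have "u ^ q * (\<Prod>l\<in>UNIV. \<iota> l + T / u) = (\<Prod>l\<in>UNIV. u * (\<iota> l + T / u))"
    by (simp add: prod.distrib q_def)
  also have "(\<lambda>l. u * (\<iota> l + T / u)) = (\<lambda>l. T + \<iota> l * u)" using False by (auto simp: field_simps)
  also have "u ^ q * ((T / u) ^ q - T / u) = T ^ q - u ^ (q - 1) * T"
  proof -
    have "u ^ q = u * u ^ (q - 1)" by (simp flip: power_Suc)
    thus ?thesis using False by (simp add: power_divide right_diff_distrib)
  qed
  finally show ?thesis .
qed

section \<open>Values of the Carlitz module and the additive polynomials vanishing on them\<close>

primrec Cb :: "nat \<Rightarrow> 'b" where
  "Cb 0 = xx"
| "Cb (Suc i) = th * Cb i + Cb i ^ q"

text \<open>\<open>Cc c\<close> is the Carlitz polynomial of \<open>c\<close> evaluated at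
  \<open>xx\<close>; the values \<open>Cb i\<close> belong to the powers \<theta>^i.\<close>

definition Cc :: "'a poly \<Rightarrow> 'b" where
  "Cc c = (\<Sum>i\<le>degree c. \<iota> (coeff c i) * Cb i)"

lemma Cc_lows: "c \<in> lows n \<Longrightarrow> Cc c = (\<Sum>i<n. \<iota> (coeff c i) * Cb i)"
  unfolding Cc_def
proof (rule sum.mono_neutral_cong)
  fix i assume "c \<in> lows n" "i \<in> {..degree c} - {..<n}"
  thus "\<iota> (coeff c i) * Cb i = 0" by (auto simp: lows_def)
qed (auto simp: coeff_eq_0)

lemma Cc_add_monom: "c \<in> lows d \<Longrightarrow> Cc (c + monom l d) = Cc c + \<iota> l * Cb d"
proof -
  assume c: "c \<in> lows d"
  have "Cc (c + monom l d) = (\<Sum>i<Suc d. \<iota> (coeff (c + monom l d) i) * Cb i)"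
    by (rule Cc_lows) (use c in \<open>auto simp: lows_def\<close>)
  thus ?thesis using c Cc_lows[OF c] by (simp add: lows_def)
qed

lemma Cc_smult: "Cc (smult l c) = \<iota> l * Cc c"
  by (cases "l = 0") (simp_all add: Cc_def \<iota>_mult sum_distrib_left mult.assoc)

lemma Cc_0 [simp]: "Cc 0 = 0" by (simp add: Cc_def)

text \<open>
  \<open>e d\<close> is the \<open>\<F>\<^sub>q\<close>-linear polynomial with zeros \<open>C\<^sub>c\<close>, \<open>deg c < d\<close>; its coefficient at \<open>Y^(q^b)\<close> is \<open>a d b\<close>.
\<close>

primrec e :: "nat \<Rightarrow> 'b \<Rightarrow> 'b" where
  "e 0 Y = Y"
| "e (Suc d) Y = e d Y ^ q - e d (Cb d) ^ (q - 1) * e d Y"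

definition \<epsilon> :: "nat \<Rightarrow> 'b" where "\<epsilon> d = e d (Cb d)"

primrec a :: "nat \<Rightarrow> nat \<Rightarrow> 'b" where
  "a 0 b = (if b = 0 then 1 else 0)"
| "a (Suc d) b = (if b = 0 then 0 else a d (b - 1) ^ q) - \<epsilon> d ^ (q - 1) * a d b"

lemma a_gt: "b > d \<Longrightarrow> a d b = 0"
  by (induction d arbitrary: b) auto

lemma a_diag [simp]: "a d d = 1"
  by (induction d) (auto simp: a_gt)

lemma e_expand: "e d Y = (\<Sum>b\<le>d. a d b * Y ^ (q ^ b))"
proof (induction d)
  case (Suc d)
  have "(\<Sum>b\<le>Suc d. a (Suc d) b * Y ^ (q ^ b)) =
     (\<Sum>b\<le>Suc d. (if b = 0 then 0 else a d (b - 1) ^ q) * Y ^ (q ^ b)) -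
      \<epsilon> d ^ (q - 1) * (\<Sum>b\<le>Suc d. a d b * Y ^ (q ^ b))"
    unfolding a.simps left_diff_distrib sum_subtractf sum_distrib_left mult.assoc ..
  also have "(\<Sum>b\<le>Suc d. a d b * Y ^ (q ^ b)) = e d Y"
    using Suc by (simp add: a_gt)
  also have "(\<Sum>b\<le>Suc d. (if b = 0 then 0 else a d (b - 1) ^ q) * Y ^ (q ^ b)) =
      (\<Sum>b\<le>d. a d b ^ q * Y ^ (q ^ Suc b))"
    unfolding sum.atMost_Suc_shift by simp
  also have "\<dots> = e d Y ^ q"
    unfolding Suc frob1 power_mult_distrib
    by (intro sum.cong refl arg_cong2[where f = "(*)"]) (simp add: mult.commute flip: power_mult)
  finally show ?case by (simp add: \<epsilon>_def)
qed simp

lemma e_add: "e d (Y + Z) = e d Y + e d Z"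
  by (simp add: e_expand frob_power distrib_left sum.distrib)

lemma e_\<iota>: "e d (\<iota> l * Y) = \<iota> l * e d Y"
  by (simp add: e_expand power_mult_distrib sum_distrib_left mult_ac)

lemma e_Cb: "i < d \<Longrightarrow> e d (Cb i) = 0"
proof (induction d)
  case (Suc d)
  show ?case
  proof (cases "i = d")
    case True
    have "x ^ (q - 1) * x = x ^ q" for x :: 'b by (rule power_minus_mult) simp
    thus ?thesis using True by simp
  qed (use Suc in \<open>simp add: power_0_left\<close>)
qed simp

lemma a_0: "a d 0 = (-1) ^ d * (\<Prod>i<d. \<epsilon> i) ^ (q - 1)"
  by (induction d) (simp_all add: power_mult_distrib)

text \<open>Going from d to d + 1 splits the product over the leading coefficient l; by additivity
  each inner product is \<open>e d Y\<close> plus l times \<open>\<epsilon> d\<close>, and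
  \<open>prod_translates\<close> multiplies these up to the recursion that defines
  \<open>e\<close>.\<close>

lemma e_prod: "e d Y = (\<Prod>c\<in>lows d. Y + Cc c)"
proof (induction d arbitrary: Y)
  case (Suc d)
  have "(\<Prod>c\<in>lows (Suc d). Y + Cc c) = (\<Prod>l\<in>UNIV. \<Prod>c\<in>lows d. (Y + \<iota> l * Cb d) + Cc c)"
    by (simp add: prod_lows_Suc Cc_add_monom add_ac)
  also have "\<dots> = (\<Prod>l\<in>UNIV. e d Y + \<iota> l * \<epsilon> d)"
    by (simp flip: Suc add: e_add e_\<iota> \<epsilon>_def)
  also have "\<dots> = e (Suc d) Y" by (simp add: prod_translates \<epsilon>_def)
  finally show ?case by (rule sym)
qed (simp add: lows_0)

definition P :: "nat \<Rightarrow> 'b" where "P d = (\<Prod>c\<in>monics_below d. Cc c)"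

text \<open>The monic polynomials of degree d are the translates of \<theta>^d by
  \<open>lows d\<close>, so \<open>e_prod\<close> at \<open>Cb d\<close> gives the product of their
  values.\<close>

lemma P_Suc: "P (Suc d) = P d * \<epsilon> d"
proof -
  have "(\<Prod>c\<in>lows d. Cc (c + monom 1 d)) = (\<Prod>c\<in>lows d. Cb d + Cc c)"
    by (intro prod.cong refl) (simp add: Cc_add_monom \<iota>_1)
  thus ?thesis by (simp add: P_def prod_monics_below_Suc \<epsilon>_def e_prod)
qed

lemma P_0 [simp]: "P 0 = 1" by (simp add: P_def monics_below_0)

lemma P_eq: "P d = (\<Prod>i<d. \<epsilon> i)"
  by (induction d) (simp_all add: P_Suc)

text \<open>Each factor is additive in the leading coefficient l of \<open>c\<close>. After
  expanding over subsets, the factors that supply l give a power of l, whose sum over F_q vanishes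
  for exponents below q - 1. Otherwise at least q - 1 factors are used up, and the rest are few
  enough for the induction hypothesis.\<close>

lemma sum_prod_lows:
  assumes "finite I" "card I < d * (q - 1)"
  shows "(\<Sum>c\<in>lows d. \<Prod>k\<in>I. (y k + Cc c ^ (q ^ r k))) = 0"
  using assms
proof (induction d arbitrary: I)
  case (Suc d)
  have "(\<Sum>c\<in>lows (Suc d). \<Prod>k\<in>I. (y k + Cc c ^ (q ^ r k))) =
    (\<Sum>l\<in>UNIV. \<Sum>c\<in>lows d. \<Prod>k\<in>I. (y k + Cc c ^ (q ^ r k)) + \<iota> l * Cb d ^ (q ^ r k))"
    by (simp add: sum_lows_Suc Cc_add_monom frob_power power_mult_distrib add_ac)
  also have "\<dots> = (\<Sum>l\<in>UNIV. \<Sum>c\<in>lows d. \<Sum>J\<in>Pow I. (\<Prod>k\<in>J. y k + Cc c ^ (q ^ r k)) *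
       (\<Prod>k\<in>I - J. \<iota> l * Cb d ^ (q ^ r k)))"
    by (simp add: prod_add[OF Suc.prems(1)])
  also have "\<dots> = (\<Sum>l\<in>UNIV. \<Sum>J\<in>Pow I. \<Sum>c\<in>lows d. (\<Prod>k\<in>J. y k + Cc c ^ (q ^ r k)) *
       (\<Prod>k\<in>I - J. \<iota> l * Cb d ^ (q ^ r k)))"
    by (intro sum.cong sum.swap refl)
  also have "\<dots> = (\<Sum>J\<in>Pow I. \<Sum>l\<in>UNIV. \<Sum>c\<in>lows d. (\<Prod>k\<in>J. y k + Cc c ^ (q ^ r k)) *
       (\<Prod>k\<in>I - J. \<iota> l * Cb d ^ (q ^ r k)))"
    by (rule sum.swap)
  also have "\<dots> = (\<Sum>J\<in>Pow I. 0)"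
  proof (rule sum.cong[OF refl])
    fix J assume "J \<in> Pow I"
    hence J: "J \<subseteq> I" "finite J" using Suc.prems(1) by (auto intro: finite_subset)
    have "(\<Sum>l\<in>UNIV. \<Sum>c\<in>lows d. (\<Prod>k\<in>J. y k + Cc c ^ (q ^ r k)) *
       (\<Prod>k\<in>I - J. \<iota> l * Cb d ^ (q ^ r k))) =
      (\<Sum>l\<in>UNIV. (\<Sum>c\<in>lows d. \<Prod>k\<in>J. y k + Cc c ^ (q ^ r k)) * 
         ((\<Prod>k\<in>I - J. Cb d ^ (q ^ r k)) * \<iota> l ^ card (I - J)))"
      unfolding sum_distrib_right by (simp add: prod.distrib mult_ac)
    also have "\<dots> = (\<Sum>c\<in>lows d. \<Prod>k\<in>J. y k + Cc c ^ (q ^ r k)) * 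
         ((\<Prod>k\<in>I - J. Cb d ^ (q ^ r k)) * (\<Sum>l\<in>UNIV. \<iota> l ^ card (I - J)))"
      unfolding sum_distrib_left mult.assoc ..
    also have "\<dots> = 0"
    proof (cases "card (I - J) < q - 1")
      case False
      have "card (I - J) = card I - card J" using J by (simp add: card_Diff_subset)
      moreover have "card J \<le> card I" using J Suc.prems(1) by (simp add: card_mono)
      ultimately have "card J < d * (q - 1)" using Suc.prems(2) False by simp
      thus ?thesis using Suc.IH[OF J(2)] by simp
    qed (simp add: sum_\<iota>_power)
    finally show "(\<Sum>l\<in>UNIV. \<Sum>c\<in>lows d. (\<Prod>k\<in>J. y k + Cc c ^ (q ^ r k)) *
       (\<Prod>k\<in>I - J. \<iota> l * Cb d ^ (q ^ r k))) = 0" .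
  qed
  finally show ?case by simp
qed simp

lemma sum_q_powers: "(q - 1) * (\<Sum>r<b. q ^ r) = q ^ b - 1"
  by (induction b) (use q_ge_2 in \<open>auto simp: algebra_simps diff_mult_distrib\<close>)

text \<open>The exponent is q^b - 1 = (q - 1)(1 + q + ... + q^(b-1)), so the power is a product of b
  (q - 1) factors that are additive in \<open>c\<close>, fewer than d (q - 1).\<close>

lemma power_sum_lows:
  assumes "b < d"
  shows "(\<Sum>c\<in>lows d. Cc c ^ (q ^ b - 1)) = 0"
proof -
  define I where "I = {..<b} \<times> {..<q - 1}"
  have "card I < d * (q - 1)" unfolding I_def using assms q_ge_2 by simp
  hence "(\<Sum>c\<in>lows d. \<Prod>k\<in>I. (0 + Cc c ^ (q ^ fst k))) = 0"
    by (intro sum_prod_lows) (simp_all add: I_def)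
  moreover have "(\<Prod>k\<in>I. (0 + w ^ (q ^ fst k))) = w ^ (q ^ b - 1)" for w :: 'b
  proof -
    have "(\<Prod>k\<in>I. (0 + w ^ (q ^ fst k))) = w ^ (\<Sum>k\<in>I. q ^ fst k)" by (simp add: power_sum)
    also have "(\<Sum>k\<in>I. q ^ fst k) = (\<Sum>r<b. \<Sum>_<q - 1. q ^ r)"
      unfolding I_def sum.cartesian_product by (simp add: case_prod_unfold)
    also have "\<dots> = q ^ b - 1" by (simp add: sum_distrib_left[symmetric] sum_q_powers[simplified])
    finally show ?thesis .
  qed
  ultimately show ?thesis by simp
qed

lemma bij_smult_lows: "(l :: 'a) \<noteq> 0 \<Longrightarrow> bij_betw (smult l) (lows d) (lows d)"
  by (rule bij_betw_byWitness[where f' = "smult (inverse l)"]) (auto simp: lows_def)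

lemma add_add_diff: "x = b - t \<Longrightarrow> y + t + x = y + (b :: 'b)" by simp

text \<open>Since q - 1 divides the exponent, the summand does not change when \<open>c\<close> is
  multiplied by a unit of F_q. The sum over \<open>lows d\<close> is thus the term of c = 0 plus q -
  1 = -1 times the sum over the monic polynomials. The term of c = 0 is 1 for b = 0, by
  \<open>0 ^ 0 = 1\<close>, and 0 otherwise.\<close>

lemma power_sum_monics_aux:
  "(\<Sum>c\<in>monics_below d. Cc c ^ (q ^ b - 1)) + (\<Sum>c\<in>lows d. Cc c ^ (q ^ b - 1)) = 0 ^ (q ^ b - 1)"
proof (induction d)
  case (Suc d)
  let ?F = "\<lambda>c. Cc c ^ (q ^ b - 1)"
  have F: "?F (smult l c) = ?F c" if "l \<noteq> 0" for l c
  proof -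
    have "\<iota> l ^ (q ^ b - 1) * \<iota> l = \<iota> l ^ (q ^ b)" by (rule power_minus_mult) simp
    hence "\<iota> l ^ (q ^ b - 1) = 1" using that by simp
    thus ?thesis by (simp add: Cc_smult power_mult_distrib)
  qed
  have *: "(\<Sum>c\<in>lows d. ?F (c + monom l d)) = (\<Sum>c\<in>lows d. ?F (c + monom 1 d))" if "l \<noteq> 0" for l
  proof -
    have "(\<Sum>c\<in>lows d. ?F (c + monom l d)) = (\<Sum>c\<in>lows d. ?F (smult l c + monom l d))"
      by (rule sum.reindex_bij_betw[OF bij_smult_lows[OF that], symmetric])
    also have "\<dots> = (\<Sum>c\<in>lows d. ?F (smult l (c + monom 1 d)))"
      by (simp add: smult_add_right smult_monom)
    also have "\<dots> = (\<Sum>c\<in>lows d. ?F (c + monom 1 d))" by (intro sum.cong refl F[OF that])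
    finally show ?thesis .
  qed
  have "(\<Sum>c\<in>lows (Suc d). ?F c) = (\<Sum>c\<in>lows d. ?F (c + monom 0 d)) +
          (\<Sum>l\<in>UNIV - {0}. \<Sum>c\<in>lows d. ?F (c + monom l d))"
    unfolding sum_lows_Suc by (rule sum.remove) simp_all
  also have "(\<Sum>l\<in>UNIV - {0}. \<Sum>c\<in>lows d. ?F (c + monom l d)) =
      (\<Sum>l\<in>UNIV - {0 :: 'a}. \<Sum>c\<in>lows d. ?F (c + monom 1 d))"
    by (intro sum.cong refl *) simp
  also have "\<dots> = of_nat (q - 1) * (\<Sum>c\<in>lows d. ?F (c + monom 1 d))"
    by (simp add: q_def card_Diff_singleton)
  also have "of_nat (q - 1) = (- 1 :: 'b)"
  proof -
    have "of_nat n = \<iota> (of_nat n)" for n by (induction n) (simp_all add: \<iota>_1 \<iota>_add)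
    hence "of_nat q = \<iota> (of_nat q)" .
    also have "of_nat q = (0 :: 'a)" using sum_power_finite_field[of 0, where ?'a = 'a] q_ge_2 by (simp add: q_def)
    finally show ?thesis using q_ge_2 by (simp add: of_nat_diff)
  qed
  finally have "(\<Sum>c\<in>lows (Suc d). ?F c) = (\<Sum>c\<in>lows d. ?F c) - (\<Sum>c\<in>lows d. ?F (c + monom 1 d))"
    by (simp only: monom_0 minus_one_mult_self monom_eq_0 add_0_right mult_minus1 add_uminus_conv_diff)
  hence "(\<Sum>c\<in>monics_below (Suc d). ?F c) + (\<Sum>c\<in>lows (Suc d). ?F c) =
     (\<Sum>c\<in>monics_below d. ?F c) + (\<Sum>c\<in>lows d. ?F c)"
    unfolding sum_monics_below_Suc by (rule add_add_diff)
  thus ?case unfolding Suc .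
qed (simp add: lows_0 monics_below_0)

lemma power_sum_monics:
  assumes "b < d"
  shows "(\<Sum>c\<in>monics_below d. Cc c ^ (q ^ b - 1)) = (if b = 0 then 1 else 0)"
proof -
  have "q ^ b - 1 = 0 \<longleftrightarrow> b = 0"
    using one_less_power[of q b] q_ge_2 by (cases "b = 0") auto
  thus ?thesis using power_sum_monics_aux[of b d] power_sum_lows[OF assms] by (simp only: power_0_left add_0_right)
qed

end

subsection \<open>Sums over the monic polynomials of bounded degree\<close>

text \<open>The assumption says that \<open>xx\<close> is not a torsion point of the Carlitz module,
  so that the quotients \<open>1 / Cc c\<close> make sense; they stand for the u_c.\<close>

locale carlitz_lattice = carlitz_field +
  assumes Cc_nz: "c \<noteq> 0 \<Longrightarrow> Cc c \<noteq> 0"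
begin

lemma monic_nz: "c \<in> monics_below d \<Longrightarrow> c \<noteq> 0"
  by (auto simp: monics_below_def)

lemma Cc_monic_nz: "c \<in> monics_below d \<Longrightarrow> Cc c \<noteq> 0"
  using Cc_nz monic_nz by blast

lemma monics_lows: "c \<in> monics_below d \<Longrightarrow> d \<le> n \<Longrightarrow> c \<in> lows n"
  by (auto simp: monics_below_def lows_def coeff_eq_0)

lemma P_nz: "P d \<noteq> 0"
  using Cc_monic_nz by (simp add: P_def prod_zero_iff finite_monics_below)

lemma \<epsilon>_nz: "\<epsilon> d \<noteq> 0"
  using P_nz[of "Suc d"] by (auto simp: P_Suc)

text \<open>The coefficient of t^i in the sum of c(t) / C_c over the monic c of degree less than
  d.\<close>

definition y :: "nat \<Rightarrow> nat \<Rightarrow> 'b" where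
  "y d i = (\<Sum>c\<in>monics_below d. \<iota> (coeff c i) / Cc c)"

lemma y_ge: "i \<ge> d \<Longrightarrow> y d i = 0"
  unfolding y_def by (rule sum.neutral) (auto simp: monics_below_def coeff_eq_0)

lemma y_dual_aux:
  assumes "d \<le> n"
  shows "(\<Sum>i<n. y d i * Cb i ^ (q ^ b)) = (\<Sum>c\<in>monics_below d. Cc c ^ (q ^ b - 1))"
proof -
  have "(\<Sum>i<n. y d i * Cb i ^ (q ^ b)) =
        (\<Sum>c\<in>monics_below d. \<Sum>i<n. \<iota> (coeff c i) / Cc c * Cb i ^ (q ^ b))"
    unfolding y_def sum_distrib_right by (rule sum.swap)
  also have "\<dots> = (\<Sum>c\<in>monics_below d. Cc c ^ (q ^ b - 1))"
  proof (rule sum.cong[OF refl])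
    fix c :: "'a poly" assume c: "c \<in> monics_below d"
    have "Cc c ^ (q ^ b) = (\<Sum>i<n. \<iota> (coeff c i) * Cb i ^ (q ^ b))"
      unfolding Cc_lows[OF monics_lows[OF c assms]] frob_sum power_mult_distrib by simp
    hence "(\<Sum>i<n. \<iota> (coeff c i) / Cc c * Cb i ^ (q ^ b)) = Cc c ^ (q ^ b) / Cc c"
      by (simp add: sum_divide_distrib)
    also have "Cc c ^ (q ^ b) = Cc c ^ (q ^ b - 1) * Cc c"
      by (rule power_minus_mult[symmetric]) simp
    finally show "(\<Sum>i<n. \<iota> (coeff c i) / Cc c * Cb i ^ (q ^ b)) = Cc c ^ (q ^ b - 1)"
      using Cc_monic_nz[OF c] by simp
  qed
  finally show ?thesis .
qed

text \<open>Pairing \<open>y d\<close> with row b of the Moore matrix \<open>Cb i ^ (q ^ b)\<close>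
  reassembles C_c^(q^b) / C_c, whose sum over the monic c is a known power sum.\<close>

lemma y_dual:
  assumes "b < d" "d \<le> n"
  shows "(\<Sum>i<n. y d i * Cb i ^ (q ^ b)) = (if b = 0 then 1 else 0)"
  using y_dual_aux[OF assms(2)] power_sum_monics[OF assms(1)] by simp

lemma y_dual_q:
  assumes "d \<le> n"
  shows "(\<Sum>i<n. y d i ^ q * Cb i) = (\<Sum>c\<in>monics_below d. (1 / Cc c) ^ (q - 1))"
proof -
  have "(\<Sum>i<n. y d i ^ q * Cb i) =
        (\<Sum>i<n. \<Sum>c\<in>monics_below d. \<iota> (coeff c i) / Cc c ^ q * Cb i)"
    unfolding y_def frob1 sum_distrib_right by (simp add: power_divide)
  also have "\<dots> = (\<Sum>c\<in>monics_below d. \<Sum>i<n. \<iota> (coeff c i) / Cc c ^ q * Cb i)"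
    by (rule sum.swap)
  also have "\<dots> = (\<Sum>c\<in>monics_below d. (1 / Cc c) ^ (q - 1))"
  proof (rule sum.cong[OF refl])
    fix c :: "'a poly" assume c: "c \<in> monics_below d"
    have "(\<Sum>i<n. \<iota> (coeff c i) / Cc c ^ q * Cb i) = Cc c / Cc c ^ q"
      by (simp add: Cc_lows[OF monics_lows[OF c assms]] sum_divide_distrib)
    also have "\<dots> = Cc c / (Cc c ^ (q - 1) * Cc c)"
      by (subst power_minus_mult) simp_all
    finally have "(\<Sum>i<n. \<iota> (coeff c i) / Cc c ^ q * Cb i) = Cc c / (Cc c ^ (q - 1) * Cc c)" .
    also have "\<dots> = (1 / Cc c) ^ (q - 1)"
      using Cc_monic_nz[OF c] by (simp add: power_divide)
    finally show "(\<Sum>i<n. \<iota> (coeff c i) / Cc c ^ q * Cb i) = (1 / Cc c) ^ (q - 1)" .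
  qed
  finally show ?thesis .
qed

text \<open>
  For \<open>d \<rightarrow> \<infinity>\<close> the limit of \<open>gl d\<close> is \<open>g\<close>, and that of \<open>H d\<close> below is \<open>-h\<close>.
\<close>

definition gl :: "nat \<Rightarrow> 'b" where
  "gl d = 1 - (th ^ q - th) * (\<Sum>c\<in>monics_below d. (1 / Cc c) ^ (q - 1))"

text \<open>The coefficient of t^i in \<open>gl d\<close> Y_(d+1)(t) + (\<theta>^q - t) Y_d(t)',
  where Y_d has the coefficients \<open>y d i\<close> and the prime stands for q-th powers of the
  coefficients. Such a power raises the row index of a pairing by one, which is why level d there
  goes with level d + 1 in the first term.\<close>

definition z :: "nat \<Rightarrow> nat \<Rightarrow> 'b" where
  "z d i = gl d * y (Suc d) i + th ^ q * y d i ^ q - (case i of 0 \<Rightarrow> 0 | Suc i' \<Rightarrow> y d i' ^ q)"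

definition H :: "nat \<Rightarrow> 'b" where "H d = P d ^ (q ^ 2) / P (Suc d)"

lemma pairing_e:
  "(\<Sum>i<n. v i * e d (Cb i)) = (\<Sum>b\<le>d. a d b * (\<Sum>i<n. v i * Cb i ^ (q ^ b)))"
  unfolding e_expand sum_distrib_left by (subst sum.swap) (simp add: mult_ac)

lemma pairing_e_top: "(\<Sum>i<Suc d. v i * e d (Cb i)) = v d * \<epsilon> d"
  by (simp add: e_Cb \<epsilon>_def)

lemma sum_a_delta:
  "(\<Sum>b\<le>d. a d b * (if b = 0 then x else 0)) = a d 0 * x"
proof -
  have "(\<Sum>b\<le>d. a d b * (if b = 0 then x else 0)) = (\<Sum>b\<le>d. if b = 0 then a d 0 * x else 0)"
    by (intro sum.cong) auto
  thus ?thesis by simp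
qed

lemma sum_a_top:
  "(\<Sum>b\<le>d. a d b * (if b < d then 0 else x)) = x"
proof -
  have "(\<Sum>b\<le>d. a d b * (if b < d then 0 else x)) = (\<Sum>b\<le>d. if b = d then x else 0)"
    by (intro sum.cong) auto
  thus ?thesis by simp
qed

text \<open>Row d is the first one where the duality fails. The value there is forced by the
  additive polynomial \<open>e d\<close>, which vanishes at all \<open>Cb i\<close> with i <
  d.\<close>

lemma power_sum_top:
  assumes "d \<ge> 1"
  shows "(\<Sum>i<d. y d i * Cb i ^ (q ^ d)) = - a d 0"
proof -
  have "0 = (\<Sum>i<d. y d i * e d (Cb i))" by (simp add: e_Cb)
  also have "\<dots> = (\<Sum>b\<le>d. a d b * (\<Sum>i<d. y d i * Cb i ^ (q ^ b)))"
    by (rule pairing_e)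
  also have "\<dots> = (\<Sum>b<d. a d b * (if b = 0 then 1 else 0)) + (\<Sum>i<d. y d i * Cb i ^ (q ^ d))"
    unfolding lessThan_Suc_atMost[symmetric] sum.lessThan_Suc by (simp add: y_dual)
  also have "(\<Sum>b<d. a d b * (if b = 0 then 1 else 0)) = (\<Sum>b<d. if b = 0 then a d 0 else 0)"
    by (intro sum.cong) auto
  also have "\<dots> = a d 0" using assms by simp
  finally show ?thesis by (simp add: eq_neg_iff_add_eq_0 add.commute)
qed

text \<open>A q-th power turns a pairing with row b into one with row b + 1, and the shift of i is
  undone by the recursion of \<open>Cb\<close>. The terms with \<theta> vanish or cancel for b \<ge>
  1, and for b = 0 they cancel by the choice of \<open>gl d\<close>. Only row d sees the failure of
  the duality.\<close>

lemma z_dual: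
  assumes d: "d \<ge> 1" and b: "b \<le> d"
  shows "(\<Sum>i<Suc d. z d i * Cb i ^ (q ^ b)) = (if b < d then 0 else a d 0 ^ q)"
proof -
  define U where "U b = (\<Sum>i<d. y d i ^ q * Cb i ^ (q ^ b))" for b
  have U_Suc: "U (Suc b) = (\<Sum>i<d. y d i * Cb i ^ (q ^ b)) ^ q" for b
    unfolding U_def frob1 power_mult_distrib by (simp add: mult.commute flip: power_mult)
  have "(\<Sum>i<Suc d. z d i * Cb i ^ (q ^ b)) =
     gl d * (\<Sum>i<Suc d. y (Suc d) i * Cb i ^ (q ^ b)) + th ^ q * (\<Sum>i<Suc d. y d i ^ q * Cb i ^ (q ^ b))
     - (\<Sum>i<Suc d. (case i of 0 \<Rightarrow> 0 | Suc i' \<Rightarrow> y d i' ^ q) * Cb i ^ (q ^ b))"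
    unfolding z_def sum_distrib_left sum_subtractf[symmetric] sum.distrib[symmetric]
    by (intro sum.cong refl) (simp add: algebra_simps)
  also have "(\<Sum>i<Suc d. y (Suc d) i * Cb i ^ (q ^ b)) = (if b = 0 then 1 else 0)"
    by (rule y_dual) (use b in auto)
  also have "(\<Sum>i<Suc d. y d i ^ q * Cb i ^ (q ^ b)) = U b"
    by (simp add: U_def y_ge power_0_left)
  also have "(\<Sum>i<Suc d. (case i of 0 \<Rightarrow> 0 | Suc i' \<Rightarrow> y d i' ^ q) * Cb i ^ (q ^ b)) =
      (\<Sum>i<d. y d i ^ q * (th * Cb i + Cb i ^ q) ^ (q ^ b))"
    unfolding sum.lessThan_Suc_shift by simp
  also have "\<dots> = (\<Sum>i<d. th ^ (q ^ b) * (y d i ^ q * Cb i ^ (q ^ b)) + y d i ^ q * Cb i ^ (q ^ Suc b))"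
    by (intro sum.cong refl) (simp add: frob_power power_mult_distrib algebra_simps flip: power_mult)
  also have "\<dots> = th ^ (q ^ b) * U b + U (Suc b)"
    unfolding sum.distrib U_def sum_distrib_left by (rule refl)
  finally have *: "(\<Sum>i<Suc d. z d i * Cb i ^ (q ^ b)) =
      gl d * (if b = 0 then 1 else 0) + th ^ q * U b - (th ^ (q ^ b) * U b + U (Suc b))" .
  have U1: "U (Suc b) = (if b = 0 then 1 else 0)" if "b < d" for b
    using y_dual[OF that order.refl] by (simp add: U_Suc power_0_left)
  have Ud: "U (Suc d) = - (a d 0 ^ q)"
    using power_sum_top[OF d] by (simp add: U_Suc frob1)
  show ?thesis
  proof (cases b)
    case 0
    have "U 0 = (\<Sum>c\<in>monics_below d. (1 / Cc c) ^ (q - 1))"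
      using y_dual_q[of d d] by (simp add: U_def)
    hence "gl d = 1 - (th ^ q - th) * U 0" by (simp add: gl_def)
    moreover have "U (Suc b) = 1" using U1[of 0] d 0 by simp
    ultimately have "gl d * 1 + th ^ q * U 0 - (th * U 0 + U (Suc b)) = 0"
      by (simp add: algebra_simps)
    thus ?thesis unfolding * using 0 d by simp
  next
    case (Suc b')
    have "th ^ q * U b = th ^ (q ^ b) * U b"
      using U1[of b'] Suc b by (cases "b' = 0") auto
    hence "(\<Sum>i<Suc d. z d i * Cb i ^ (q ^ b)) = - U (Suc b)"
      unfolding * using Suc by simp
    thus ?thesis using Suc U1[of b] Ud b by (cases "b < d") auto
  qed
qed

text \<open>Combining the rows with the coefficients of \<open>e d\<close> isolates the last entry
  of \<open>v\<close>, multiplied by \<open>\<epsilon> d\<close>, which is not zero; then the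
  induction descends.\<close>

lemma moore_unique:
  assumes "\<And>b. b \<le> d \<Longrightarrow> (\<Sum>i<Suc d. v i * Cb i ^ (q ^ b)) = 0" "i \<le> d"
  shows "v i = 0"
  using assms
proof (induction d)
  case (Suc d)
  have "v (Suc d) * \<epsilon> (Suc d) = 0"
    unfolding pairing_e_top[symmetric] pairing_e using Suc.prems(1) by simp
  hence v: "v (Suc d) = 0" using \<epsilon>_nz by simp
  show ?case
  proof (cases "i = Suc d")
    case False
    show ?thesis
      by (rule Suc.IH) (use Suc.prems v False in \<open>auto simp: le_Suc_eq\<close>)
  qed (use v in simp)
next
  case 0
  thus ?case using \<epsilon>_nz[of 0] 0(1)[of 0] by (simp add: \<epsilon>_def)
qed

lemma z_top:
  assumes "d \<ge> 1"
  shows "z d d * \<epsilon> d = a d 0 ^ q"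
proof -
  have "z d d * \<epsilon> d = (\<Sum>b\<le>d. a d b * (if b < d then 0 else a d 0 ^ q))"
    unfolding pairing_e_top[symmetric] pairing_e
    by (intro sum.cong refl) (simp only: z_dual[OF assms] atMost_iff)
  thus ?thesis by (simp only: sum_a_top)
qed

lemma y_top: "y (Suc d) d * \<epsilon> d = a d 0"
proof -
  have "y (Suc d) d * \<epsilon> d = (\<Sum>b\<le>d. a d b * (if b = 0 then 1 else 0))"
    unfolding pairing_e_top[symmetric] pairing_e
    by (intro sum.cong refl) (subst y_dual, auto)
  thus ?thesis by (simp only: sum_a_delta mult_1_right)
qed

lemma neg_one_q: "(-1 :: 'b) ^ q = -1" by (simp add: frob1)

lemma a_0_nz: "a d 0 \<noteq> 0"
  using \<epsilon>_nz by (simp add: a_0)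

lemma H_nz: "H d \<noteq> 0" using P_nz by (simp add: H_def)

lemma H_q: "H d ^ (q - 1) * (a d 0 * \<epsilon> d ^ q) = a d 0 ^ q ^ 2 * \<epsilon> d"
proof -
  have *: "((-1) ^ d) ^ q = ((-1 :: 'b) ^ d)"
  proof -
    have "((-1) ^ d) ^ q = ((-1 :: 'b) ^ q) ^ d" by (simp only: power_mult[symmetric] mult.commute)
    thus ?thesis by (simp only: neg_one_q)
  qed
  have **: "((-1) ^ d) ^ (q ^ 2) = ((-1 :: 'b) ^ d)"
    by (simp only: power2_eq_square power_mult *)
  have "a d 0 ^ q ^ 2 = (-1) ^ d * (P d ^ (q ^ 2)) ^ (q - 1)"
    unfolding a_0 P_eq[symmetric] power_mult_distrib **
    by (simp only: power_mult[symmetric] mult.commute)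
  moreover have "a d 0 = (-1) ^ d * P d ^ (q - 1)" by (simp add: a_0 P_eq)
  moreover have "H d ^ (q - 1) = (P d ^ (q ^ 2)) ^ (q - 1) / (P d ^ (q - 1) * \<epsilon> d ^ (q - 1))"
    by (simp add: H_def P_Suc power_divide power_mult_distrib)
  moreover have "\<epsilon> d ^ q = \<epsilon> d ^ (q - 1) * \<epsilon> d"
    by (rule power_minus_mult[symmetric]) simp
  ultimately show ?thesis using P_nz \<epsilon>_nz by simp
qed

text \<open>By \<open>z_dual\<close> the q-th powers of the entries of \<open>z d\<close> pair to 0
  with every row except the first, as do the multiples of \<open>y (Suc d)\<close>. Hence the two
  vectors are proportional, and the factor can be read off from their last entries.\<close>

theorem z_power:
  assumes d: "d \<ge> 1" and i: "i \<le> d"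
  shows "z d i ^ q = H d ^ (q - 1) * y (Suc d) i"
proof -
  define \<kappa> where "\<kappa> = (\<Sum>i<Suc d. z d i ^ q * Cb i)"
  have v0: "z d i ^ q - \<kappa> * y (Suc d) i = 0" if "i \<le> d" for i
  proof (rule moore_unique[of d, OF _ that])
    fix b assume b: "b \<le> d"
    have "(\<Sum>i<Suc d. (z d i ^ q - \<kappa> * y (Suc d) i) * Cb i ^ q ^ b) =
       (\<Sum>i<Suc d. z d i ^ q * Cb i ^ q ^ b) - \<kappa> * (\<Sum>i<Suc d. y (Suc d) i * Cb i ^ q ^ b)"
      unfolding sum_distrib_left sum_subtractf[symmetric] by (simp add: algebra_simps)
    also have "(\<Sum>i<Suc d. y (Suc d) i * Cb i ^ q ^ b) = (if b = 0 then 1 else 0)"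
      by (rule y_dual) (use b in auto)
    also have "(\<Sum>i<Suc d. z d i ^ q * Cb i ^ q ^ b) = (if b = 0 then \<kappa> else 0)"
    proof (cases b)
      case (Suc b')
      have "(\<Sum>i<Suc d. z d i ^ q * Cb i ^ q ^ b) = (\<Sum>i<Suc d. z d i * Cb i ^ q ^ b') ^ q"
        unfolding Suc frob1 power_mult_distrib by (simp add: mult.commute flip: power_mult)
      also have "\<dots> = 0" using z_dual[OF d, of b'] Suc b by (simp add: power_0_left)
      finally show ?thesis using Suc by simp
    qed (simp add: \<kappa>_def)
    finally show "(\<Sum>i<Suc d. (z d i ^ q - \<kappa> * y (Suc d) i) * Cb i ^ q ^ b) = 0" by simp
  qed
  have "z d d ^ q * (\<epsilon> d ^ q * \<epsilon> d) = \<kappa> * (y (Suc d) d * \<epsilon> d) * \<epsilon> d ^ q"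
    using v0[of d] by simp
  also have "z d d ^ q * (\<epsilon> d ^ q * \<epsilon> d) = (z d d * \<epsilon> d) ^ q * \<epsilon> d"
    by (simp add: power_mult_distrib)
  finally have "\<kappa> * (a d 0 * \<epsilon> d ^ q) = a d 0 ^ q ^ 2 * \<epsilon> d"
    unfolding y_top z_top[OF d] by (simp add: power2_eq_square mult_ac flip: power_mult)
  hence "\<kappa> = H d ^ (q - 1)"
    unfolding H_q[symmetric] using a_0_nz \<epsilon>_nz by simp
  thus ?thesis using v0[OF i] by simp
qed

section \<open>The value of the vector z at \<theta>\<close>

primrec R :: "nat \<Rightarrow> 'b" where
  "R 0 = xx"
| "R (Suc b) = xx ^ (q ^ Suc b) - (th ^ (q ^ Suc b) - th) * R b"

definition \<Theta> :: "nat \<Rightarrow> 'b" where "\<Theta> d = (\<Sum>b\<le>d. a d b ^ q * R b)"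

text \<open>The \<open>t i\<close> are Horner's coefficients for the division of the polynomial with
  coefficients \<open>z d i\<close> by t - \<theta>, and \<open>\<zeta>\<close> is the remainder.
  Pairing the quotient with the Moore matrix turns \<open>z_dual\<close> into a recursion in b,
  which is solved by the multiples of \<open>R b\<close>. Applying the additive polynomials of
  levels d and d - 1 gives the two equations.\<close>

lemma zeta_\<Theta>:
  assumes d: "d \<ge> 1"
  defines "\<zeta> \<equiv> (\<Sum>i<Suc d. th ^ i * z d i)"
  shows "\<zeta> * \<Theta> d = a d 0 ^ q" "\<zeta> * \<Theta> (d - 1) = - z d d * \<epsilon> (d - 1) ^ q"
proof -
  define t where "t i = (\<Sum>k=i..d. th ^ (k - i) * z d k)" for i
  have t0: "t 0 = \<zeta>" unfolding t_def \<zeta>_def by (rule sum.cong) auto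
  have td: "t d = z d d" by (simp add: t_def)
  have z_t: "z d i = t i - th * t (Suc i)" if "i \<le> d" for i
  proof -
    have "t i = th ^ (i - i) * z d i + (\<Sum>k=Suc i..d. th ^ (k - i) * z d k)"
      unfolding t_def by (rule sum.atLeast_Suc_atMost) fact
    also have "(\<Sum>k=Suc i..d. th ^ (k - i) * z d k) = (\<Sum>k=Suc i..d. th * (th ^ (k - Suc i) * z d k))"
    proof (rule sum.cong[OF refl])
      fix k assume "k \<in> {Suc i..d}"
      hence "k - i = Suc (k - Suc i)" by auto
      thus "th ^ (k - i) * z d k = th * (th ^ (k - Suc i) * z d k)" by simp
    qed
    finally show ?thesis by (simp add: t_def sum_distrib_left)
  qed
  have t_Suc: "t (Suc d) = 0" by (simp add: t_def)
  define T where "T b = (\<Sum>i<d. t (Suc i) * Cb i ^ (q ^ b))" for b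
  have L: "(\<Sum>i<Suc d. z d i * Cb i ^ (q ^ b)) = \<zeta> * xx ^ (q ^ b) + (th ^ (q ^ b) - th) * T b + T (Suc b)" for b
  proof -
    have "(\<Sum>i<Suc d. z d i * Cb i ^ (q ^ b)) =
        (\<Sum>i<Suc d. t i * Cb i ^ (q ^ b)) - th * (\<Sum>i<Suc d. t (Suc i) * Cb i ^ (q ^ b))"
      unfolding sum_distrib_left sum_subtractf[symmetric]
      by (intro sum.cong refl) (simp add: z_t algebra_simps)
    also have "(\<Sum>i<Suc d. t (Suc i) * Cb i ^ (q ^ b)) = T b" by (simp add: t_Suc T_def)
    also have "(\<Sum>i<Suc d. t i * Cb i ^ (q ^ b)) = 
        \<zeta> * xx ^ (q ^ b) + (\<Sum>i<d. t (Suc i) * (th * Cb i + Cb i ^ q) ^ (q ^ b))"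
      unfolding sum.lessThan_Suc_shift by (simp add: t0)
    also have "(\<Sum>i<d. t (Suc i) * (th * Cb i + Cb i ^ q) ^ (q ^ b)) = th ^ (q ^ b) * T b + T (Suc b)"
      unfolding T_def sum_distrib_left sum.distrib[symmetric]
      by (intro sum.cong refl) (simp add: frob_power power_mult_distrib algebra_simps flip: power_mult)
    finally show ?thesis by (simp add: algebra_simps)
  qed
  have T_R: "T (Suc b) = - (\<zeta> * R b)" if "b < d" for b
    using that
  proof (induction b)
    case 0
    thus ?case using L[of 0] z_dual[OF d, of 0] d by (simp add: eq_neg_iff_add_eq_0 add.commute)
  next
    case (Suc b)
    have "\<zeta> * xx ^ (q ^ Suc b) + (th ^ (q ^ Suc b) - th) * T (Suc b) + T (Suc (Suc b)) = 0"
      using L[of "Suc b"] z_dual[OF d, of "Suc b"] Suc.prems by simp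
    hence "T (Suc (Suc b)) = - (\<zeta> * xx ^ (q ^ Suc b) + (th ^ (q ^ Suc b) - th) * T (Suc b))"
      by (simp only: eq_neg_iff_add_eq_0 add.commute)
    thus ?case using Suc by (simp add: algebra_simps)
  qed
  have T_d: "T (Suc d) = a d 0 ^ q - \<zeta> * R d"
  proof -
    obtain d' where d': "d = Suc d'" using d by (cases d) auto
    have "\<zeta> * xx ^ (q ^ d) + (th ^ (q ^ d) - th) * T d + T (Suc d) = a d 0 ^ q"
      using L[of d] z_dual[OF d, of d] by simp
    hence "T (Suc d) = a d 0 ^ q - (\<zeta> * xx ^ (q ^ d) + (th ^ (q ^ d) - th) * T d)"
      by (simp add: eq_diff_eq add.commute)
    thus ?thesis using T_R[of d'] unfolding d' by (simp add: algebra_simps)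
  qed
  have e_T: "(\<Sum>i<d. t (Suc i) * e m (Cb i) ^ q) = (\<Sum>b\<le>m. a m b ^ q * T (Suc b))" for m
  proof -
    have "(\<Sum>i<d. t (Suc i) * e m (Cb i) ^ q) = (\<Sum>i<d. \<Sum>b\<le>m. t (Suc i) * (a m b ^ q * Cb i ^ (q ^ Suc b)))"
      unfolding e_expand frob1 power_mult_distrib sum_distrib_left
      by (simp add: mult.commute flip: power_mult)
    also have "\<dots> = (\<Sum>b\<le>m. \<Sum>i<d. t (Suc i) * (a m b ^ q * Cb i ^ (q ^ Suc b)))" by (rule sum.swap)
    also have "\<dots> = (\<Sum>b\<le>m. a m b ^ q * T (Suc b))"
      unfolding T_def sum_distrib_left by (simp add: mult_ac)
    finally show ?thesis .
  qed
  have "0 = (\<Sum>b\<le>d. a d b ^ q * T (Suc b))"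
    unfolding e_T[symmetric] by (simp add: e_Cb power_0_left)
  also have "\<dots> = (\<Sum>b<d. a d b ^ q * T (Suc b)) + T (Suc d)"
    unfolding lessThan_Suc_atMost[symmetric] by simp
  also have "(\<Sum>b<d. a d b ^ q * T (Suc b)) = - \<zeta> * (\<Sum>b<d. a d b ^ q * R b)"
    unfolding sum_distrib_left by (intro sum.cong refl) (simp add: T_R)
  also have "(\<Sum>b<d. a d b ^ q * R b) = \<Theta> d - R d"
    unfolding \<Theta>_def lessThan_Suc_atMost[symmetric] by simp
  finally show "\<zeta> * \<Theta> d = a d 0 ^ q" by (simp add: T_d algebra_simps)
  obtain d' where d': "d = Suc d'" using d by (cases d) auto
  have "- (\<zeta> * \<Theta> d') = (\<Sum>b\<le>d'. a d' b ^ q * T (Suc b))"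
    unfolding \<Theta>_def sum_distrib_left sum_negf[symmetric]
    by (intro sum.cong refl) (simp add: T_R d')
  also have "\<dots> = t d * \<epsilon> d' ^ q"
    unfolding e_T[symmetric] d' by (simp add: e_Cb \<epsilon>_def power_0_left)
  finally show "\<zeta> * \<Theta> (d - 1) = - z d d * \<epsilon> (d - 1) ^ q" using td unfolding d' by (simp add: minus_equation_iff[of "\<zeta> * \<Theta> d'"] eq_commute[of "- _"])
qed

text \<open>Both equations of \<open>zeta_\<Theta>\<close> at level d + 1 contain the same unknown
  \<open>\<zeta>\<close>. Eliminating it determines \<open>\<Theta>\<close> recursively, and with
  \<open>\<Theta>\<close> known, the first equation determines \<open>\<zeta>\<close>.\<close>

lemma \<Theta>_Suc: "\<Theta> (Suc d) * \<epsilon> d ^ q = - \<Theta> d * \<epsilon> (Suc d)"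
proof -
  define \<zeta> where "\<zeta> = (\<Sum>i<Suc (Suc d). th ^ i * z (Suc d) i)"
  have 1: "\<zeta> * \<Theta> (Suc d) = a (Suc d) 0 ^ q" "\<zeta> * \<Theta> d = - z (Suc d) (Suc d) * \<epsilon> d ^ q"
    using zeta_\<Theta>[of "Suc d"] unfolding \<zeta>_def by simp_all
  have nz: "\<zeta> \<noteq> 0" using 1(1) a_0_nz[of "Suc d"] by auto
  have "\<zeta> * (\<Theta> (Suc d) * \<epsilon> d ^ q) = (z (Suc d) (Suc d) * \<epsilon> (Suc d)) * \<epsilon> d ^ q"
    using 1(1) z_top[of "Suc d"] by (simp only: mult.assoc[symmetric])
  also have "\<dots> = \<zeta> * (- \<Theta> d * \<epsilon> (Suc d))"
    unfolding mult.assoc[symmetric] mult_minus_right 1(2) by (simp add: mult_ac)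
  finally show ?thesis using nz by (simp only: mult_cancel_left) simp
qed

lemma \<Theta>_eq: "\<Theta> d * P d ^ q = (-1) ^ d * P (Suc d)"
proof (induction d)
  case 0
  show ?case by (simp add: \<Theta>_def P_Suc \<epsilon>_def)
next
  case (Suc d)
  have "\<Theta> (Suc d) * P (Suc d) ^ q = (\<Theta> (Suc d) * \<epsilon> d ^ q) * P d ^ q"
    by (simp add: P_Suc[of d] power_mult_distrib mult_ac)
  also have "\<dots> = - (\<Theta> d * P d ^ q) * \<epsilon> (Suc d)"
    unfolding \<Theta>_Suc by (simp add: mult_ac)
  also have "\<dots> = (-1) ^ Suc d * P (Suc (Suc d))"
    unfolding Suc by (simp add: P_Suc[of "Suc d"])
  finally show ?case .
qed

theorem z_sum:
  assumes "d \<ge> 1"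
  shows "(\<Sum>i<Suc d. th ^ i * z d i) = H d"
proof -
  define \<zeta> where "\<zeta> = (\<Sum>i<Suc d. th ^ i * z d i)"
  have s: "((-1) ^ d) ^ q = ((-1 :: 'b) ^ d)"
  proof -
    have "((-1) ^ d) ^ q = ((-1 :: 'b) ^ q) ^ d" by (simp only: power_mult[symmetric] mult.commute)
    thus ?thesis by (simp only: neg_one_q)
  qed
  have "\<zeta> * ((-1) ^ d * P (Suc d)) = (\<zeta> * \<Theta> d) * P d ^ q"
    by (simp only: \<Theta>_eq[symmetric] mult.assoc)
  also have "\<zeta> * \<Theta> d = a d 0 ^ q" using zeta_\<Theta>(1)[OF assms] by (simp add: \<zeta>_def)
  also have "a d 0 ^ q = (-1) ^ d * (P d ^ (q - 1)) ^ q"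
    by (simp add: a_0 P_eq power_mult_distrib s)
  also have "(-1) ^ d * (P d ^ (q - 1)) ^ q * P d ^ q = (-1) ^ d * (P d ^ (q - 1) * P d) ^ q"
    by (simp add: power_mult_distrib)
  also have "P d ^ (q - 1) * P d = P d ^ q" by (rule power_minus_mult) simp
  also have "(P d ^ q) ^ q = P d ^ q ^ 2" by (simp add: power2_eq_square flip: power_mult)
  finally have "(-1) ^ d * (\<zeta> * P (Suc d)) = (-1) ^ d * P d ^ q ^ 2" by (simp only: mult_ac)
  hence "\<zeta> * P (Suc d) = P d ^ q ^ 2" by simp
  thus ?thesis using P_nz unfolding \<zeta>_def[symmetric] H_def by (simp add: eq_divide_eq)
qed

end

subsection \<open>Limits of power series\<close>

hide_const (open) Divisibility.prime

text \<open>Congruence modulo X^(m+1). It is compatible with products, and convergence of power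
  series is eventual agreement to every order m.\<close>

definition fps_agree :: "nat \<Rightarrow> 'b::zero fps \<Rightarrow> 'b fps \<Rightarrow> bool" where
  "fps_agree m f g \<longleftrightarrow> (\<forall>j\<le>m. fps_nth f j = fps_nth g j)"

lemma fps_agree_refl [simp]: "fps_agree m f f" by (simp add: fps_agree_def)

lemma fps_agree_mult:
  fixes f g :: "'b::comm_ring_1 fps"
  assumes "fps_agree m f f'" "fps_agree m g g'"
  shows "fps_agree m (f * g) (f' * g')"
  using assms by (auto simp: fps_agree_def fps_mult_nth intro!: sum.cong)

lemma fps_agree_prod:
  fixes f g :: "'c \<Rightarrow> 'b::comm_ring_1 fps"
  assumes "\<And>x. x \<in> A \<Longrightarrow> fps_agree m (f x) (g x)"
  shows "fps_agree m (prod f A) (prod g A)"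
  using assms by (induction A rule: infinite_finite_induct) (auto intro: fps_agree_mult)

lemma tendsto_fps_iff_agree:
  fixes L :: "'b::group_add fps"
  shows "(f \<longlongrightarrow> L) F \<longleftrightarrow> (\<forall>m. eventually (\<lambda>x. fps_agree m (f x) L) F)"
proof
  assume "(f \<longlongrightarrow> L) F"
  hence *: "eventually (\<lambda>x. fps_nth (f x) n = fps_nth L n) F" for n
    by (auto simp: tendsto_fps_iff)
  show "\<forall>m. eventually (\<lambda>x. fps_agree m (f x) L) F"
  proof
    fix m
    have "eventually (\<lambda>x. \<forall>n\<in>{..m}. fps_nth (f x) n = fps_nth L n) F"
      by (subst eventually_ball_finite_distrib) (use * in auto)
    thus "eventually (\<lambda>x. fps_agree m (f x) L) F"
      by eventually_elim (auto simp: fps_agree_def)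
  qed
next
  assume *: "\<forall>m. eventually (\<lambda>x. fps_agree m (f x) L) F"
  show "(f \<longlongrightarrow> L) F"
  proof (rule tendsto_fpsI)
    fix n
    from * have "eventually (\<lambda>x. fps_agree n (f x) L) F" by blast
    thus "eventually (\<lambda>x. fps_nth (f x) n = fps_nth L n) F"
      by eventually_elim (auto simp: fps_agree_def)
  qed
qed

lemma tendsto_mult_fps:
  fixes L M :: "'b::comm_ring_1 fps"
  assumes "(f \<longlongrightarrow> L) F" "(g \<longlongrightarrow> M) F"
  shows "((\<lambda>x. f x * g x) \<longlongrightarrow> L * M) F"
  unfolding tendsto_fps_iff_agree
proof
  fix m
  have "eventually (\<lambda>x. fps_agree m (f x) L) F" "eventually (\<lambda>x. fps_agree m (g x) M) F"
    using assms by (auto simp: tendsto_fps_iff_agree)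
  thus "eventually (\<lambda>x. fps_agree m (f x * g x) (L * M)) F"
    by eventually_elim (rule fps_agree_mult)
qed

lemma tendsto_power_fps:
  fixes L :: "'b::comm_ring_1 fps"
  assumes "(f \<longlongrightarrow> L) F"
  shows "((\<lambda>x. f x ^ n) \<longlongrightarrow> L ^ n) F"
  by (induction n) (auto intro: tendsto_mult_fps assms)

lemma tendsto_add_fps:
  fixes L M :: "'b::comm_ring_1 fps"
  assumes "(f \<longlongrightarrow> L) F" "(g \<longlongrightarrow> M) F"
  shows "((\<lambda>x. f x + g x) \<longlongrightarrow> L + M) F"
  unfolding tendsto_fps_iff
proof
  fix m
  have "eventually (\<lambda>x. fps_nth (f x) m = fps_nth L m) F" 
       "eventually (\<lambda>x. fps_nth (g x) m = fps_nth M m) F"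
    using assms by (auto simp: tendsto_fps_iff)
  thus "eventually (\<lambda>x. fps_nth (f x + g x) m = fps_nth (L + M) m) F"
    by eventually_elim simp
qed

lemma tendsto_uminus_fps:
  fixes L :: "'b::comm_ring_1 fps"
  assumes "(f \<longlongrightarrow> L) F"
  shows "((\<lambda>x. - f x) \<longlongrightarrow> - L) F"
  using tendsto_mult_fps[OF tendsto_const[of "-1"] assms] by simp

lemma tendsto_diff_fps:
  fixes L M :: "'b::comm_ring_1 fps"
  assumes "(f \<longlongrightarrow> L) F" "(g \<longlongrightarrow> M) F"
  shows "((\<lambda>x. f x - g x) \<longlongrightarrow> L - M) F"
  using tendsto_add_fps[OF assms(1) tendsto_uminus_fps[OF assms(2)]] by simp

lemma eventually_sequentially_fps_eq:
  fixes L :: "'b::group_add fps"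
  assumes "\<And>m. \<exists>N. \<forall>n\<ge>N. fps_nth (f n) m = fps_nth L m"
  shows "f \<longlonglongrightarrow> L"
  using assms by (intro tendsto_fpsI) (auto simp: eventually_sequentially)

lemma fps_to_fls_fps_of_poly:
  "fps_to_fls (fps_of_poly f) = poly (map_poly fls_const f) (fls_X :: 'b::field fls)"
proof (induction f)
  case (pCons a f)
  thus ?case
    by (simp add: map_poly_pCons fps_of_poly_pCons fls_times_fps_to_fls fps_to_fls_plus mult.commute)
qed simp

lemma pcompose_monom: "pcompose (monom c n) f = smult c (f ^ n)"
  by (induction n) (simp_all add: monom_0 monom_Suc pcompose_pCons)

subsection \<open>The \<open>u\<close>-expansions\<close>

locale drinfeld =
  fixes F :: "'a::finite_field itself" and p e q :: nat
  assumes prime_p: "prime p" and q_pe: "q = p ^ e" and card_q: "CARD('a) = q"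
begin

lemma CHAR_a: "CHAR('a) = p" using CHAR_eq_prime[OF prime_p] card_q q_pe by metis

lemma q2: "q \<ge> 2" using card_finite_field_ge_2[where ?'a = 'a] card_q by simp

lemma q0 [simp]: "q > 0" "q \<noteq> 0" "Suc 0 \<le> q" "Suc 0 < q" using q2 by simp_all

lemma lt_q_power: "n < q ^ n" using power_gt_expt[of q n] by simp

lemma le_q_mult: "x \<le> q * x" for x :: nat by simp

lemma frob_gen:
  fixes x y :: "'b::comm_semiring_1"
  assumes "CHAR('b) = p"
  shows "(x + y) ^ (q ^ n) = x ^ (q ^ n) + y ^ (q ^ n)"
proof (rule freshmans_dream')
  show "prime CHAR('b)" using prime_p assms by simp
  show "q ^ n = CHAR('b) ^ (e * n)" using assms q_pe by (simp add: power_mult)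
qed

lemma frob_gen_minus:
  fixes x y :: "'b::comm_ring_1"
  assumes "CHAR('b) = p"
  shows "(- x) ^ (q ^ n) = - (x ^ (q ^ n))"
  using frob_gen[OF assms, of x "- x" n]
  by (simp add: eq_neg_iff_add_eq_0 add.commute[of "x ^ q ^ n"] power_0_left)

lemma frob_gen_diff:
  fixes x y :: "'b::comm_ring_1"
  assumes "CHAR('b) = p"
  shows "(x - y) ^ (q ^ n) = x ^ (q ^ n) - y ^ (q ^ n)"
  using frob_gen[OF assms, of x "- y" n] by (simp add: frob_gen_minus[OF assms])

lemma frob_sum_gen:
  fixes f :: "'c \<Rightarrow> 'b::comm_semiring_1"
  assumes "CHAR('b) = p"
  shows "sum f A ^ (q ^ n) = (\<Sum>x\<in>A. f x ^ (q ^ n))"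
proof (rule freshmans_dream_sum')
  show "prime CHAR('b)" using prime_p assms by simp
  show "q ^ n = CHAR('b) ^ (e * n)" using assms q_pe by (simp add: power_mult)
qed

lemma CHAR_K: "CHAR('a ratfun) = p" by (simp add: CHAR_ratfun CHAR_a)
lemma CHAR_fps: "CHAR('a ratfun fps) = p" by (simp add: CHAR_K)
lemma CHAR_fls: "CHAR('a ratfun fls) = p" by (simp add: CHAR_K)
lemma CHAR_poly: "CHAR('a poly poly) = p" by (simp add: CHAR_a)

definition kap :: "'a poly \<Rightarrow> 'a ratfun fls" where "kap a = fls_const (to_fract a)"

sublocale kap: inj_comm_ring_hom kap
  by unfold_locales (auto simp: kap_def fls_plus_const fls_const_mult_const)

sublocale kapm: map_poly_comm_ring_hom kap ..

definition iota :: "'a \<Rightarrow> 'a ratfun fls" where "iota a = kap [:a:]"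

sublocale cf: carlitz_field iota "kap theta" fls_X_inv q
proof
  show "q = CARD('a)" using card_q by simp
  show "iota 1 = 1" by (simp add: iota_def one_pCons[symmetric])
  show "iota (x + y) = iota x + iota y" for x y
    by (simp add: iota_def flip: kap.hom_add)
  show "iota (x * y) = iota x * iota y" for x y
    by (simp add: iota_def flip: kap.hom_mult)
  show "(u + v) ^ q = u ^ q + v ^ q" for u v :: "'a ratfun fls"
    using frob_gen[OF CHAR_fls, of u v 1] by simp
qed

text \<open>The Carlitz polynomial of \<theta>^i.\<close>

definition Fp :: "nat \<Rightarrow> 'a poly poly" where "Fp i = (pcompose carlitz_theta ^^ i) (monom 1 1)"

lemma Fp_0: "Fp 0 = monom 1 1" by (simp add: Fp_def)

lemma Fp_Suc: "Fp (Suc i) = smult theta (Fp i) + Fp i ^ q"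
  by (simp add: Fp_def carlitz_theta_def pcompose_add pcompose_monom card_q)

lemma carlitz_Fp: "carlitz a = (\<Sum>i\<le>degree a. smult [:coeff a i:] (Fp i))"
  by (simp add: carlitz_def Fp_def)

text \<open>Below the leading term X^(q^i) there is a gap down to degree q^(i-1); the factor q on
  the left states this without the exponent i - 1, so that i = 0 is covered. The gap is what makes
  the product for h converge.\<close>

lemma Fp_decomp: "\<exists>G. Fp i = monom 1 (q ^ i) + G \<and> q * degree G \<le> q ^ i"
proof (induction i)
  case 0
  show ?case by (intro exI[of _ 0]) (simp add: Fp_0)
next
  case (Suc i)
  then obtain G where G: "Fp i = monom 1 (q ^ i) + G" "q * degree G \<le> q ^ i" by blast
  have "Fp i ^ q = monom 1 (q ^ i) ^ q + G ^ q"
    unfolding G(1) using frob_gen[OF CHAR_poly, of "monom 1 (q ^ i)" G 1] by simp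
  also have "monom 1 (q ^ i) ^ q = monom (1 :: 'a poly) (q ^ Suc i)"
    by (simp add: monom_power mult.commute)
  finally have F: "Fp (Suc i) = monom 1 (q ^ Suc i) + (smult theta (Fp i) + G ^ q)"
    unfolding Fp_Suc by simp
  have "degree G \<le> q ^ i"
  proof -
    show ?thesis using G(2) le_q_mult[of "degree G"] by linarith
  qed
  hence "degree (Fp i) \<le> q ^ i"
    unfolding G(1) by (intro degree_add_le) (auto simp: degree_monom_eq)
  hence 1: "degree (smult theta (Fp i)) \<le> q ^ i" using degree_smult_le le_trans by blast
  have 2: "degree (G ^ q) \<le> q ^ i"
    using degree_power_le[of G q] G(2) by (simp add: mult.commute)
  have "degree (smult theta (Fp i) + G ^ q) \<le> q ^ i" by (rule degree_add_le[OF 1 2])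
  hence "q * degree (smult theta (Fp i) + G ^ q) \<le> q ^ Suc i" by simp
  thus ?case using F by blast
qed

lemma degree_Fp: "degree (Fp i) \<le> q ^ i"
proof -
  obtain G where G: "Fp i = monom 1 (q ^ i) + G" "q * degree G \<le> q ^ i" using Fp_decomp by blast
  have "degree G \<le> q ^ i" using G(2) le_q_mult[of "degree G"] by linarith
  thus ?thesis unfolding G(1) by (intro degree_add_le) (auto simp: degree_monom_eq)
qed

lemma carlitz_decomp:
  fixes c :: "'a poly"
  assumes "c \<noteq> 0"
  shows "\<exists>G. carlitz c = monom [:lead_coeff c:] (q ^ degree c) + G \<and> q * degree G \<le> q ^ degree c"
proof -
  obtain G where G: "Fp (degree c) = monom 1 (q ^ degree c) + G" "q * degree G \<le> q ^ degree c"
    using Fp_decomp by blast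
  define R where "R = smult [:lead_coeff c:] G + (\<Sum>i<degree c. smult [:coeff c i:] (Fp i))"
  have "carlitz c = monom [:lead_coeff c:] (q ^ degree c) + R"
    unfolding carlitz_Fp lessThan_Suc_atMost[symmetric] R_def 
    by (simp add: G(1) smult_add_right smult_monom)
  moreover have "q * degree R \<le> q ^ degree c"
  proof -
    have "degree (\<Sum>i<degree c. smult [:coeff c i:] (Fp i)) \<le> q ^ degree c div q"
    proof (rule degree_sum_le)
      fix i assume i: "i \<in> {..<degree c}"
      hence "q * q ^ i \<le> q ^ degree c" using q2 by (simp flip: power_Suc add: power_increasing)
      hence "q ^ i \<le> q ^ degree c div q" by (simp add: less_eq_div_iff_mult_less_eq mult.commute)
      thus "degree (smult [:coeff c i:] (Fp i)) \<le> q ^ degree c div q"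
        using degree_smult_le[of "[:coeff c i:]" "Fp i"] degree_Fp[of i] by linarith
    qed simp
    moreover have "degree (smult [:lead_coeff c:] G) \<le> q ^ degree c div q"
    proof -
      have "degree G \<le> q ^ degree c div q" using G(2) by (simp add: less_eq_div_iff_mult_less_eq mult.commute)
      thus ?thesis using degree_smult_le[of "[:lead_coeff c:]" G] by linarith
    qed
    ultimately have "degree R \<le> q ^ degree c div q" unfolding R_def by (intro degree_add_le)
    thus ?thesis by (simp add: less_eq_div_iff_mult_less_eq mult.commute)
  qed
  ultimately show ?thesis by blast
qed

lemma degree_carlitz: "(c :: 'a poly) \<noteq> 0 \<Longrightarrow> degree (carlitz c) = q ^ degree c"
  and coeff_carlitz_top: "(c :: 'a poly) \<noteq> 0 \<Longrightarrow> coeff (carlitz c) (q ^ degree c) = [:lead_coeff c:]"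
  and coeff_carlitz_gap: "(c :: 'a poly) \<noteq> 0 \<Longrightarrow> q * j > q ^ degree c \<Longrightarrow> j \<noteq> q ^ degree c \<Longrightarrow> coeff (carlitz c) j = 0"
proof -
  assume c: "(c :: 'a poly) \<noteq> 0"
  obtain G where G: "carlitz c = monom [:lead_coeff c:] (q ^ degree c) + G" "q * degree G \<le> q ^ degree c"
    using carlitz_decomp[OF c] by blast
  have G0: "coeff G j = 0" if "q * j > q ^ degree c" for j
  proof (rule coeff_eq_0)
    have "q * degree G < q * j" using that G(2) by linarith
    thus "degree G < j" by simp
  qed
  have "q * q ^ degree c > q ^ degree c" using q2 by simp
  hence 1: "coeff (carlitz c) (q ^ degree c) = [:lead_coeff c:]"
    by (simp add: G(1) G0)
  have 2: "coeff (carlitz c) j = 0" if "q * j > q ^ degree c" "j \<noteq> q ^ degree c" for j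
    using that by (simp add: G(1) G0)
  show "coeff (carlitz c) (q ^ degree c) = [:lead_coeff c:]" by (rule 1)
  show "q * j > q ^ degree c \<Longrightarrow> j \<noteq> q ^ degree c \<Longrightarrow> coeff (carlitz c) j = 0" by (rule 2)
  show "degree (carlitz c) = q ^ degree c"
  proof (rule antisym)
    show "degree (carlitz c) \<le> q ^ degree c"
    proof (rule degree_le, intro allI impI)
      fix j assume "q ^ degree c < j"
      moreover have "j \<le> q * j" by (rule le_q_mult)
      ultimately show "coeff (carlitz c) j = 0" by (intro 2) linarith+
    qed
    show "q ^ degree c \<le> degree (carlitz c)" using 1 c by (intro le_degree) auto
  qed
qed

lemma ev_Fp: "poly (map_poly kap (Fp i)) fls_X_inv = cf.Cb i"
proof (induction i)
  case 0
  show ?case by (simp add: Fp_0 map_poly_monom poly_monom)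
next
  case (Suc i)
  thus ?case by (simp add: Fp_Suc hom_distribs kapm.hom_power)
qed

lemma ev_carlitz: "poly (map_poly kap (carlitz c)) fls_X_inv = cf.Cc c"
  by (simp add: carlitz_Fp cf.Cc_def kapm.hom_sum hom_distribs poly_sum ev_Fp iota_def)

lemma recip_fls:
  fixes c :: "'a poly"
  assumes "c \<noteq> 0"
  shows "fps_to_fls (carlitz_recip c) = fls_X ^ (q ^ degree c) * cf.Cc c"
proof -
  have "fps_to_fls (carlitz_recip c) = poly (map_poly fls_const (map_poly to_fract (reflect_poly (carlitz c)))) fls_X"
    by (simp add: carlitz_recip_def fps_to_fls_fps_of_poly)
  also have "map_poly fls_const (map_poly to_fract (reflect_poly (carlitz c))) = map_poly kap (reflect_poly (carlitz c))"
    by (subst map_poly_map_poly) (simp_all add: comp_def kap_def[abs_def])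
  also have "\<dots> = reflect_poly (map_poly kap (carlitz c))"
    by (rule poly_eqI) (simp add: coeff_map_poly coeff_reflect_poly)
  also have "poly \<dots> fls_X = fls_X ^ degree (map_poly kap (carlitz c)) * poly (map_poly kap (carlitz c)) (inverse fls_X)"
    by (rule poly_reflect_poly_nz) simp
  also have "degree (map_poly kap (carlitz c)) = q ^ degree c"
    using degree_carlitz[OF assms] by simp
  also have "inverse (fls_X :: 'a ratfun fls) = fls_X_inv" by (simp add: fls_inverse_X)
  finally show ?thesis by (simp add: ev_carlitz)
qed

lemma recip_0: "(c :: 'a poly) \<noteq> 0 \<Longrightarrow> fps_nth (carlitz_recip c) 0 = to_fract [:lead_coeff c:]"
  using degree_carlitz[of c] coeff_carlitz_top[of c]
  by (simp add: carlitz_recip_def coeff_map_poly coeff_reflect_poly)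

lemma recip_nz: "(c :: 'a poly) \<noteq> 0 \<Longrightarrow> carlitz_recip c \<noteq> 0"
  using recip_0[of c] by auto

sublocale cl: carlitz_lattice iota "kap theta" fls_X_inv q
proof
  fix c :: "'a poly" assume c: "c \<noteq> 0"
  hence "fps_to_fls (carlitz_recip c) \<noteq> 0" using recip_nz by simp
  thus "cf.Cc c \<noteq> 0" unfolding recip_fls[OF c] by auto
qed

lemma u_mult_fls:
  fixes c :: "'a poly"
  assumes "c \<noteq> 0"
  shows "fps_to_fls (u_mult c) = 1 / cf.Cc c"
proof -
  have "fps_to_fls (u_mult c) = fls_X ^ (q ^ degree c) * inverse (fps_to_fls (carlitz_recip c))"
    using recip_0[OF assms] assms
    by (simp add: u_mult_def card_q fls_times_fps_to_fls fps_to_fls_power fls_inverse_fps_to_fls)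
  also have "\<dots> = 1 / cf.Cc c" unfolding recip_fls[OF assms] by (simp add: field_simps)
  finally show ?thesis .
qed

lemma monic_recip:
  fixes c :: "'a poly"
  assumes "c \<in> monics_below d"
  shows "c \<noteq> 0" "fps_nth (carlitz_recip c) 0 = 1"
proof -
  show "c \<noteq> 0" using assms by (auto simp: monics_below_def)
  from recip_0[OF this] show "fps_nth (carlitz_recip c) 0 = 1"
    using assms by (simp add: monics_below_def one_pCons[symmetric])
qed

text \<open>By the gap in the Carlitz polynomial, the reciprocal polynomial of a monic c of degree d
  is 1 modulo u^(q^d - q^(d-1)), and this exponent is larger than m as soon as d > m.\<close>

lemma recip_agree:
  fixes c :: "'a poly"
  assumes "lead_coeff c = 1" "degree c > m"
  shows "fps_agree m (carlitz_recip c) 1"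
  unfolding fps_agree_def
proof (intro allI impI)
  fix j assume j: "j \<le> m"
  define d where "d = degree c"
  have c: "c \<noteq> 0" using assms by auto
  show "fps_nth (carlitz_recip c) j = fps_nth 1 j"
  proof (cases "j = 0")
    case True
    thus ?thesis using recip_0[OF c] assms by (simp add: one_pCons[symmetric])
  next
    case False
    have d: "d \<ge> 1" using assms by (simp add: d_def)
    then obtain d' where d': "d = Suc d'" by (cases d) auto
    have "j \<le> d'" using j assms d' d_def by simp
    also have "d' < q ^ d'" by (rule lt_q_power)
    finally have jd: "j < q ^ d'" .
    have "q ^ d' * 2 \<le> q ^ d' * q" using q2 by (intro mult_left_mono) auto
    hence "q ^ d' + q ^ d' \<le> q ^ d" unfolding d' power_Suc mult.commute[of q] by linarith
    hence gap: "q ^ d - j > q ^ d'" using jd by linarith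
    hence "q * (q ^ d - j) > q ^ d" by (simp add: d')
    hence "coeff (carlitz c) (q ^ d - j) = 0"
      using False gap jd unfolding d_def by (intro coeff_carlitz_gap[OF c]) (auto simp: )
    thus ?thesis using False degree_carlitz[OF c] 
      by (simp add: carlitz_recip_def coeff_map_poly coeff_reflect_poly d_def)
  qed
qed

definition u_partial :: "('a poly \<Rightarrow> 'a ratfun) \<Rightarrow> nat \<Rightarrow> nat \<Rightarrow> 'a ratfun fps" where
  "u_partial \<psi> n d = (\<Sum>c\<in>monics_below d. fps_const (\<psi> c) * u_mult c ^ n)"

text \<open>The diagonal already gives the limit for n \<ge> 1: u_c has order q^(deg c), which
  exceeds m for all c of degree at least m, so these do not affect the coefficient m.\<close>

definition u_series :: "('a poly \<Rightarrow> 'a ratfun) \<Rightarrow> nat \<Rightarrow> 'a ratfun fps" where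
  "u_series \<psi> n = Abs_fps (\<lambda>m. fps_nth (u_partial \<psi> n (Suc m)) m)"

lemma u_mult_pow_nth:
  fixes c :: "'a poly"
  assumes "m < q ^ degree c" "n \<ge> 1"
  shows "fps_nth (u_mult c ^ n) m = 0"
proof -
  have "u_mult c ^ n = fps_X ^ (q ^ degree c * n) * inverse (carlitz_recip c) ^ n"
    by (simp add: u_mult_def card_q power_mult_distrib power_mult)
  moreover have "m < q ^ degree c * n"
    using assms(1) mult_le_mono2[OF assms(2), of "q ^ degree c"] by linarith
  ultimately show ?thesis by (simp add: fps_X_power_mult_nth)
qed

lemma u_partial_stable:
  assumes n: "n \<ge> 1" and m: "m < q ^ d" and "d \<le> d'"
  shows "fps_nth (u_partial \<psi> n d') m = fps_nth (u_partial \<psi> n d) m"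
  using assms(3)
proof (induction d' rule: dec_induct)
  case (step d')
  have "fps_nth (fps_const (\<psi> (c + monom 1 d')) * u_mult (c + monom 1 d') ^ n) m = 0" if "c \<in> lows d'" for c
  proof -
    have "q ^ d \<le> q ^ d'" using step q2 by (intro power_increasing) auto
    hence "m < q ^ d'" using m by linarith
    hence "m < q ^ degree (c + monom 1 d')" using degree_add_monom_lows[OF that] by simp
    thus ?thesis using u_mult_pow_nth[OF _ n] by simp
  qed
  hence "fps_nth (\<Sum>c\<in>lows d'. fps_const (\<psi> (c + monom 1 d')) * u_mult (c + monom 1 d') ^ n) m = 0"
    unfolding fps_sum_nth by (intro sum.neutral ballI)
  thus ?case using step.IH unfolding u_partial_def sum_monics_below_Suc by simp
qed simp

lemma u_series_nth:
  assumes "n \<ge> 1" "m < q ^ d"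
  shows "fps_nth (u_series \<psi> n) m = fps_nth (u_partial \<psi> n d) m"
proof -
  have m: "m < q ^ Suc m" using lt_q_power[of "Suc m"] by linarith
  hence "fps_nth (u_partial \<psi> n (Suc m)) m = fps_nth (u_partial \<psi> n (max d (Suc m))) m"
    using u_partial_stable[OF assms(1) m, of "max d (Suc m)" \<psi>] by simp
  also have "\<dots> = fps_nth (u_partial \<psi> n d) m"
    using u_partial_stable[OF assms, of "max d (Suc m)" \<psi>] by simp
  finally show ?thesis by (simp add: u_series_def)
qed

lemma u_series_lim: "n \<ge> 1 \<Longrightarrow> (\<lambda>d. u_partial \<psi> n d) \<longlonglongrightarrow> u_series \<psi> n"
proof (rule eventually_sequentially_fps_eq)
  fix m assume n: "n \<ge> 1"
  show "\<exists>N. \<forall>d\<ge>N. fps_nth (u_partial \<psi> n d) m = fps_nth (u_series \<psi> n) m"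
  proof (intro exI[of _ m] allI impI)
    fix d assume "m \<le> d"
    hence "m < q ^ d" using lt_q_power[of d] by linarith
    thus "fps_nth (u_partial \<psi> n d) m = fps_nth (u_series \<psi> n) m" using u_series_nth[OF n] by simp
  qed
qed

abbreviation EE :: "'a ratfun fps" where "EE \<equiv> E_series"
abbreviation gg :: "'a ratfun fps" where "gg \<equiv> g_series"
abbreviation hh :: "'a ratfun fps" where "hh \<equiv> h_series"

lemma EE_eq: "EE = u_series to_fract 1"
  using limI[OF u_series_lim[of 1 to_fract]] by (simp add: E_series_def u_partial_def const_A_def)

lemma gg_eq: "gg = 1 - const_A (theta ^ q - theta) * u_series (\<lambda>_. 1) (q - 1)"
proof -
  have "1 \<le> q - 1" using q2 by simp
  from limI[OF u_series_lim[OF this, of "\<lambda>_. 1"]] show ?thesis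
    by (simp add: g_series_def u_partial_def card_q)
qed

definition PP :: "nat \<Rightarrow> 'a ratfun fps" where "PP d = (\<Prod>c\<in>monics_below d. carlitz_recip c)"

lemma PP_0: "fps_nth (PP d) 0 = 1"
proof -
  have "fps_nth (prod f A) 0 = (\<Prod>x\<in>A. fps_nth (f x) 0)" for f :: "'a poly \<Rightarrow> 'a ratfun fps" and A
    by (induction A rule: infinite_finite_induct) simp_all
  thus ?thesis unfolding PP_def using monic_recip(2) by (auto intro!: prod.neutral)
qed

lemma PP_stable:
  assumes "m < d" "d \<le> d'"
  shows "fps_agree m (PP d') (PP d)"
  using assms(2)
proof (induction d' rule: dec_induct)
  case (step d')
  have "fps_agree m (\<Prod>c\<in>(lows d' :: 'a poly set). carlitz_recip (c + monom 1 d')) (\<Prod>c\<in>(lows d' :: 'a poly set). 1)"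
  proof (intro fps_agree_prod recip_agree)
    fix c :: "'a poly" assume c: "c \<in> lows d'"
    from c show "lead_coeff (c + monom 1 d') = 1"
      using degree_add_monom_lows[OF c] by (simp add: lows_def)
    show "m < degree (c + monom 1 d')" 
      using degree_add_monom_lows[OF c] step assms by simp
  qed
  from fps_agree_mult[OF step.IH this] show ?case
    by (simp add: PP_def prod_monics_below_Suc)
qed simp

definition PPI :: "'a ratfun fps" where "PPI = Abs_fps (\<lambda>m. fps_nth (PP (Suc m)) m)"

lemma PP_lim: "PP \<longlonglongrightarrow> PPI"
proof (rule eventually_sequentially_fps_eq)
  fix m
  show "\<exists>N. \<forall>d\<ge>N. fps_nth (PP d) m = fps_nth PPI m"
  proof (intro exI[of _ "Suc m"] allI impI)
    fix d assume "Suc m \<le> d"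
    hence "fps_agree m (PP d) (PP (Suc m))" by (intro PP_stable) auto
    thus "fps_nth (PP d) m = fps_nth PPI m" by (simp add: fps_agree_def PPI_def)
  qed
qed

lemma PPI_0: "fps_nth PPI 0 = 1" by (simp add: PPI_def PP_0)

lemma hh_eq: "hh = - (fps_X * PPI ^ (q\<^sup>2 - 1))"
proof -
  have "(\<lambda>d. PP d ^ (q\<^sup>2 - 1)) \<longlonglongrightarrow> PPI ^ (q\<^sup>2 - 1)" by (intro tendsto_power_fps PP_lim)
  from limI[OF this] show ?thesis
    by (simp add: h_series_def PP_def prod_power_distrib card_q)
qed

lemma fps_to_fls_prod:
  fixes f :: "'b \<Rightarrow> 'a ratfun fps"
  shows "fps_to_fls (prod f A) = (\<Prod>c\<in>A. fps_to_fls (f c))"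
  by (induction A rule: infinite_finite_induct) (simp_all add: fls_times_fps_to_fls)

lemma PP_fls: "fps_to_fls (PP d) = (\<Prod>c\<in>(monics_below d :: 'a poly set). fls_X ^ (q ^ degree c)) * cf.P d"
  (is "_ = ?X d * _")
proof -
  have "fps_to_fls (PP d) = (\<Prod>c\<in>monics_below d. fps_to_fls (carlitz_recip c))"
    unfolding PP_def by (rule fps_to_fls_prod)
  also have "\<dots> = (\<Prod>c\<in>monics_below d. fls_X ^ (q ^ degree c) * cf.Cc c)"
    by (intro prod.cong refl recip_fls) (rule monic_recip(1))
  finally show ?thesis unfolding prod.distrib cf.P_def .
qed

end

subsection \<open>The three-term recursion\<close>

definition fps_lead :: "'b::zero fps \<Rightarrow> 'b" where "fps_lead f = fps_nth f (subdegree f)"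

lemma fps_lead_mult: "fps_lead (f * g) = fps_lead f * fps_lead (g :: 'b::idom fps)"
  by (cases "f = 0 \<or> g = 0") (auto simp: fps_lead_def nth_subdegree_mult)

lemma fps_lead_1 [simp]: "fps_lead (1 :: 'b::idom fps) = 1"
  by (simp add: fps_lead_def)

lemma fps_lead_power: "fps_lead (f ^ n) = fps_lead (f :: 'b::idom fps) ^ n"
  by (induction n) (simp_all add: fps_lead_mult)

lemma subdegree_fps_leadI:
  assumes "fps_nth f n = c" "c \<noteq> 0" "\<And>m. m < n \<Longrightarrow> fps_nth f m = 0"
  shows "subdegree f = n" "fps_lead f = c"
proof -
  show "subdegree f = n" by (rule subdegreeI) (use assms in auto)
  thus "fps_lead f = c" using assms by (simp add: fps_lead_def)
qed

context drinfeld
begin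

definition kc :: "'a poly \<Rightarrow> 'a ratfun fps" where "kc a = fps_const (to_fract a)"

sublocale kc: inj_comm_ring_hom kc
  by unfold_locales (auto simp: kc_def)

lemma kc_fls: "fps_to_fls (kc a) = kap a"
  by (simp add: kc_def kap_def)

lemma const_A_kc: "const_A a = kc a" by (simp add: kc_def const_A_def)

definition sX :: "nat \<Rightarrow> nat" where "sX d = (\<Sum>c\<in>(monics_below d :: 'a poly set). q ^ degree c)"

lemma card_lows: "card (lows d :: 'a poly set) = q ^ d"
proof (induction d)
  case (Suc d)
  show ?case using bij_betw_same_card[OF bij_lows_Suc[of d, where ?'a = 'a]] Suc
    by (simp add: card_q card_cartesian_product)
qed (simp add: lows_0)

lemma sX_Suc: "sX (Suc d) = sX d + q ^ (2 * d)"
proof -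
  have "(\<Sum>c\<in>(lows d :: 'a poly set). q ^ degree (c + monom 1 d)) = (\<Sum>c\<in>(lows d :: 'a poly set). q ^ d)"
    by (intro sum.cong refl) (simp add: degree_add_monom_lows)
  thus ?thesis by (simp add: sX_def sum_monics_below_Suc card_lows mult_2 power_add)
qed

text \<open>With this identity the powers of u cancel in \<open>Hs d\<close>, where the factor
  \<open>fps_X\<close> supplies the summand 1.\<close>

lemma sX_rec: "sX (Suc d) = q\<^sup>2 * sX d + 1"
proof (induction d)
  case 0
  show ?case by (simp add: sX_def monics_below_0 sum_monics_below_Suc lows_0 degree_monom_eq)
next
  case (Suc d)
  have "q\<^sup>2 * sX (Suc d) = q\<^sup>2 * sX d + q ^ (2 * Suc d)"
    unfolding sX_Suc[of d] by (simp add: distrib_left power2_eq_square)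
  thus ?case using Suc sX_Suc[of "Suc d"] by simp
qed

lemma PP_fls': "fps_to_fls (PP d) = fls_X ^ sX d * cf.P d"
  unfolding PP_fls sX_def power_sum ..

definition Hs :: "nat \<Rightarrow> 'a ratfun fps" where
  "Hs d = fps_X * PP d ^ q\<^sup>2 * inverse (PP (Suc d))"

lemma Hs_fls: "fps_to_fls (Hs d) = cl.H d"
proof -
  have "fps_to_fls (Hs d) = fls_X * fps_to_fls (PP d) ^ q\<^sup>2 * inverse (fps_to_fls (PP (Suc d)))"
    using PP_0[of "Suc d"]
    by (simp add: Hs_def fls_times_fps_to_fls fps_to_fls_power fls_inverse_fps_to_fls subdegree_eq_0)
  also have "\<dots> = fls_X * (fls_X ^ sX d * cf.P d) ^ q\<^sup>2 / (fls_X ^ sX (Suc d) * cf.P (Suc d))"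
    unfolding PP_fls' by (simp add: divide_inverse)
  also have "\<dots> = fls_X ^ sX (Suc d) * cf.P d ^ q\<^sup>2 / (fls_X ^ sX (Suc d) * cf.P (Suc d))"
    unfolding sX_rec by (simp add: power_mult_distrib mult.commute flip: power_mult)
  also have "\<dots> = cl.H d" by (simp add: cl.H_def)
  finally show ?thesis .
qed

lemma Hs_nz: "Hs d \<noteq> 0"
  using Hs_fls[of d] cl.H_nz[of d] by auto

lemma Hs_lim: "Hs \<longlonglongrightarrow> - hh"
proof -
  have "(\<lambda>d. inverse (PP (Suc d))) \<longlonglongrightarrow> inverse PPI"
    by (rule tendsto_inverse_fps) (use PPI_0 LIMSEQ_Suc[OF PP_lim] in auto)
  hence "Hs \<longlonglongrightarrow> fps_X * PPI ^ q\<^sup>2 * inverse PPI"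
    unfolding Hs_def[abs_def] by (intro tendsto_mult_fps tendsto_power_fps tendsto_const PP_lim)
  also have "fps_X * PPI ^ q\<^sup>2 * inverse PPI = fps_X * PPI ^ (q\<^sup>2 - 1) * (PPI * inverse PPI)"
    by (subst power_minus_mult[of "q\<^sup>2" PPI, symmetric]) (simp_all add: mult_ac)
  also have "PPI * inverse PPI = 1" using PPI_0 by (intro inverse_mult_eq_1') simp
  finally show ?thesis by (simp add: hh_eq)
qed

definition yc :: "nat \<Rightarrow> 'a poly \<Rightarrow> 'a ratfun" where "yc i c = to_fract [:coeff c i:]"

abbreviation Yn :: "nat \<Rightarrow> nat \<Rightarrow> 'a ratfun fps" where "Yn d i \<equiv> u_partial (yc i) 1 d"
abbreviation Y :: "nat \<Rightarrow> 'a ratfun fps" where "Y i \<equiv> u_series (yc i) 1"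

lemma fps_to_fls_sum:
  fixes f :: "'b \<Rightarrow> 'a ratfun fps"
  shows "fps_to_fls (sum f A) = (\<Sum>c\<in>A. fps_to_fls (f c))"
  by (induction A rule: infinite_finite_induct) simp_all

lemma u_mult_monic_fls: "c \<in> monics_below d \<Longrightarrow> fps_to_fls (u_mult (c :: 'a poly)) = 1 / cf.Cc c"
  by (rule u_mult_fls) (rule monic_recip(1))

lemma u_partial_fls:
  "fps_to_fls (u_partial \<psi> n d) = (\<Sum>c\<in>monics_below d. fls_const (\<psi> c) * (1 / cf.Cc c) ^ n)"
  unfolding u_partial_def fps_to_fls_sum
  by (intro sum.cong refl) (simp add: fls_times_fps_to_fls fps_to_fls_power u_mult_monic_fls)

lemma Yn_fls: "fps_to_fls (Yn d i) = cl.y d i"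
  unfolding u_partial_fls cl.y_def by (simp add: yc_def iota_def kap_def)

lemmas Yn_fls' = Yn_fls[unfolded One_nat_def]

lemma frob_fps: "((f :: 'a ratfun fps) + g) ^ (q ^ n) = f ^ (q ^ n) + g ^ (q ^ n)"
  by (rule frob_gen[OF CHAR_fps])

lemma frob_fps_sum: "(sum f A :: 'a ratfun fps) ^ (q ^ n) = (\<Sum>x\<in>A. f x ^ (q ^ n))"
  by (rule frob_sum_gen[OF CHAR_fps])

lemma frob_fps_minus: "(- f :: 'a ratfun fps) ^ (q ^ n) = - (f ^ (q ^ n))"
  by (rule frob_gen_minus[OF CHAR_fps])

lemma frob_fps_diff: "((f :: 'a ratfun fps) - g) ^ (q ^ n) = f ^ (q ^ n) - g ^ (q ^ n)"
  by (rule frob_gen_diff[OF CHAR_fps])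

lemma const_q_power: "(to_fract [:a :: 'a:]) ^ (q ^ n) = to_fract [:a:]"
proof -
  have "[:a:] ^ (q ^ n) = [:a ^ (q ^ n):]" by (simp add: poly_const_pow)
  also have "a ^ (q ^ n) = a" using finite_field_power_card_power_eq_same[OF refl, of a n] by (simp add: card_q)
  finally show ?thesis by (simp flip: to_fract_hom.hom_power)
qed

lemma Yn_power: "Yn d i ^ (q ^ n) = u_partial (yc i) (q ^ n) d"
  unfolding u_partial_def frob_fps_sum
  by (simp add: power_mult_distrib yc_def fps_const_power const_q_power)

definition gln :: "nat \<Rightarrow> 'a ratfun fps" where
  "gln d = 1 - kc (theta ^ q - theta) * u_partial (\<lambda>_. 1) (q - 1) d"

lemma gln_fls: "fps_to_fls (gln d) = cl.gl d"
  by (simp add: gln_def fls_times_fps_to_fls u_partial_fls cl.gl_def kc_fls kap.hom_minus kap.hom_power)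

lemma q_minus_1: "1 \<le> q - 1" using q2 by simp

lemma gln_lim: "gln \<longlonglongrightarrow> gg"
  unfolding gg_eq gln_def[abs_def] const_A_kc
  by (intro tendsto_diff_fps tendsto_mult_fps tendsto_const u_series_lim q_minus_1)

definition zn :: "nat \<Rightarrow> nat \<Rightarrow> 'a ratfun fps" where
  "zn d i = gln d * Yn (Suc d) i + kc theta ^ q * Yn d i ^ q - (case i of 0 \<Rightarrow> 0 | Suc i' \<Rightarrow> Yn d i' ^ q)"

lemma zn_fls: "fps_to_fls (zn d i) = cl.z d i"
  by (cases i) (simp_all add: zn_def cl.z_def fls_times_fps_to_fls fps_to_fls_power gln_fls Yn_fls' kc_fls)

lemma zn_power:
  assumes "d \<ge> 1" "i \<le> d"
  shows "zn d i ^ q = Hs d ^ (q - 1) * Yn (Suc d) i"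
proof -
  have "fps_to_fls (zn d i ^ q) = fps_to_fls (Hs d ^ (q - 1) * Yn (Suc d) i)"
    using cl.z_power[OF assms] by (simp add: fps_to_fls_power fls_times_fps_to_fls zn_fls Hs_fls Yn_fls')
  thus ?thesis by (simp only: fps_to_fls_eq_iff)
qed

lemma zn_sum:
  assumes "d \<ge> 1"
  shows "(\<Sum>i<Suc d. kc theta ^ i * zn d i) = Hs d"
proof -
  have "fps_to_fls (\<Sum>i<Suc d. kc theta ^ i * zn d i) = (\<Sum>i<Suc d. kap theta ^ i * cl.z d i)"
    unfolding fps_to_fls_sum by (simp only: fls_times_fps_to_fls fps_to_fls_power zn_fls kc_fls)
  also have "\<dots> = fps_to_fls (Hs d)" unfolding cl.z_sum[OF assms] Hs_fls ..
  finally show ?thesis by (simp only: fps_to_fls_eq_iff)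
qed

abbreviation En :: "nat \<Rightarrow> nat \<Rightarrow> nat \<Rightarrow> 'a ratfun fps" where
  "En s n d \<equiv> u_partial (\<lambda>c. to_fract (c ^ (q ^ s))) (q ^ n) d"

text \<open>
  The series representing \<open>E\<^bsub>n-s,1\<^esub>^(q^s)\<close>, see \<open>E1_eq\<close> below.
\<close>

definition Ehat :: "nat \<Rightarrow> nat \<Rightarrow> 'a ratfun fps" where
  "Ehat s n = u_series (\<lambda>c. to_fract (c ^ (q ^ s))) (q ^ n)"

lemma theta_monom: "theta ^ i = monom (1 :: 'a) i"
  by (simp add: theta_def monom_altdef)

lemma poly_expand: "c \<in> lows n \<Longrightarrow> c = (\<Sum>i<n. [:coeff c i:] * (theta :: 'a poly) ^ i)"
proof (rule poly_eqI)
  fix k assume c: "c \<in> lows n"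
  have "coeff (\<Sum>i<n. [:coeff c i:] * theta ^ i) k = (\<Sum>i<n. if i = k then coeff c k else 0)"
    unfolding coeff_sum theta_monom by (intro sum.cong) auto
  also have "\<dots> = coeff c k" using c by (auto simp: lows_def not_less)
  finally show "coeff c k = coeff (\<Sum>i<n. [:coeff c i:] * theta ^ i) k" by simp
qed

text \<open>The coefficients of c are fixed by the Frobenius map, so c^(q^s) is the value of c at
  \<theta>^(q^s).\<close>

lemma poly_power_expand:
  assumes "c \<in> lows n"
  shows "to_fract ((c :: 'a poly) ^ (q ^ s)) = (\<Sum>i<n. yc i c * to_fract (theta ^ (q ^ s)) ^ i)"
proof -
  have "c ^ (q ^ s) = (\<Sum>i<n. ([:coeff c i:] * theta ^ i) ^ (q ^ s))"
    by (subst poly_expand[OF assms], rule frob_sum_gen) (simp add: CHAR_a)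
  hence "to_fract (c ^ (q ^ s)) = (\<Sum>i<n. (to_fract [:coeff c i:]) ^ (q ^ s) * to_fract ((theta ^ i) ^ (q ^ s)))"
    by (simp only: to_fract_hom.hom_sum power_mult_distrib to_fract_hom.hom_power to_fract_hom.hom_mult)
  also have "\<dots> = (\<Sum>i<n. yc i c * to_fract (theta ^ (q ^ s)) ^ i)"
    unfolding const_q_power yc_def to_fract_hom.hom_power
    by (simp only: power_mult[symmetric] mult.commute)
  finally show ?thesis .
qed

lemma fps_const_sum_K: "fps_const (sum f A) = (\<Sum>x\<in>A. fps_const (f x :: 'a ratfun))"
  by (induction A rule: infinite_finite_induct) (simp_all flip: fps_const_add)

lemma u_partial_linear:
  assumes "\<And>c. c \<in> monics_below d \<Longrightarrow> \<psi> c = (\<Sum>i<n. a i * yc i c)"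
  shows "u_partial \<psi> m d = (\<Sum>i<n. fps_const (a i) * u_partial (yc i) m d)"
proof -
  have "u_partial \<psi> m d = (\<Sum>c\<in>monics_below d. \<Sum>i<n. fps_const (a i) * (fps_const (yc i c) * u_mult c ^ m))"
    unfolding u_partial_def
  proof (rule sum.cong[OF refl])
    fix c :: "'a poly" assume "c \<in> monics_below d"
    hence "fps_const (\<psi> c) = (\<Sum>i<n. fps_const (a i) * fps_const (yc i c))"
      using assms by (simp add: fps_const_sum_K)
    thus "fps_const (\<psi> c) * u_mult c ^ m = (\<Sum>i<n. fps_const (a i) * (fps_const (yc i c) * u_mult c ^ m))"
      by (simp only: sum_distrib_right mult.assoc)
  qed
  also have "\<dots> = (\<Sum>i<n. fps_const (a i) * u_partial (yc i) m d)"
    unfolding u_partial_def sum_distrib_left by (rule sum.swap)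
  finally show ?thesis .
qed

lemma kc_power_const: "kc a ^ n = fps_const (to_fract a ^ n)"
  by (simp add: kc_def fps_const_power)

lemma En_Yn:
  assumes "d \<le> n"
  shows "En s m d = (\<Sum>i<n. kc (theta ^ (q ^ s)) ^ i * Yn d i ^ (q ^ m))"
  unfolding Yn_power kc_power_const
  by (rule u_partial_linear) (simp add: poly_power_expand[OF cl.monics_lows[OF _ assms]] mult.commute)

lemma Yn_d: "d \<le> i \<Longrightarrow> Yn d i = 0"
proof -
  assume "d \<le> i"
  hence "fps_to_fls (Yn d i) = 0" using cl.y_ge[of d i] Yn_fls[of i d] by simp
  thus ?thesis by simp
qed

text \<open>Evaluation at t = \<theta>^(q^s) after a Frobenius power: the shift of i becomes
  multiplication by t, and this produces the difference of powers of \<theta> in the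
  recursion.\<close>

lemma zn_power_sum:
  "(\<Sum>i<Suc d. kc (theta ^ (q ^ s)) ^ i * zn d i ^ (q ^ m)) =
     gln d ^ (q ^ m) * En s m (Suc d) + (kc theta ^ (q ^ Suc m) - kc theta ^ (q ^ s)) * En s (Suc m) d"
proof -
  let ?t = "kc (theta ^ (q ^ s))"
  have *: "zn d i ^ (q ^ m) = gln d ^ (q ^ m) * Yn (Suc d) i ^ (q ^ m) + kc theta ^ (q ^ Suc m) * Yn d i ^ (q ^ Suc m)
     - (case i of 0 \<Rightarrow> 0 | Suc i' \<Rightarrow> Yn d i' ^ (q ^ Suc m))" for i
    unfolding zn_def frob_fps frob_fps_diff power_mult_distrib
    by (cases i) (simp_all add: power_0_left flip: power_mult)
  have "(\<Sum>i<Suc d. ?t ^ i * zn d i ^ (q ^ m)) = 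
     gln d ^ (q ^ m) * (\<Sum>i<Suc d. ?t ^ i * Yn (Suc d) i ^ (q ^ m)) +
     kc theta ^ (q ^ Suc m) * (\<Sum>i<Suc d. ?t ^ i * Yn d i ^ (q ^ Suc m)) -
     (\<Sum>i<Suc d. ?t ^ i * (case i of 0 \<Rightarrow> 0 | Suc i' \<Rightarrow> Yn d i' ^ (q ^ Suc m)))"
    unfolding * sum_distrib_left sum.distrib[symmetric] sum_subtractf[symmetric]
    by (intro sum.cong refl) (simp add: algebra_simps)
  also have "(\<Sum>i<Suc d. ?t ^ i * (case i of 0 \<Rightarrow> 0 | Suc i' \<Rightarrow> Yn d i' ^ (q ^ Suc m))) =
      ?t * (\<Sum>i<d. ?t ^ i * Yn d i ^ (q ^ Suc m))"
    unfolding sum.lessThan_Suc_shift sum_distrib_left by (simp add: mult.assoc)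
  also have "(\<Sum>i<d. ?t ^ i * Yn d i ^ (q ^ Suc m)) = En s (Suc m) d" by (rule En_Yn[symmetric]) simp
  also have "(\<Sum>i<Suc d. ?t ^ i * Yn d i ^ (q ^ Suc m)) = En s (Suc m) d" by (rule En_Yn[symmetric]) simp
  also have "(\<Sum>i<Suc d. ?t ^ i * Yn (Suc d) i ^ (q ^ m)) = En s m (Suc d)" by (rule En_Yn[symmetric]) simp
  finally show ?thesis by (simp add: algebra_simps kc.hom_power)
qed

lemma q_power_ge_1: "1 \<le> q ^ n" by simp

lemma En_lim: "(\<lambda>d. En s n d) \<longlonglongrightarrow> Ehat s n"
  unfolding Ehat_def by (rule u_series_lim) simp

lemma En_lim_Suc: "(\<lambda>d. En s n (Suc d)) \<longlonglongrightarrow> Ehat s n"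
  using En_lim by (rule LIMSEQ_Suc)

lemma LIMSEQ_eq_ge_1:
  fixes f g :: "nat \<Rightarrow> 'a ratfun fps"
  assumes "f \<longlonglongrightarrow> a" "g \<longlonglongrightarrow> b" "\<And>d. d \<ge> 1 \<Longrightarrow> f d = g d"
  shows "a = b"
proof -
  have "eventually (\<lambda>d. f d = g d) sequentially"
    using assms(3) eventually_sequentially by blast
  hence "f \<longlonglongrightarrow> b" using assms(2) by (rule tendsto_cong[THEN iffD2])
  thus ?thesis using assms(1) LIMSEQ_unique by blast
qed

lemma neg_one_q: "(- 1 :: 'a ratfun) ^ q = - 1"
  using frob_gen_minus[OF CHAR_K, of 1 1] by simp

lemma neg_one_q_minus_1: "(- 1 :: 'a ratfun) ^ (q - 1) = 1"
proof -
  have "(- 1 :: 'a ratfun) ^ (q - 1) * (-1) = (-1) ^ q" by (rule power_minus_mult) simp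
  thus ?thesis by (simp add: neg_one_q)
qed

lemma minus_hh_power: "(- hh) ^ (q - 1) = hh ^ (q - 1)"
proof -
  have "(- hh) = fps_const (-1) * hh" by (simp flip: fps_const_neg)
  hence "(- hh) ^ (q - 1) = fps_const ((-1) ^ (q - 1)) * hh ^ (q - 1)"
    by (simp only: power_mult_distrib fps_const_power)
  thus ?thesis by (simp only: neg_one_q_minus_1 fps_const_1_eq_1 mult_1_left)
qed

text \<open>The relation \<open>zn_power\<close>, raised to the power q^n and summed against the
  powers of \<theta>^(q^s), is evaluated by \<open>zn_power_sum\<close>; then d tends to
  infinity.\<close>

lemma Ehat_rec:
  "gg ^ (q ^ Suc n) * Ehat s (Suc n) + (kc theta ^ (q ^ Suc (Suc n)) - kc theta ^ (q ^ s)) * Ehat s (Suc (Suc n)) =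
     (hh ^ (q - 1)) ^ (q ^ n) * Ehat s n"
proof (rule LIMSEQ_eq_ge_1)
  show "(\<lambda>d. gln d ^ (q ^ Suc n) * En s (Suc n) (Suc d) +
          (kc theta ^ (q ^ Suc (Suc n)) - kc theta ^ (q ^ s)) * En s (Suc (Suc n)) d) \<longlonglongrightarrow>
     gg ^ (q ^ Suc n) * Ehat s (Suc n) + (kc theta ^ (q ^ Suc (Suc n)) - kc theta ^ (q ^ s)) * Ehat s (Suc (Suc n))"
    by (intro tendsto_add_fps tendsto_mult_fps tendsto_power_fps tendsto_const gln_lim En_lim En_lim_Suc)
  show "(\<lambda>d. (Hs d ^ (q - 1)) ^ (q ^ n) * En s n (Suc d)) \<longlonglongrightarrow> (hh ^ (q - 1)) ^ (q ^ n) * Ehat s n"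
    unfolding minus_hh_power[symmetric]
    by (intro tendsto_mult_fps tendsto_power_fps Hs_lim En_lim_Suc)
  fix d :: nat assume d: "d \<ge> 1"
  have "(\<Sum>i<Suc d. kc (theta ^ (q ^ s)) ^ i * zn d i ^ (q ^ Suc n)) =
     (\<Sum>i<Suc d. (Hs d ^ (q - 1)) ^ (q ^ n) * (kc (theta ^ (q ^ s)) ^ i * Yn (Suc d) i ^ (q ^ n)))"
  proof (rule sum.cong[OF refl])
    fix i assume "i \<in> {..<Suc d}"
    hence "zn d i ^ (q ^ Suc n) = (Hs d ^ (q - 1) * Yn (Suc d) i) ^ (q ^ n)"
      using zn_power[OF d, of i] by (simp add: power_mult)
    thus "kc (theta ^ (q ^ s)) ^ i * zn d i ^ (q ^ Suc n) =
       (Hs d ^ (q - 1)) ^ (q ^ n) * (kc (theta ^ (q ^ s)) ^ i * Yn (Suc d) i ^ (q ^ n))"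
      unfolding power_mult_distrib by (simp only: mult_ac)
  qed
  also have "\<dots> = (Hs d ^ (q - 1)) ^ (q ^ n) * En s n (Suc d)"
    unfolding sum_distrib_left[symmetric] by (subst En_Yn[OF order.refl]) (rule refl)
  finally show "gln d ^ (q ^ Suc n) * En s (Suc n) (Suc d) +
          (kc theta ^ (q ^ Suc (Suc n)) - kc theta ^ (q ^ s)) * En s (Suc (Suc n)) d =
     (Hs d ^ (q - 1)) ^ (q ^ n) * En s n (Suc d)"
    unfolding zn_power_sum .
qed

lemma Ehat_0_0: "Ehat 0 0 = EE" by (simp add: Ehat_def EE_eq)

text \<open>The start of the recursion needs the value of \<open>zn\<close> at t = \<theta> itself.
  This is where h enters, and not only its power h^(q-1).\<close>

lemma Ehat_0_1: "gg * EE + (kc theta ^ q - kc theta) * Ehat 0 1 = - hh"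
proof (rule LIMSEQ_eq_ge_1)
  show "(\<lambda>d. gln d * En 0 0 (Suc d) + (kc theta ^ q - kc theta) * En 0 1 d) \<longlonglongrightarrow>
     gg * EE + (kc theta ^ q - kc theta) * Ehat 0 1"
    unfolding Ehat_0_0[symmetric]
    by (intro tendsto_add_fps tendsto_mult_fps tendsto_power_fps tendsto_const gln_lim En_lim En_lim_Suc)
  show "Hs \<longlonglongrightarrow> - hh" by (rule Hs_lim)
  fix d :: nat assume d: "d \<ge> 1"
  show "gln d * En 0 0 (Suc d) + (kc theta ^ q - kc theta) * En 0 1 d = Hs d"
    using zn_sum[OF d] zn_power_sum[of 0 d 0] by simp
qed

text \<open>The q-th power of \<open>zn_sum\<close> is \<open>Hs d ^ q\<close> on one side, and by
  \<open>zn_power\<close> the product of \<open>Hs d ^ (q - 1)\<close> with the wanted sum on the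
  other. The lemma expresses that E_(-1,1)^q = -h.\<close>

lemma Ehat_1_0: "Ehat 1 0 = - hh"
proof (rule LIMSEQ_eq_ge_1)
  show "(\<lambda>d. En 1 0 (Suc d)) \<longlonglongrightarrow> Ehat 1 0" by (rule En_lim_Suc)
  show "Hs \<longlonglongrightarrow> - hh" by (rule Hs_lim)
  fix d :: nat assume d: "d \<ge> 1"
  have "Hs d ^ (q - 1) * Hs d = Hs d ^ q" by (rule power_minus_mult) simp
  also have "\<dots> = (\<Sum>i<Suc d. kc theta ^ i * zn d i) ^ (q ^ 1)" by (simp only: zn_sum[OF d] power_one_right)
  also have "\<dots> = (\<Sum>i<Suc d. Hs d ^ (q - 1) * (kc (theta ^ (q ^ 1)) ^ i * Yn (Suc d) i ^ (q ^ 0)))"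
    unfolding frob_fps_sum power_mult_distrib
  proof (rule sum.cong[OF refl])
    fix i assume "i \<in> {..<Suc d}"
    hence z: "zn d i ^ (q ^ 1) = Hs d ^ (q - 1) * Yn (Suc d) i"
      using zn_power[OF d, of i] by simp
    have "(kc theta ^ i) ^ (q ^ 1) = kc (theta ^ (q ^ 1)) ^ i"
      by (simp add: kc.hom_power mult.commute flip: power_mult)
    thus "(kc theta ^ i) ^ (q ^ 1) * zn d i ^ (q ^ 1) = Hs d ^ (q - 1) * (kc (theta ^ (q ^ 1)) ^ i * Yn (Suc d) i ^ (q ^ 0))"
      unfolding z by simp
  qed
  also have "\<dots> = Hs d ^ (q - 1) * En 1 0 (Suc d)"
    unfolding sum_distrib_left[symmetric] by (subst En_Yn[OF order.refl]) (rule refl)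
  finally show "En 1 0 (Suc d) = Hs d" using Hs_nz[of d] by simp
qed

section \<open>The orders of the coefficient series Y i\<close>

lemma Y_lim: "(\<lambda>d. Yn d i) \<longlonglongrightarrow> Y i" by (rule u_series_lim) simp

definition Z :: "nat \<Rightarrow> 'a ratfun fps" where
  "Z i = gg * Y i + kc theta ^ q * Y i ^ q - (case i of 0 \<Rightarrow> 0 | Suc i' \<Rightarrow> Y i' ^ q)"

lemma Z_power: "Z i ^ q = hh ^ (q - 1) * Y i"
proof (rule LIMSEQ_eq_ge_1)
  have "(\<lambda>d. zn d i) \<longlonglongrightarrow> Z i"
  proof (cases i)
    case 0
    show ?thesis unfolding zn_def Z_def 0 nat.case
      by (intro tendsto_add_fps tendsto_diff_fps tendsto_mult_fps tendsto_power_fps tendsto_const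
        gln_lim Y_lim LIMSEQ_Suc[OF Y_lim])
  next
    case (Suc i')
    show ?thesis unfolding zn_def Z_def Suc nat.case
      by (intro tendsto_add_fps tendsto_diff_fps tendsto_mult_fps tendsto_power_fps tendsto_const
        gln_lim Y_lim LIMSEQ_Suc[OF Y_lim])
  qed
  hence "(\<lambda>d. zn (d + i) i) \<longlonglongrightarrow> Z i" by (rule LIMSEQ_ignore_initial_segment)
  thus "(\<lambda>d. zn (d + i) i ^ q) \<longlonglongrightarrow> Z i ^ q" by (rule tendsto_power_fps)
  have "(\<lambda>d. Hs d ^ (q - 1) * Yn (Suc d) i) \<longlonglongrightarrow> hh ^ (q - 1) * Y i"
    unfolding minus_hh_power[symmetric]
    by (intro tendsto_mult_fps tendsto_power_fps Hs_lim LIMSEQ_Suc[OF Y_lim])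
  thus "(\<lambda>d. Hs (d + i) ^ (q - 1) * Yn (Suc (d + i)) i) \<longlonglongrightarrow> hh ^ (q - 1) * Y i"
    by (rule LIMSEQ_ignore_initial_segment)
  fix d :: nat assume "d \<ge> 1"
  thus "zn (d + i) i ^ q = Hs (d + i) ^ (q - 1) * Yn (Suc (d + i)) i" by (intro zn_power) auto
qed

lemma hh_subdegree: "subdegree hh = 1" "fps_lead hh = - 1"
proof -
  have 1: "fps_nth hh 1 = - 1" using PPI_0 by (simp add: hh_eq fps_nth_power_0)
  have 2: "fps_nth hh m = 0" if "m < 1" for m using that by (simp add: hh_eq)
  from subdegree_fps_leadI[OF 1 _ 2] show "subdegree hh = 1" "fps_lead hh = - 1" by simp_all
qed

lemma hh_nz: "hh \<noteq> 0" using hh_subdegree by auto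

text \<open>The recursion compares orders in \<open>Z (Suc i) ^ q = hh ^ (q - 1) * Y (Suc i)\<close>
  when \<open>Z (Suc i)\<close> begins like \<open>Y i ^ q\<close> up to sign.\<close>

primrec \<rho> :: "nat \<Rightarrow> nat" where
  "\<rho> 0 = 1"
| "\<rho> (Suc i) = q\<^sup>2 * \<rho> i - (q - 1)"

lemma \<rho>_eq: "(q + 1) * \<rho> i = q ^ (2 * i + 1) + 1"
proof (induction i)
  case (Suc i)
  have "\<rho> i \<noteq> 0" using Suc by (cases "\<rho> i") auto
  hence r: "\<rho> i \<ge> 1" by simp
  have "q - 1 \<le> q * q" using le_q_mult[of q] by linarith
  also have "\<dots> \<le> q * q * \<rho> i" using r by simp
  finally have "\<rho> (Suc i) + (q - 1) = q\<^sup>2 * \<rho> i" by (simp add: power2_eq_square)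
  hence "(q + 1) * (\<rho> (Suc i) + (q - 1)) = (q + 1) * (q\<^sup>2 * \<rho> i)" by (rule arg_cong)
  hence "(q + 1) * \<rho> (Suc i) + (q + 1) * (q - 1) = q\<^sup>2 * ((q + 1) * \<rho> i)"
    unfolding distrib_left[of "q + 1"] mult.left_commute[of "q\<^sup>2"] .
  also have "\<dots> = q ^ (2 * Suc i + 1) + q\<^sup>2" unfolding Suc by (simp add: algebra_simps power2_eq_square)
  also have "(q + 1) * (q - 1) = q\<^sup>2 - 1" by (simp add: algebra_simps power2_eq_square diff_mult_distrib2)
  finally have "(q + 1) * \<rho> (Suc i) + (q\<^sup>2 - 1) = q ^ (2 * Suc i + 1) + q\<^sup>2" .
  moreover have "q\<^sup>2 \<ge> 1" by simp
  ultimately show ?case by linarith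
qed simp

lemma Y_low: "m < q ^ i \<Longrightarrow> fps_nth (Y i) m = 0"
  using u_series_nth[of 1 m i "yc i"] Yn_d[of i i] by simp

text \<open>If the order of \<open>Y (Suc i)\<close> were at most that of \<open>Y i ^ q\<close>, it
  would bound the order of \<open>Z (Suc i)\<close> from below; then \<open>Z_power\<close> would
  force it to be at most 1, against \<open>Y_low\<close>. So \<open>Z (Suc i)\<close> begins with
  the leading term of - \<open>Y i ^ q\<close>, and \<open>Z_power\<close> returns the leading term
  of \<open>Y (Suc i)\<close>.\<close>

lemma Y_order: "subdegree (Y i) = \<rho> i \<and> fps_lead (Y i) = (-1) ^ i"
proof (induction i)
  case 0
  have m1: "monics_below 1 = {1 :: 'a poly}"
  proof -
    have "monics_below (Suc 0) = {monom (1 :: 'a) 0}"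
      unfolding monics_below_Suc by (simp add: monics_below_0 lows_0)
    thus ?thesis by (simp only: monom_0 one_pCons One_nat_def)
  qed
  have "Yn 1 0 = u_mult 1" unfolding u_partial_def m1 by (simp add: yc_def one_pCons[symmetric])
  also have "\<dots> = fps_X * inverse (carlitz_recip 1)" by (simp add: u_mult_def)
  finally have Y: "Yn 1 0 = fps_X * inverse (carlitz_recip 1)" .
  have "fps_nth (carlitz_recip (1 :: 'a poly)) 0 = 1" using recip_0[of 1] by (simp add: one_pCons[symmetric])
  hence 1: "fps_nth (Y 0) 1 = 1" using u_series_nth[of 1 1 1 "yc 0"] q2 Y by simp
  have 2: "fps_nth (Y 0) m = 0" if "m < 1" for m using that Y_low[of m 0] by simp
  from subdegree_fps_leadI[OF 1 _ 2] show ?case by simp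
next
  case (Suc i)
  define y where "y = Y (Suc i)"
  define r where "r = \<rho> i"
  have Yi: "subdegree (Y i) = r" "fps_lead (Y i) = (-1) ^ i" using Suc by (simp_all add: r_def)
  have Yi0: "Y i \<noteq> 0" using Yi(2) by (auto simp: fps_lead_def)
  have Z: "Z (Suc i) = gg * y + kc theta ^ q * y ^ q - Y i ^ q" by (simp add: Z_def y_def)
  have Zq: "Z (Suc i) ^ q = hh ^ (q - 1) * y" by (simp add: Z_power y_def)
  have y0: "y \<noteq> 0"
  proof
    assume "y = 0"
    hence "Z (Suc i) = - (Y i ^ q)" "Z (Suc i) ^ q = 0" using Z Zq by (auto simp: power_0_left)
    thus False using Yi0 by simp
  qed
  define ov where "ov = subdegree y"
  have "q ^ Suc i \<le> ov"
    unfolding ov_def by (rule subdegree_geI[OF y0]) (use Y_low[of _ "Suc i"] in \<open>simp add: y_def\<close>)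
  moreover have "q ^ Suc i \<ge> q" using le_q_mult[of 1] by simp
  ultimately have o2: "ov \<ge> 2" using q2 by linarith
  have Z0: "Z (Suc i) \<noteq> 0" using Zq hh_nz y0 by (auto simp: power_0_left)
  have sZ: "q * subdegree (Z (Suc i)) = (q - 1) + ov"
    using arg_cong[OF Zq, of subdegree] hh_nz y0 by (simp add: subdegree_power hh_subdegree ov_def)
  have y_low: "fps_nth (gg * y + kc theta ^ q * y ^ q) m = 0" if "m < ov" for m
  proof -
    have "y * (gg + kc theta ^ q * y ^ (q - 1)) = gg * y + kc theta ^ q * (y ^ (q - 1) * y)"
      by (simp add: algebra_simps)
    also have "y ^ (q - 1) * y = y ^ q" by (rule power_minus_mult) simp
    finally have *: "gg * y + kc theta ^ q * y ^ q = y * (gg + kc theta ^ q * y ^ (q - 1))" ..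
    show ?thesis
      unfolding * by (rule fps_mult_nth_outside_subdegrees(1)) (use that ov_def in simp)
  qed
  have sYq: "subdegree (Y i ^ q) = q * r" by (simp only: subdegree_power Yi)
  have "q * r < ov"
  proof (rule ccontr)
    assume "\<not> q * r < ov"
    have "ov \<le> subdegree (Z (Suc i))"
    proof (rule subdegree_geI[OF Z0])
      fix m assume m: "m < ov"
      hence "fps_nth (Y i ^ q) m = 0" using sYq \<open>\<not> q * r < ov\<close> by (intro nth_less_subdegree_zero) simp
      thus "fps_nth (Z (Suc i)) m = 0" unfolding Z using y_low[OF m] by simp
    qed
    hence "q * ov \<le> (q - 1) + ov" unfolding sZ[symmetric] by simp
    hence "(q - 1) * ov \<le> (q - 1) * 1" by (simp add: diff_mult_distrib)
    thus False using o2 q2 by simp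
  qed
  hence "fps_nth (Z (Suc i)) (q * r) = - fps_lead (Y i ^ q)"
    unfolding Z using y_low[of "q * r"] sYq by (simp add: fps_lead_def)
  also have "fps_lead (Y i ^ q) = ((-1) ^ q) ^ i"
    unfolding fps_lead_power Yi by (simp only: power_mult[symmetric] mult.commute)
  finally have Zr: "fps_nth (Z (Suc i)) (q * r) = (-1) ^ Suc i" by (simp add: neg_one_q)
  have Zl: "fps_nth (Z (Suc i)) m = 0" if "m < q * r" for m
    unfolding Z using y_low[of m] that \<open>q * r < ov\<close> sYq nth_less_subdegree_zero[of m "Y i ^ q"] by simp
  from subdegree_fps_leadI[OF Zr _ Zl] have Zs: "subdegree (Z (Suc i)) = q * r" "fps_lead (Z (Suc i)) = (-1) ^ Suc i"
    by simp_all
  have "ov = \<rho> (Suc i)" using sZ unfolding Zs by (simp add: r_def power2_eq_square mult.assoc)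
  moreover have "fps_lead y = (-1) ^ Suc i"
  proof -
    have "((-1) ^ Suc i) ^ q = fps_lead (hh ^ (q - 1)) * fps_lead y"
      using arg_cong[OF Zq, of fps_lead] Zs by (simp only: fps_lead_power fps_lead_mult)
    also have "fps_lead (hh ^ (q - 1)) = 1" by (simp only: fps_lead_power hh_subdegree neg_one_q_minus_1)
    also have "((-1 :: 'a ratfun) ^ Suc i) ^ q = ((-1) ^ q) ^ Suc i" by (simp only: power_mult[symmetric] mult.commute)
    finally show ?thesis by (simp only: neg_one_q mult_1_left)
  qed
  ultimately show ?case by (simp add: y_def ov_def)
qed

end

subsection \<open>The determinants\<close>

text \<open>Moving the largest value to the last position by one transposition raises the sum by a
  product of two positive differences. The strict form singles out one term in the expansion of a
  determinant.\<close>

lemma rearrangement: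
  fixes f g :: "nat \<Rightarrow> int"
  assumes "\<And>i j. i < j \<Longrightarrow> j < k \<Longrightarrow> f i < f j" "\<And>i j. i < j \<Longrightarrow> j < k \<Longrightarrow> g i < g j"
    and "p permutes {..<k}"
  shows "(\<Sum>i<k. f i * g (p i)) \<le> (\<Sum>i<k. f i * g i)"
    and "p \<noteq> id \<Longrightarrow> (\<Sum>i<k. f i * g (p i)) < (\<Sum>i<k. f i * g i)"
proof -
  have "(\<Sum>i<k. f i * g (p i)) \<le> (\<Sum>i<k. f i * g i) \<and>
        (p \<noteq> id \<longrightarrow> (\<Sum>i<k. f i * g (p i)) < (\<Sum>i<k. f i * g i))"
    using assms
  proof (induction k arbitrary: p)
    case 0
    thus ?case by simp
  next
    case (Suc k)
    have fixk: "p' permutes {..<k}" if "p' permutes {..<Suc k}" "p' k = k" for p'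
      by (rule permutes_superset[OF that(1)]) (use that(2) in \<open>auto simp: less_Suc_eq\<close>)
    have mono: "f i < f j" "g i < g j" if "i < j" "j < k" for i j
      using that Suc.prems(1,2) by (auto simp: less_Suc_eq)
    show ?case
    proof (cases "p k = k")
      case True
      from Suc.IH[OF mono fixk[OF Suc.prems(3) True]] show ?thesis using True by auto
    next
      case False
      define m where "m = inv_into UNIV p k"
      have pm: "p m = k" using permutes_inverses(1)[OF Suc.prems(3)] by (simp add: m_def)
      have "m < Suc k" using pm Suc.prems(3) by (metis lessI lessThan_iff permutes_not_in)
      moreover have "m \<noteq> k" using pm False by auto
      ultimately have m: "m < k" by simp
      have r: "p k < k" using False permutes_in_image[OF Suc.prems(3), of k] by auto
      define p' where "p' = p \<circ> Transposition.transpose m k"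
      have p': "p' permutes {..<Suc k}" unfolding p'_def
        by (rule permutes_compose[OF permutes_swap_id Suc.prems(3)]) (use m in auto)
      have p'k: "p' k = k" and p'm: "p' m = p k" and p'i: "i \<noteq> m \<Longrightarrow> i \<noteq> k \<Longrightarrow> p' i = p i" for i
        using pm by (simp_all add: p'_def)
      have split: "(\<Sum>i<Suc k. h i) = (\<Sum>i\<in>{..<k} - {m}. h i) + h m + h k" for h :: "nat \<Rightarrow> int"
        using m by (simp add: sum.remove[of "{..<k}" m])
      have eq: "(\<Sum>i\<in>{..<k} - {m}. f i * g (p' i)) = (\<Sum>i\<in>{..<k} - {m}. f i * g (p i))"
        by (intro sum.cong refl) (use p'i in auto)
      have "(f k - f m) * (g k - g (p k)) > 0"
        using Suc.prems(1)[of m k] Suc.prems(2)[of "p k" k] m r by (intro mult_pos_pos) auto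
      hence "(\<Sum>i<Suc k. f i * g (p i)) < (\<Sum>i<Suc k. f i * g (p' i))"
        unfolding split eq p'k p'm pm by (simp add: algebra_simps)
      also have "\<dots> \<le> (\<Sum>i<Suc k. f i * g i)"
        using Suc.IH[OF mono fixk[OF p' p'k]] p'k by simp
      finally show ?thesis by simp
    qed
  qed
  thus "(\<Sum>i<k. f i * g (p i)) \<le> (\<Sum>i<k. f i * g i)"
    and "p \<noteq> id \<Longrightarrow> (\<Sum>i<k. f i * g (p i)) < (\<Sum>i<k. f i * g i)" by auto
qed

lemma det_expand:
  "det (mat k k (\<lambda>(a, b). f a b)) = (\<Sum>r\<in>{r. r permutes {..<k}}. of_int (sign r) * (\<Prod>a<k. f a (r a)))"
proof -
  have c: "mat k k (\<lambda>(a, b). f a b) \<in> carrier_mat k k" by simp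
  have "det (mat k k (\<lambda>(a, b). f a b)) =
     (\<Sum>r\<in>{r. r permutes {..<k}}. of_int (sign r) * (\<Prod>a<k. mat k k (\<lambda>(a, b). f a b) $$ (a, r a)))"
    by (simp only: det_def'[OF c] atLeast0LessThan)
  also have "\<dots> = (\<Sum>r\<in>{r. r permutes {..<k}}. of_int (sign r) * (\<Prod>a<k. f a (r a)))"
  proof (intro sum.cong refl arg_cong2[where f = "(*)"] prod.cong)
    fix r s assume "r \<in> {r. r permutes {..<k}}" "s \<in> {..<k}"
    hence "s < k" "r s < k" using permutes_in_image[of r "{..<k}" s] by auto
    thus "mat k k (\<lambda>(a, b). f a b) $$ (s, r s) = f s (r s)" by simp
  qed
  finally show ?thesis .
qed

definition rev_perm :: "nat \<Rightarrow> nat \<Rightarrow> nat" where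
  "rev_perm k s = (if s < k then k - 1 - s else s)"

definition shift_perm :: "nat \<Rightarrow> nat \<Rightarrow> nat" where
  "shift_perm k t = (if t < k then Suc t else if t = k then 0 else t)"

lemma rev_perm_permutes: "rev_perm k permutes {..<k}"
  by (rule bij_imp_permutes, rule bij_betw_byWitness[where f' = "rev_perm k"]) (auto simp: rev_perm_def)

lemma rev_perm_involution: "rev_perm k (rev_perm k s) = s"
  by (auto simp: rev_perm_def)

lemma shift_perm_sign: "permutation (shift_perm k) \<and> sign (shift_perm k) = (-1) ^ k"
proof (induction k)
  case 0
  have "shift_perm 0 = id" by (auto simp: shift_perm_def fun_eq_iff)
  thus ?case by (simp add: sign_id)
next
  case (Suc k)
  have *: "shift_perm (Suc k) = Transposition.transpose (Suc k) 0 \<circ> shift_perm k"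
    by (auto simp: shift_perm_def fun_eq_iff Transposition.transpose_def)
  show ?case unfolding *
    by (subst sign_compose) (use Suc in \<open>auto intro: permutation_compose permutation_swap_id simp: sign_swap_id\<close>)
qed

text \<open>Reversing k + 1 elements is reversing k of them followed by a cycle of length k + 1. The
  product over s is that of the leading coefficients of the series \<open>G s n\<close> below, so
  the sign cancels it.\<close>

lemma rev_perm_sign: "sign (rev_perm k) * (\<Prod>s<k. (-1) ^ s) = 1"
proof (induction k)
  case 0
  have "rev_perm 0 = id" by (auto simp: rev_perm_def fun_eq_iff)
  thus ?case by (simp add: sign_id)
next
  case (Suc k)
  have "rev_perm (Suc k) = shift_perm k \<circ> rev_perm k"
    by (auto simp: shift_perm_def rev_perm_def fun_eq_iff)
  hence "sign (rev_perm (Suc k)) = (-1) ^ k * sign (rev_perm k)"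
    using shift_perm_sign[of k] permutes_imp_permutation[OF _ rev_perm_permutes[of k]]
    by (simp add: sign_compose)
  hence "sign (rev_perm (Suc k)) * (\<Prod>s<Suc k. (-1) ^ s) = 
     (sign (rev_perm k) * (\<Prod>s<k. (-1) ^ s)) * ((-1) ^ k * (-1) ^ k)" by (simp add: mult_ac)
  also have "\<dots> = 1" unfolding Suc by (simp flip: power_mult_distrib)
  finally show ?case .
qed

lemma subdegree_prod_fps:
  fixes f :: "'c \<Rightarrow> 'b::idom fps"
  assumes "finite A" "\<And>x. x \<in> A \<Longrightarrow> f x \<noteq> 0"
  shows "subdegree (prod f A) = (\<Sum>x\<in>A. subdegree (f x))"
  using assms by (induction A rule: finite_induct) (auto simp: subdegree_mult)

lemma fps_lead_prod: "fps_lead (prod f A) = (\<Prod>x\<in>A. fps_lead (f x :: 'b::idom fps))"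
  by (induction A rule: infinite_finite_induct) (simp_all add: fps_lead_mult)

context drinfeld
begin

section \<open>Identification of the series with Frobenius powers of the E_(j,1)\<close>

lemma u_partial_power: "u_partial \<psi> n d ^ (q ^ m) = u_partial (\<lambda>c. \<psi> c ^ (q ^ m)) (n * q ^ m) d"
  unfolding u_partial_def frob_fps_sum by (simp add: power_mult_distrib fps_const_power power_mult)

lemma u_series_power:
  assumes "n \<ge> 1"
  shows "u_series \<psi> n ^ (q ^ m) = u_series (\<lambda>c. \<psi> c ^ (q ^ m)) (n * q ^ m)"
proof -
  have "1 \<le> n * q ^ m" using assms by simp
  from u_series_lim[OF this, of "\<lambda>c. \<psi> c ^ (q ^ m)"] tendsto_power_fps[OF u_series_lim[OF assms], of \<psi> "q ^ m"]
  show ?thesis unfolding u_partial_power by (rule LIMSEQ_unique[rotated])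
qed

lemma Ehat_power: "Ehat s n ^ (q ^ m) = Ehat (s + m) (n + m)"
  unfolding Ehat_def by (subst u_series_power) (simp_all add: power_add power_mult flip: to_fract_hom.hom_power)

lemma Y_power: "Y i ^ (q ^ n) = u_series (yc i) (q ^ n)"
  by (subst u_series_power) (simp_all add: yc_def[abs_def] const_q_power)

lemma u_series_linear:
  assumes "n \<ge> 1" "\<And>c. \<psi> c = (\<Sum>i\<in>A. a i * \<psi>' i c)"
  shows "u_series \<psi> n = (\<Sum>i\<in>A. fps_const (a i) * u_series (\<psi>' i) n)"
proof (rule fps_ext)
  fix m
  have m: "m < q ^ m" by (rule lt_q_power)
  have "u_partial \<psi> n m = (\<Sum>c\<in>monics_below m. \<Sum>i\<in>A. fps_const (a i) * (fps_const (\<psi>' i c) * u_mult c ^ n))"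
    unfolding u_partial_def assms(2) fps_const_sum_K sum_distrib_right
    by (simp add: mult.assoc flip: fps_const_mult)
  also have "\<dots> = (\<Sum>i\<in>A. fps_const (a i) * u_partial (\<psi>' i) n m)"
    unfolding u_partial_def sum_distrib_left by (rule sum.swap)
  finally show "fps_nth (u_series \<psi> n) m = fps_nth (\<Sum>i\<in>A. fps_const (a i) * u_series (\<psi>' i) n) m"
    unfolding u_series_nth[OF assms(1) m] by (simp add: fps_sum_nth u_series_nth[OF assms(1) m])
qed

lemma emb_hom [simp]: 
  "emb (0 :: 'a ratfun fps) = 0" "emb (1 :: 'a ratfun fps) = 1"
  "emb (f + g) = emb f + emb (g :: 'a ratfun fps)" "emb (f * g) = emb f * emb (g :: 'a ratfun fps)"
  "emb (- f) = - emb (f :: 'a ratfun fps)" "emb (f - g) = emb f - emb (g :: 'a ratfun fps)"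
  "emb (f ^ n) = emb (f :: 'a ratfun fps) ^ n"
  by (simp_all add: emb_def fls_times_fps_to_fls fps_to_fls_power)

lemma emb_eq_iff [simp]: "emb f = emb g \<longleftrightarrow> f = (g :: 'a ratfun fps)"
  by (simp add: emb_def)

sublocale emb: inj_comm_ring_hom "emb :: 'a ratfun fps \<Rightarrow> 'a closure_field"
proof
  fix x :: "'a ratfun fps" assume "emb x = 0"
  hence "emb x = emb 0" by simp
  thus "x = 0" by (simp only: emb_eq_iff)
qed simp_all

lemma theta_power_neq: "i \<noteq> j \<Longrightarrow> (theta :: 'a poly) ^ (q ^ i) - theta ^ (q ^ j) \<noteq> 0"
proof
  assume "i \<noteq> j" "(theta :: 'a poly) ^ (q ^ i) - theta ^ (q ^ j) = 0"
  hence "degree ((theta :: 'a poly) ^ (q ^ i)) = degree ((theta :: 'a poly) ^ (q ^ j))" by simp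
  hence "q ^ i = q ^ j" by (simp add: theta_monom degree_monom_eq)
  thus False using \<open>i \<noteq> j\<close> by (simp add: power_inject_exp)
qed

lemma kc_theta_neq: "i \<noteq> j \<Longrightarrow> kc theta ^ (q ^ i) - kc theta ^ (q ^ j) \<noteq> 0"
  using theta_power_neq[of i j] by (simp flip: kc.hom_power kc.hom_minus)

lemma frob_pos: "frob (int n) x = (x :: 'a closure_field) ^ (q ^ n)"
  by (simp add: frob_def card_q)

lemma frob_power_shift:
  fixes x :: "'a closure_field"
  assumes "i + int s \<ge> 0"
  shows "frob i x ^ (q ^ s) = x ^ (q ^ nat (i + int s))"
proof (cases "i \<ge> 0")
  case True
  hence "nat (i + int s) = nat i + s" by (simp add: nat_add_distrib)
  thus ?thesis using True by (simp add: frob_def card_q power_add power_mult)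
next
  case False
  have *: "frob i x ^ (q ^ nat (- i)) = x"
    using theI'[OF root_unique[of p e "nat (- i)" x]] prime_p q_pe card_q False by (simp add: frob_def)
  have "s = nat (- i) + nat (i + int s)" using assms False by simp
  hence "q ^ s = q ^ nat (- i) * q ^ nat (i + int s)" by (simp only: power_add[symmetric])
  hence "frob i x ^ (q ^ s) = (frob i x ^ (q ^ nat (- i))) ^ (q ^ nat (i + int s))"
    by (simp only: power_mult)
  thus ?thesis unfolding * .
qed

lemma CHAR_cl: "CHAR('a closure_field) = p" by (simp add: CHAR_K)

lemma frob_cl: "((x :: 'a closure_field) + y) ^ (q ^ n) = x ^ (q ^ n) + y ^ (q ^ n)"
  by (rule frob_gen[OF CHAR_cl])

lemma frob_cl_minus: "(- x :: 'a closure_field) ^ (q ^ n) = - (x ^ (q ^ n))"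
  by (rule frob_gen_minus[OF CHAR_cl])

lemma frob_cl_diff: "((x :: 'a closure_field) - y) ^ (q ^ n) = x ^ (q ^ n) - y ^ (q ^ n)"
  by (rule frob_gen_diff[OF CHAR_cl])

lemma bracket_power:
  assumes "i + int s \<ge> 0"
  shows "(bracket i :: 'a closure_field) ^ (q ^ s) =
     emb (kc theta ^ (q ^ nat (i + int s)) - kc theta ^ (q ^ s))"
  by (simp add: bracket_def frob_cl_diff frob_power_shift[OF assms] const_A_kc)

lemma bracket_nz: "i \<noteq> 0 \<Longrightarrow> (bracket i :: 'a closure_field) \<noteq> 0"
proof
  assume i: "i \<noteq> 0" "bracket i = (0 :: 'a closure_field)"
  define s where "s = nat (- i)"
  have s: "i + int s \<ge> 0" by (simp add: s_def)
  have "emb (kc theta ^ (q ^ nat (i + int s)) - kc theta ^ (q ^ s)) = 0"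
    using bracket_power[OF s] i(2) by (simp add: power_0_left)
  moreover have "nat (i + int s) \<noteq> s" using i(1) s by (simp add: s_def)
  ultimately show False using kc_theta_neq[of "nat (i + int s)" s] emb.hom_0_iff by blast
qed

lemma Delta_power: "(Delta_series :: 'a ratfun fps) ^ (q ^ n) = - ((hh ^ (q - 1)) ^ (q ^ n))"
  by (simp only: Delta_series_def card_q frob_fps_minus)

text \<open>For negative j the value \<open>E1 j\<close> contains q-power roots; the power q^s with
  s \<ge> -j clears them, and the downward recursion becomes \<open>Ehat_rec\<close> read
  backwards.\<close>

lemma E1_eq: "j + int s \<ge> 0 \<Longrightarrow> (E1 j :: 'a closure_field) ^ (q ^ s) = emb (Ehat s (nat (j + int s)))"
proof (induction j arbitrary: s rule: E1.induct)
  case (1 j)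
  consider "j = 0" | "j = 1" | "j \<ge> 2" | "j < 0" by linarith
  thus ?case
  proof cases
    case 1
    have "(E1 j :: 'a closure_field) = emb (Ehat 0 0)" using 1 by (subst E1.simps) (simp add: Ehat_0_0)
    thus ?thesis using 1 Ehat_power[of 0 0 s] by (simp flip: emb_hom)
  next
    case 2
    have b: "(bracket 1 :: 'a closure_field) = emb (kc theta ^ q - kc theta)"
      using bracket_power[of 1 0] by simp
    have bn: "(bracket 1 :: 'a closure_field) \<noteq> 0" by (rule bracket_nz) simp
    have "bracket 1 * emb (Ehat 0 1) = - emb (EE * gg + hh)"
    proof -
      have "(kc theta ^ q - kc theta) * Ehat 0 1 = - (EE * gg + hh)"
        using Ehat_0_1 by (simp add: algebra_simps eq_diff_eq)
      thus ?thesis unfolding b emb_hom(4)[symmetric] by (simp only: emb_hom)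
    qed
    hence "(E1 j :: 'a closure_field) = emb (Ehat 0 1)"
      using 2 bn by (subst E1.simps) (simp add: field_simps)
    thus ?thesis using 2 Ehat_power[of 0 1 s] by (simp flip: emb_hom add: nat_add_distrib)
  next
    case 3
    define n where "n = nat (j - 2 + int s)"
    have n1: "nat (j - 1 + int s) = Suc n" and n2: "nat (j + int s) = Suc (Suc n)"
      using 3 by (auto simp: n_def)
    have nz: "(bracket j :: 'a closure_field) \<noteq> 0" by (rule bracket_nz) (use 3 in simp)
    have IH: "(E1 (j - 2) :: 'a closure_field) ^ (q ^ s) = emb (Ehat s n)"
             "(E1 (j - 1) :: 'a closure_field) ^ (q ^ s) = emb (Ehat s (Suc n))"
      using 1(1,2)[of s] 3 n1 by (auto simp: n_def)
    have "bracket j * E1 j = - (frob (j - 2) (emb Delta_series) * E1 (j - 2) +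
             frob (j - 1) (emb gg) * (E1 (j - 1) :: 'a closure_field))"
      using 3 nz by (subst E1.simps) simp
    hence "(bracket j * E1 j) ^ (q ^ s) = (- (frob (j - 2) (emb Delta_series) * E1 (j - 2) +
             frob (j - 1) (emb gg) * (E1 (j - 1) :: 'a closure_field))) ^ (q ^ s)" by simp
    also have "\<dots> = - (emb (Delta_series ^ (q ^ n)) * emb (Ehat s n) + emb (gg ^ (q ^ Suc n)) * emb (Ehat s (Suc n)))"
      unfolding frob_cl_minus frob_cl power_mult_distrib IH
      using 3 by (simp add: frob_power_shift n1 n_def[symmetric])
    also have "\<dots> = emb ((hh ^ (q - 1)) ^ (q ^ n) * Ehat s n - gg ^ (q ^ Suc n) * Ehat s (Suc n))"
      unfolding Delta_power by (simp only: emb_hom) simp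
    also have "(hh ^ (q - 1)) ^ (q ^ n) * Ehat s n - gg ^ (q ^ Suc n) * Ehat s (Suc n) =
        (kc theta ^ (q ^ Suc (Suc n)) - kc theta ^ (q ^ s)) * Ehat s (Suc (Suc n))"
      unfolding Ehat_rec[symmetric] by (rule add_diff_cancel_left')
    finally have "bracket j ^ (q ^ s) * E1 j ^ (q ^ s) = bracket j ^ (q ^ s) * emb (Ehat s (Suc (Suc n)))"
      using 3 by (simp only: power_mult_distrib emb_hom(4) bracket_power[of j s] n2)
    thus ?thesis using nz n2 by simp
  next
    case 4
    have js: "j + int s \<ge> 0" by (rule 1(5))
    define n where "n = nat (j + int s)"
    have n1: "nat (j + 1 + int s) = Suc n" and n2: "nat (j + 2 + int s) = Suc (Suc n)"
      using js by (auto simp: n_def)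
    have IH: "(E1 (j + 2) :: 'a closure_field) ^ (q ^ s) = emb (Ehat s (Suc (Suc n)))"
             "(E1 (j + 1) :: 'a closure_field) ^ (q ^ s) = emb (Ehat s (Suc n))"
      using 1(3,4)[of s] 4 js n1 n2 by (auto)
    define D where "D = frob j (emb Delta_series :: 'a closure_field)"
    have D: "D ^ (q ^ s) = emb (Delta_series ^ (q ^ n))"
      unfolding D_def by (simp add: frob_power_shift[OF js] n_def)
    have Dnz: "D \<noteq> 0"
    proof
      assume "D = 0"
      hence "emb (Delta_series ^ (q ^ n) :: 'a ratfun fps) = 0" using D by (simp add: power_0_left)
      hence "(Delta_series ^ (q ^ n) :: 'a ratfun fps) = 0" by (simp only: emb.hom_0_iff)
      thus False using hh_nz by (simp add: Delta_power)
    qed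
    have "D * E1 j = - (bracket (j + 2) * E1 (j + 2) +
             frob (j + 1) (emb gg) * (E1 (j + 1) :: 'a closure_field))"
      using 4 Dnz by (subst E1.simps) (simp add: D_def)
    hence "(D * E1 j) ^ (q ^ s) = (- (bracket (j + 2) * E1 (j + 2) +
             frob (j + 1) (emb gg) * (E1 (j + 1) :: 'a closure_field))) ^ (q ^ s)" by simp
    also have "\<dots> = - (emb (kc theta ^ (q ^ Suc (Suc n)) - kc theta ^ (q ^ s)) * emb (Ehat s (Suc (Suc n))) + 
                        emb (gg ^ (q ^ Suc n)) * emb (Ehat s (Suc n)))"
      unfolding frob_cl_minus frob_cl power_mult_distrib IH
      using js by (simp only: bracket_power[of "j + 2" s] frob_power_shift[of "j + 1" s] n1 n2 emb_hom)
    also have "\<dots> = emb (- (gg ^ (q ^ Suc n) * Ehat s (Suc n) + (kc theta ^ (q ^ Suc (Suc n)) - kc theta ^ (q ^ s)) * Ehat s (Suc (Suc n))))"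
      by (simp only: emb_hom add.commute)
    also have "\<dots> = emb (Delta_series ^ (q ^ n)) * emb (Ehat s n)"
      unfolding Ehat_rec Delta_power by (simp only: emb_hom mult_minus_left)
    finally have "D ^ (q ^ s) * E1 j ^ (q ^ s) = D ^ (q ^ s) * emb (Ehat s n)"
      by (simp only: power_mult_distrib D)
    thus ?thesis using Dnz by (simp add: n_def)
  qed
qed

section \<open>Newton interpolation and the factor B_k(\<theta>)\<close>

definition theta_q :: "nat \<Rightarrow> 'a poly" where "theta_q a = theta ^ (q ^ a)"

text \<open>
  The divided difference of \<open>t^i\<close> at the nodes \<open>\<theta>^(q^0), \<dots>, \<theta>^(q^(s-1)), \<theta>^(q^a)\<close>.
\<close>

fun div_diff :: "nat \<Rightarrow> nat \<Rightarrow> nat \<Rightarrow> 'a poly" where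
  "div_diff 0 a i = theta_q a ^ i"
| "div_diff (Suc s) a 0 = 0"
| "div_diff (Suc s) a (Suc i) = theta_q a * div_diff (Suc s) a i + div_diff s s i"

text \<open>This is the usual quotient formula for divided differences. The definition uses the
  product rule for t times t^i instead, which needs no division: the values lie in A, and repeated
  nodes are allowed.\<close>

lemma div_diff_diff: "div_diff s a i - div_diff s s i = (theta_q a - theta_q s) * div_diff (Suc s) a i"
proof (induction i)
  case 0
  show ?case by (cases s) simp_all
next
  case (Suc i)
  have *: "div_diff s b (Suc i) = theta_q b * div_diff s b i + (case s of 0 \<Rightarrow> 0 | Suc s' \<Rightarrow> div_diff s' s' i)" for b
    by (cases s) simp_all
  have "div_diff s a (Suc i) - div_diff s s (Suc i) = theta_q a * (div_diff s a i - div_diff s s i) + (theta_q a - theta_q s) * div_diff s s i"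
    unfolding * by (simp add: algebra_simps)
  thus ?case unfolding Suc by (simp add: algebra_simps)
qed

lemma div_diff_lt: "i < s \<Longrightarrow> div_diff s a i = 0"
proof (induction i arbitrary: s a)
  case 0
  thus ?case by (cases s) auto
next
  case (Suc i)
  thus ?case by (cases s) auto
qed

lemma div_diff_diag: "div_diff s a s = 1"
  by (induction s arbitrary: a) (simp_all add: div_diff_lt)

definition newton_basis :: "nat \<Rightarrow> nat \<Rightarrow> 'a poly" where "newton_basis s a = (\<Prod>r<s. theta_q a - theta_q r)"

lemma newton_basis_gt: "a < s \<Longrightarrow> newton_basis s a = 0"
  unfolding newton_basis_def by (rule prod_zero) auto

lemma newton_partial: "theta_q a ^ i = (\<Sum>s<m. newton_basis s a * div_diff s s i) + newton_basis m a * div_diff m a i"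
proof (induction m)
  case (Suc m)
  have "newton_basis m a * div_diff m a i = newton_basis m a * (div_diff m m i + (theta_q a - theta_q m) * div_diff (Suc m) a i)"
    unfolding div_diff_diff[symmetric] by simp
  also have "\<dots> = newton_basis m a * div_diff m m i + newton_basis (Suc m) a * div_diff (Suc m) a i"
    by (simp add: newton_basis_def algebra_simps)
  finally show ?case using Suc by simp
qed (simp add: newton_basis_def)

lemma newton:
  assumes "a < k"
  shows "theta_q a ^ i = (\<Sum>s<k. newton_basis s a * div_diff s s i)"
  using newton_partial[of a i k] newton_basis_gt[OF assms] by simp

text \<open>The divided difference of the polynomial c(t) at the nodes \<theta>^(q^0), ...,
  \<theta>^(q^s).\<close>

definition \<psi>D :: "nat \<Rightarrow> 'a poly \<Rightarrow> 'a ratfun" where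
  "\<psi>D s c = (\<Sum>i\<le>degree c. to_fract (div_diff s s i) * yc i c)"

definition G :: "nat \<Rightarrow> nat \<Rightarrow> 'a ratfun fps" where "G s n = u_series (\<psi>D s) (q ^ n)"

lemma to_fract_power_newton:
  assumes "a < k"
  shows "to_fract (c ^ (q ^ a)) = (\<Sum>s<k. to_fract (newton_basis s a) * \<psi>D s c)"
proof -
  have "c \<in> lows (Suc (degree c))" by (simp add: lows_def coeff_eq_0)
  from poly_power_expand[OF this, of a]
  have "to_fract (c ^ (q ^ a)) = (\<Sum>i\<le>degree c. yc i c * to_fract (theta_q a ^ i))"
    unfolding theta_q_def to_fract_hom.hom_power lessThan_Suc_atMost .
  also have "\<dots> = (\<Sum>i\<le>degree c. \<Sum>s<k. to_fract (newton_basis s a) * (to_fract (div_diff s s i) * yc i c))"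
    unfolding newton[OF assms] to_fract_hom.hom_sum sum_distrib_left
    by (simp add: to_fract_hom.hom_mult mult_ac)
  also have "\<dots> = (\<Sum>s<k. to_fract (newton_basis s a) * \<psi>D s c)"
    unfolding \<psi>D_def sum_distrib_left by (rule sum.swap)
  finally show ?thesis .
qed

lemma Ehat_G:
  assumes "a < k"
  shows "Ehat a n = (\<Sum>s<k. kc (newton_basis s a) * G s n)"
  unfolding Ehat_def G_def kc_def by (rule u_series_linear) (simp_all add: to_fract_power_newton[OF assms])

definition Gmat :: "nat \<Rightarrow> nat \<Rightarrow> 'a ratfun fps mat" where
  "Gmat j k = mat k k (\<lambda>(s, b). G s (j + b))"

definition Emat :: "nat \<Rightarrow> nat \<Rightarrow> 'a ratfun fps mat" where
  "Emat j k = mat k k (\<lambda>(a, b). Ehat a (j + b))"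

lemma B_poly_newton_basis: "(B_poly k :: 'a poly) = (\<Prod>a<k. newton_basis a a)"
proof -
  have "{(i, j). i < j \<and> j < k} = prod.swap ` (SIGMA j:{..<k}. {..<j})"
    by (auto simp: image_iff)
  hence "(B_poly k :: 'a poly) = (\<Prod>(j, i)\<in>(SIGMA j:{..<k}. {..<j}). theta_q j - theta_q i)"
    unfolding B_poly_def card_q theta_q_def by (simp add: prod.reindex case_prod_unfold)
  also have "\<dots> = (\<Prod>j<k. \<Prod>i<j. theta_q j - theta_q i)" by (rule prod.Sigma[symmetric]) auto
  finally show ?thesis by (simp add: newton_basis_def)
qed

lemma B_poly_nz: "(B_poly k :: 'a poly) \<noteq> 0"
  unfolding B_poly_newton_basis newton_basis_def theta_q_def using theta_power_neq by (auto simp: prod_zero_iff)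

text \<open>By \<open>Ehat_G\<close> the matrix is the product of \<open>Gmat j k\<close> with a
  triangular matrix of values of the Newton basis, whose diagonal multiplies to
  \<open>B_poly k\<close>.\<close>

lemma det_Emat: "det (Emat j k) = kc (B_poly k) * det (Gmat j k)"
proof -
  define N where "N = mat k k (\<lambda>(a, s). kc (newton_basis s a))"
  have c: "N \<in> carrier_mat k k" "Gmat j k \<in> carrier_mat k k" by (simp_all add: N_def Gmat_def)
  have "Emat j k = N * Gmat j k"
  proof (rule eq_matI)
    fix a b assume "a < dim_row (N * Gmat j k)" "b < dim_col (N * Gmat j k)"
    hence ab: "a < k" "b < k" by (simp_all add: N_def Gmat_def)
    show "Emat j k $$ (a, b) = (N * Gmat j k) $$ (a, b)"
      using ab by (simp add: Emat_def N_def Gmat_def scalar_prod_def Ehat_G[of a k] atLeast0LessThan)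
  qed (simp_all add: Emat_def N_def Gmat_def)
  hence "det (Emat j k) = det N * det (Gmat j k)" using det_mult[OF c] by simp
  also have "det N = prod_list (diag_mat N)"
    by (rule det_lower_triangular[OF _ c(1)]) (simp add: N_def newton_basis_gt)
  also have "\<dots> = (\<Prod>a = 0..<k. N $$ (a, a))" by (simp add: prod_list_diag_prod N_def)
  also have "\<dots> = kc (B_poly k)" unfolding B_poly_newton_basis kc.hom_prod by (simp add: N_def atLeast0LessThan)
  finally show ?thesis .
qed

lemma det_Emat_emb:
  "det (mat k k (\<lambda>(a, b). frob (int a) (E1 (int j - int a + int b)))) = emb (det (Emat j k))"
proof -
  have "mat k k (\<lambda>(a, b). frob (int a) (E1 (int j - int a + int b))) = map_mat emb (Emat j k)"
  proof (rule eq_matI)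
    fix a b assume "a < dim_row (map_mat emb (Emat j k))" "b < dim_col (map_mat emb (Emat j k))"
    hence ab: "a < k" "b < k" by (simp_all add: Emat_def)
    have "frob (int a) (E1 (int j - int a + int b)) = emb (Ehat a (j + b))"
      unfolding frob_pos by (subst E1_eq) (simp_all flip: of_nat_add)
    thus "mat k k (\<lambda>(a, b). frob (int a) (E1 (int j - int a + int b))) $$ (a, b) =
        map_mat emb (Emat j k) $$ (a, b)"
      using ab by (simp add: Emat_def)
  qed (simp_all add: Emat_def)
  thus ?thesis by (simp only: emb.hom_det)
qed

lemma E_form_eq: "E_form (int j) k = emb (det (Gmat j k))"
proof -
  have "emb (kc (B_poly k)) \<noteq> 0" using B_poly_nz by simp
  thus ?thesis unfolding E_form_def det_Emat_emb det_Emat const_A_kc by simp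
qed

section \<open>Integrality, order and leading coefficient of the determinants\<close>

lemma integral_sum: "(\<And>x. x \<in> A \<Longrightarrow> f x \<in> integral_series) \<Longrightarrow> (sum f A :: 'a ratfun fps) \<in> integral_series"
proof -
  assume *: "\<And>x. x \<in> A \<Longrightarrow> f x \<in> integral_series"
  have "fps_nth (sum f A) n \<in> range to_fract" for n
  proof -
    have "\<forall>x\<in>A. \<exists>a. fps_nth (f x) n = to_fract a" using * by (auto simp: integral_series_def)
    then obtain a where "\<forall>x\<in>A. fps_nth (f x) n = to_fract (a x)" by metis
    hence "fps_nth (sum f A) n = to_fract (sum a A)" by (simp add: fps_sum_nth to_fract_hom.hom_sum)
    thus ?thesis by blast
  qed
  thus ?thesis by (simp add: integral_series_def)
qed

lemma integral_mult:
  assumes "f \<in> integral_series" "g \<in> integral_series"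
  shows "(f * g :: 'a ratfun fps) \<in> integral_series"
proof -
  have "\<forall>n. \<exists>a. fps_nth f n = to_fract a" "\<forall>n. \<exists>a. fps_nth g n = to_fract a"
    using assms by (auto simp: integral_series_def)
  then obtain a b where ab: "\<And>n. fps_nth f n = to_fract (a n)" "\<And>n. fps_nth g n = to_fract (b n)" by metis
  have *: "fps_nth (f * g) n = to_fract (\<Sum>i=0..n. a i * b (n - i))" for n
    by (simp add: fps_mult_nth ab to_fract_hom.hom_sum)
  show ?thesis unfolding integral_series_def mem_Collect_eq * by blast
qed

lemma integral_const [simp]: "fps_const (to_fract a) \<in> integral_series"
  unfolding integral_series_def mem_Collect_eq
proof
  fix n
  have "fps_nth (fps_const (to_fract a)) n = to_fract (if n = 0 then a else 0)" by simp
  thus "fps_nth (fps_const (to_fract a)) n \<in> range to_fract" by blast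
qed

lemma integral_1 [simp]: "1 \<in> integral_series"
  using integral_const[of 1] by simp

lemma integral_prod: "(\<And>x. x \<in> A \<Longrightarrow> f x \<in> integral_series) \<Longrightarrow> (prod f A :: 'a ratfun fps) \<in> integral_series"
  by (induction A rule: infinite_finite_induct) (auto intro: integral_mult)

lemma integral_power: "f \<in> integral_series \<Longrightarrow> (f ^ n :: 'a ratfun fps) \<in> integral_series"
  by (induction n) (auto intro: integral_mult)

lemma integral_X: "fps_X \<in> (integral_series :: 'a ratfun fps set)"
  unfolding integral_series_def mem_Collect_eq
proof
  fix n
  have "fps_nth (fps_X :: 'a ratfun fps) n = to_fract (if n = 1 then 1 else 0)" by simp
  thus "fps_nth (fps_X :: 'a ratfun fps) n \<in> range to_fract" by blast
qed

lemma integral_inverse: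
  assumes f: "(f :: 'a ratfun fps) \<in> integral_series" and "fps_nth f 0 = 1"
  shows "inverse f \<in> integral_series"
proof -
  have fi: "f * inverse f = 1" using assms(2) by (intro inverse_mult_eq_1') simp
  have "fps_nth (inverse f) n \<in> range to_fract" for n
  proof (induction n rule: less_induct)
    case (less n)
    show ?case
    proof (cases "n = 0")
      case True
      have "fps_nth (inverse f) 0 = to_fract 1" using assms(2) by simp
      thus ?thesis using True by blast
    next
      case False
      obtain a where a: "\<And>i. fps_nth f i = to_fract (a i)"
        using f unfolding integral_series_def image_iff mem_Collect_eq by metis
      have "\<forall>i\<in>{1..n}. \<exists>b. fps_nth (inverse f) (n - i) = to_fract b"
        using less.IH by (auto simp: image_iff Suc_le_eq intro!: less.IH)
      then obtain b where b: "\<forall>i\<in>{1..n}. fps_nth (inverse f) (n - i) = to_fract (b i)" by metis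
      have "0 = fps_nth (f * inverse f) n" using False by (simp add: fi)
      also have "\<dots> = fps_nth f 0 * fps_nth (inverse f) n + (\<Sum>i=1..n. fps_nth f i * fps_nth (inverse f) (n - i))"
        unfolding fps_mult_nth by (subst sum.atLeast_Suc_atMost) simp_all
      also have "(\<Sum>i=1..n. fps_nth f i * fps_nth (inverse f) (n - i)) = to_fract (\<Sum>i=1..n. a i * b i)"
        using b by (simp add: a to_fract_hom.hom_sum)
      finally have "fps_nth (inverse f) n = to_fract (- (\<Sum>i=1..n. a i * b i))"
        using assms(2) by (simp add: eq_neg_iff_add_eq_0)
      thus ?thesis by blast
    qed
  qed
  thus ?thesis by (simp add: integral_series_def)
qed

lemma integral_u_mult:
  assumes "c \<in> monics_below d"
  shows "u_mult (c :: 'a poly) \<in> integral_series"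
proof -
  have "carlitz_recip c \<in> integral_series"
    by (auto simp: integral_series_def carlitz_recip_def coeff_map_poly)
  thus ?thesis unfolding u_mult_def using monic_recip(2)[OF assms]
    by (intro integral_mult integral_power integral_X integral_inverse)
qed

lemma integral_u_series:
  assumes "n \<ge> 1" "\<And>c. \<psi> c \<in> range to_fract"
  shows "u_series \<psi> n \<in> integral_series"
proof -
  have "u_partial \<psi> n d \<in> integral_series" for d
    unfolding u_partial_def
  proof (rule integral_sum)
    fix c :: "'a poly" assume c: "c \<in> monics_below d"
    obtain a where "\<psi> c = to_fract a" using assms(2)[of c] by blast
    thus "fps_const (\<psi> c) * u_mult c ^ n \<in> integral_series"
      by (intro integral_mult integral_power integral_u_mult[OF c]) simp
  qed
  thus ?thesis using u_series_nth[OF assms(1) lt_q_power] by (auto simp: integral_series_def)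
qed

lemma integral_G: "G s n \<in> integral_series"
  unfolding G_def
proof (rule integral_u_series)
  fix c
  have "\<psi>D s c = to_fract (\<Sum>i\<le>degree c. div_diff s s i * [:coeff c i:])"
    unfolding \<psi>D_def yc_def to_fract_hom.hom_sum to_fract_hom.hom_mult ..
  thus "\<psi>D s c \<in> range to_fract" by blast
qed simp

lemma integral_det_Gmat: "det (Gmat j k) \<in> integral_series"
proof -
  have "Gmat j k \<in> carrier_mat k k" by (simp add: Gmat_def)
  moreover have "(of_int (sign p) :: 'a ratfun fps) \<in> integral_series" for p :: "nat \<Rightarrow> nat"
  proof -
    show ?thesis using integral_const[of "of_int (sign p)"] by (simp add: fps_of_int)
  qed
  ultimately show ?thesis
    by (subst det_def') (auto intro!: integral_sum integral_mult integral_prod integral_G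
       simp: Gmat_def permutes_in_image)
qed

lemma \<rho>_mono: "i < i' \<Longrightarrow> \<rho> i < \<rho> i'"
proof -
  assume "i < i'"
  hence "q ^ (2 * i + 1) < q ^ (2 * i' + 1)" using q2 by (intro power_strict_increasing) auto
  hence "(q + 1) * \<rho> i < (q + 1) * \<rho> i'" unfolding \<rho>_eq by simp
  thus ?thesis by (simp only: mult_less_cancel1)
qed

lemma neg_one_q_power: "((-1 :: 'a ratfun) ^ s) ^ (q ^ n) = (-1) ^ s"
proof (induction n)
  case (Suc n)
  have "((-1 :: 'a ratfun) ^ s) ^ (q ^ Suc n) = (((-1) ^ s) ^ (q ^ n)) ^ q" by (simp only: power_Suc2 power_mult)
  also have "\<dots> = ((-1) ^ q) ^ s" unfolding Suc by (simp only: power_mult[symmetric] mult.commute)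
  finally show ?case by (simp only: neg_one_q)
qed simp

text \<open>Divided differences of t^i of order s are 0 for i < s and 1 for i = s, so only the
  Frobenius powers of the \<open>Y i\<close> with i \<ge> s occur. Their orders increase with i, and
  the first one decides.\<close>

lemma G_order: "subdegree (G s n) = q ^ n * \<rho> s \<and> fps_lead (G s n) = (-1) ^ s"
proof -
  define M where "M = q ^ n * \<rho> s"
  \<comment> \<open>So large that the cut-off at degree d has the correct coefficients up to
    \<open>M\<close>, and that the index s occurs in the sum.\<close>
  define d where "d = M + s + 1"
  have Yp: "subdegree (Y i ^ (q ^ n)) = q ^ n * \<rho> i" for i
    using Y_order[of i] by (simp only: subdegree_power)
  have eq: "fps_nth (G s n) m = fps_nth (Y s ^ (q ^ n)) m" if m: "m \<le> M" for m
  proof -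
    have md: "m < q ^ d" using lt_q_power[of d] m unfolding d_def by linarith
    have "u_partial (\<psi>D s) (q ^ n) d = (\<Sum>i<d. fps_const (to_fract (div_diff s s i)) * u_partial (yc i) (q ^ n) d)"
    proof (rule u_partial_linear)
      fix c :: "'a poly" assume c: "c \<in> monics_below d"
      hence "degree c < d" by (simp add: monics_below_def)
      thus "\<psi>D s c = (\<Sum>i<d. to_fract (div_diff s s i) * yc i c)"
        unfolding \<psi>D_def by (intro sum.mono_neutral_left) (auto simp: yc_def coeff_eq_0)
    qed
    hence "fps_nth (G s n) m = (\<Sum>i<d. to_fract (div_diff s s i) * fps_nth (u_partial (yc i) (q ^ n) d) m)"
      unfolding G_def u_series_nth[OF q_power_ge_1 md] by (simp add: fps_sum_nth)
    also have "\<dots> = (\<Sum>i<d. to_fract (div_diff s s i) * fps_nth (Y i ^ (q ^ n)) m)"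
      unfolding Y_power u_series_nth[OF q_power_ge_1 md] ..
    also have "\<dots> = (\<Sum>i<d. if i = s then fps_nth (Y s ^ (q ^ n)) m else 0)"
    proof (intro sum.cong refl)
      fix i
      consider "i < s" | "i = s" | "i > s" by linarith
      thus "to_fract (div_diff s s i) * fps_nth (Y i ^ (q ^ n)) m = (if i = s then fps_nth (Y s ^ (q ^ n)) m else 0)"
      proof cases
        case 3
        have "M < q ^ n * \<rho> i" unfolding M_def using \<rho>_mono[OF 3] by simp
        hence "fps_nth (Y i ^ (q ^ n)) m = 0" using m Yp[of i] by (intro nth_less_subdegree_zero) linarith
        thus ?thesis using 3 by simp
      qed (simp_all add: div_diff_lt div_diff_diag)
    qed
    also have "\<dots> = fps_nth (Y s ^ (q ^ n)) m"
      unfolding sum.delta[OF finite_lessThan] d_def by simp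
    finally show ?thesis .
  qed
  have l: "fps_lead (Y s ^ (q ^ n)) = (-1) ^ s"
    using Y_order[of s] by (simp only: fps_lead_power neg_one_q_power)
  have 1: "fps_nth (G s n) M = (-1) ^ s"
  proof -
    have "fps_nth (G s n) M = fps_nth (Y s ^ (q ^ n)) M" by (rule eq) (rule order.refl)
    also have "\<dots> = fps_lead (Y s ^ (q ^ n))" by (simp only: fps_lead_def Yp M_def)
    finally show ?thesis by (simp only: l)
  qed
  have 2: "fps_nth (G s n) m = 0" if "m < M" for m
  proof -
    have "m < subdegree (Y s ^ (q ^ n))" using that by (simp only: Yp M_def)
    hence "fps_nth (Y s ^ (q ^ n)) m = 0" by (rule nth_less_subdegree_zero)
    thus ?thesis using eq[of m] that by simp
  qed
  from subdegree_fps_leadI[OF 1 _ 2] show ?thesis unfolding M_def by simp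
qed

text \<open>The order of a term is least when larger values of \<open>\<rho>\<close> meet smaller
  powers of q. By the rearrangement inequality, applied with the powers of q negated, this happens
  for the reversal alone.\<close>

lemma det_Gmat_order:
  "subdegree (det (Gmat j k)) = (\<Sum>s<k. q ^ (j + (k - 1 - s)) * \<rho> s) \<and> fps_lead (det (Gmat j k)) = 1"
proof -
  define M where "M = (\<Sum>s<k. q ^ (j + (k - 1 - s)) * \<rho> s)"
  define T where "T p = (of_int (sign p) :: 'a ratfun fps) * (\<Prod>s<k. G s (j + p s))" for p :: "nat \<Rightarrow> nat"
  have Gnz: "G s n \<noteq> 0" for s n using G_order[of s n] by (auto simp: fps_lead_def)
  have det: "det (Gmat j k) = (\<Sum>p\<in>{p. p permutes {..<k}}. T p)"
    unfolding Gmat_def det_expand T_def by (rule refl)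
  have sd: "subdegree (\<Prod>s<k. G s (j + p s)) = (\<Sum>s<k. q ^ (j + p s) * \<rho> s)" for p
    using G_order Gnz by (subst subdegree_prod_fps) auto
  have big: "M < (\<Sum>s<k. q ^ (j + p s) * \<rho> s)" if p: "p permutes {..<k}" "p \<noteq> rev_perm k" for p
  proof -
    define p' where "p' = rev_perm k \<circ> p"
    have p': "p' permutes {..<k}" unfolding p'_def by (rule permutes_compose[OF p(1) rev_perm_permutes])
    have "p' \<noteq> id"
    proof
      assume "p' = id"
      hence "rev_perm k (p s) = s" for s by (simp add: p'_def fun_eq_iff)
      hence "p s = rev_perm k s" for s using rev_perm_involution[of k "p s"] by simp
      thus False using p(2) by blast
    qed
    have "(\<Sum>s<k. int (\<rho> s) * - int (q ^ (j + (k - 1 - p' s)))) < (\<Sum>s<k. int (\<rho> s) * - int (q ^ (j + (k - 1 - s))))"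
    proof (rule rearrangement(2)[OF _ _ p' \<open>p' \<noteq> id\<close>])
      fix i i' assume i: "i < i'" "i' < k"
      show "int (\<rho> i) < int (\<rho> i')" using \<rho>_mono[OF i(1)] by simp
      have "q ^ (j + (k - 1 - i')) < q ^ (j + (k - 1 - i))" using q2 i by (intro power_strict_increasing) auto
      thus "- int (q ^ (j + (k - 1 - i))) < - int (q ^ (j + (k - 1 - i')))" by simp
    qed
    moreover have "k - 1 - p' s = p s" if "s < k" for s
      using that permutes_in_image[OF p(1), of s] by (simp add: p'_def rev_perm_def)
    ultimately have "(\<Sum>s<k. int (\<rho> s) * - int (q ^ (j + p s))) < (\<Sum>s<k. int (\<rho> s) * - int (q ^ (j + (k - 1 - s))))"
      by simp
    hence "int M < int (\<Sum>s<k. q ^ (j + p s) * \<rho> s)"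
      by (simp add: M_def sum_negf mult.commute)
    thus ?thesis by (simp only: of_nat_less_iff)
  qed
  have Tbig: "fps_nth (T p) m = 0" if "p permutes {..<k}" "p \<noteq> rev_perm k" "m \<le> M" for p m
  proof -
    have "fps_nth (\<Prod>s<k. G s (j + p s)) m' = 0" if "m' \<le> m" for m'
      using big[OF \<open>p permutes {..<k}\<close> \<open>p \<noteq> rev_perm k\<close>] sd[of p] that \<open>m \<le> M\<close>
      by (intro nth_less_subdegree_zero) linarith
    thus ?thesis unfolding T_def by (cases p rule: sign_cases) simp_all
  qed
  have dm: "fps_nth (det (Gmat j k)) m = fps_nth (T (rev_perm k)) m" if "m \<le> M" for m
  proof -
    have "fps_nth (det (Gmat j k)) m = (\<Sum>p\<in>{p. p permutes {..<k}}. if p = rev_perm k then fps_nth (T (rev_perm k)) m else 0)"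
      unfolding det fps_sum_nth by (intro sum.cong refl) (use Tbig that in auto)
    thus ?thesis unfolding sum.delta[OF finite_permutations[OF finite_lessThan]]
      using rev_perm_permutes[of k] by simp
  qed
  have sr: "(\<Sum>s<k. q ^ (j + rev_perm k s) * \<rho> s) = M"
    unfolding M_def by (intro sum.cong) (auto simp: rev_perm_def)
  define Pr where "Pr = (\<Prod>s<k. G s (j + rev_perm k s))"
  have Pr: "subdegree Pr = M" "fps_lead Pr = (\<Prod>s<k. (-1) ^ s)"
    unfolding Pr_def using sd[of "rev_perm k"] sr G_order by (simp_all add: fps_lead_prod)
  have TP: "fps_nth (T (rev_perm k)) m = of_int (sign (rev_perm k)) * fps_nth Pr m" for m
    unfolding T_def Pr_def[symmetric] by (cases "rev_perm k" rule: sign_cases) simp_all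
  have "fps_nth Pr M = of_int (\<Prod>s<k. (-1) ^ s)"
    using Pr(2) unfolding fps_lead_def Pr(1) by simp
  hence "of_int (sign (rev_perm k)) * fps_nth Pr M = (of_int (sign (rev_perm k) * (\<Prod>s<k. (-1) ^ s)) :: 'a ratfun)"
    by (simp only: of_int_mult)
  hence "of_int (sign (rev_perm k)) * fps_nth Pr M = (1 :: 'a ratfun)"
    by (simp only: rev_perm_sign of_int_1)
  hence 1: "fps_nth (det (Gmat j k)) M = 1" by (simp only: dm[OF order.refl] TP)
  have 2: "fps_nth (det (Gmat j k)) m = 0" if "m < M" for m
  proof -
    have "fps_nth Pr m = 0" by (rule nth_less_subdegree_zero) (simp only: Pr(1) that)
    thus ?thesis by (simp only: dm[OF less_imp_le[OF that]] TP mult_zero_right)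
  qed
  from subdegree_fps_leadI[OF 1 _ 2] show ?thesis unfolding M_def by simp
qed

lemma order_sum: "(q\<^sup>2 - 1) * (\<Sum>s<k. q ^ (j + (k - 1 - s)) * \<rho> s) = q ^ j * (q ^ (2 * k) - 1)"
proof -
  have "(q + 1) * (\<Sum>s<k. q ^ (j + (k - 1 - s)) * \<rho> s) = (\<Sum>s<k. q ^ (j + (k - 1 - s)) * (q ^ (2 * s + 1) + 1))"
    unfolding sum_distrib_left \<rho>_eq[symmetric] by (simp only: mult.left_commute)
  also have "\<dots> = (\<Sum>s<k. q ^ j * q ^ (k + s) + q ^ j * q ^ (k - 1 - s))"
  proof (intro sum.cong refl)
    fix s assume "s \<in> {..<k}"
    hence "j + (k - 1 - s) + (2 * s + 1) = j + (k + s)" by auto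
    hence "q ^ (j + (k - 1 - s)) * q ^ (2 * s + 1) = q ^ j * q ^ (k + s)" by (simp only: power_add[symmetric])
    thus "q ^ (j + (k - 1 - s)) * (q ^ (2 * s + 1) + 1) = q ^ j * q ^ (k + s) + q ^ j * q ^ (k - 1 - s)"
      by (simp only: distrib_left power_add[of q j "k - 1 - s"] mult_1_right)
  qed
  also have "\<dots> = q ^ j * ((\<Sum>s<k. q ^ (k + s)) + (\<Sum>s<k. q ^ (k - 1 - s)))"
    by (simp only: sum.distrib sum_distrib_left distrib_left)
  also have "(\<Sum>s<k. q ^ (k - 1 - s)) = (\<Sum>s<k. q ^ s)"
    by (rule sum.reindex_bij_witness[of _ "\<lambda>s. k - 1 - s" "\<lambda>s. k - 1 - s"]) auto
  also have "(\<Sum>s<k. q ^ (k + s)) = q ^ k * (\<Sum>s<k. q ^ s)" by (simp only: power_add sum_distrib_left)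
  finally have *: "(q + 1) * (\<Sum>s<k. q ^ (j + (k - 1 - s)) * \<rho> s) = q ^ j * ((q ^ k + 1) * (\<Sum>s<k. q ^ s))"
    by (simp add: algebra_simps)
  have "q\<^sup>2 - 1 = (q - 1) * (q + 1)" by (simp add: power2_eq_square diff_mult_distrib)
  hence "(q\<^sup>2 - 1) * (\<Sum>s<k. q ^ (j + (k - 1 - s)) * \<rho> s) = (q - 1) * (q ^ j * ((q ^ k + 1) * (\<Sum>s<k. q ^ s)))"
    by (simp only: mult.assoc *)
  also have "\<dots> = q ^ j * ((q ^ k + 1) * ((q - 1) * (\<Sum>s<k. q ^ s)))" by (simp only: mult_ac)
  also have "(q - 1) * (\<Sum>s<k. q ^ s) = q ^ k - 1" by (rule cf.sum_q_powers)
  also have "(q ^ k + 1) * (q ^ k - 1) = q ^ (2 * k) - 1"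
    by (simp add: algebra_simps diff_mult_distrib2 mult_2_right power_add)
  finally show ?thesis .
qed

lemma det_Gmat_subdegree: "subdegree (det (Gmat j k)) = q ^ j * (q ^ (2 * k) - 1) div (q\<^sup>2 - 1)"
proof -
  have "q\<^sup>2 > 1" using q2 le_q_mult[of q] unfolding power2_eq_square by linarith
  hence "q ^ j * (q ^ (2 * k) - 1) div (q\<^sup>2 - 1) = (\<Sum>s<k. q ^ (j + (k - 1 - s)) * \<rho> s)"
    unfolding order_sum[symmetric] by (intro nonzero_mult_div_cancel_left) linarith
  thus ?thesis using det_Gmat_order[of j k] by (simp only:)
qed

lemma det_Gmat_normalised: "normalised (det (Gmat j k))"
  using det_Gmat_order[of j k] by (auto simp: normalised_def fps_lead_def)

subsection \<open>Dehomogenisation\<close>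

lemma gg_0: "fps_nth gg 0 = 1"
proof -
  have "fps_nth (u_series (\<lambda>_. 1) (q - 1)) 0 = fps_nth (u_partial (\<lambda>_. 1) (q - 1) 0) 0"
    by (rule u_series_nth[OF q_minus_1]) simp
  thus ?thesis by (simp add: gg_eq u_partial_def monics_below_0 const_A_def)
qed

lemma const_X_nth: "fps_nth (fps_const (c :: 'a ratfun) * fps_X ^ k) n = (if n = k then c else 0)"
  by (auto simp: fps_X_power_mult_right_nth)

text \<open>Additivity of the Frobenius map holds for finite sums only, hence the cut-off; the
  remainder starts beyond exponent n even after taking the q-th power.\<close>

lemma fps_q_power_nth:
  "fps_nth ((f :: 'a ratfun fps) ^ q) n = (if q dvd n then fps_nth f (n div q) ^ q else 0)"
proof -
  have cut: "fps_cutoff (Suc n) f = (\<Sum>i<Suc n. fps_const (fps_nth f i) * fps_X ^ i)"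
    by (rule fps_ext) (simp only: fps_sum_nth const_X_nth fps_cutoff_nth sum.delta[OF finite_lessThan] sum.delta'[OF finite_lessThan] lessThan_iff)
  have "f = fps_shift (Suc n) f * fps_X ^ Suc n + fps_cutoff (Suc n) f"
    by (rule fps_shift_cutoff[symmetric])
  hence "f ^ (q ^ 1) = (fps_shift (Suc n) f * fps_X ^ Suc n + (\<Sum>i<Suc n. fps_const (fps_nth f i) * fps_X ^ i)) ^ (q ^ 1)"
    unfolding cut by (rule arg_cong)
  also have "\<dots> = fps_shift (Suc n) f ^ q * fps_X ^ (Suc n * q) + (\<Sum>i<Suc n. fps_const (fps_nth f i ^ q) * fps_X ^ (i * q))"
    unfolding frob_fps frob_fps_sum
    unfolding power_mult_distrib fps_const_power power_mult[symmetric] power_one_right by (rule refl)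
  finally have "f ^ q = fps_shift (Suc n) f ^ q * fps_X ^ (Suc n * q) + (\<Sum>i<Suc n. fps_const (fps_nth f i ^ q) * fps_X ^ (i * q))"
    by (simp only: power_one_right)
  moreover have n: "n < Suc n * q" using le_q_mult[of "Suc n"] by (simp only: mult.commute[of _ q])
  ultimately have "fps_nth (f ^ q) n = (\<Sum>i<Suc n. if n = i * q then fps_nth f i ^ q else 0)"
    by (simp only: fps_add_nth fps_sum_nth const_X_nth fps_X_power_mult_right_nth[of "fps_shift (Suc n) f ^ q"] if_True add_0_left)
  also have "\<dots> = (if q dvd n then fps_nth f (n div q) ^ q else 0)"
  proof (cases "q dvd n")
    case True
    have "(n = i * q) = (i = n div q)" for i using True by auto
    hence "(\<Sum>i<Suc n. if n = i * q then fps_nth f i ^ q else 0) = (\<Sum>i<Suc n. if i = n div q then fps_nth f i ^ q else 0)"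
      by (simp only:)
    also have "\<dots> = fps_nth f (n div q) ^ q"
      unfolding sum.delta[OF finite_lessThan] using div_le_dividend[of n q] by (simp add: less_Suc_eq_le)
    finally show ?thesis using True by (simp only: if_True)
  next
    case False
    hence "n \<noteq> i * q" for i by auto
    thus ?thesis using False by (simp only: if_False sum.neutral_const)
  qed
  finally show ?thesis .
qed

text \<open>
  The coefficients of the \<open>(q-1)\<close>-st root of \<open>g\<close> with constant term \<open>1\<close>: in \<open>g_root^q = g g_root\<close> the left side
  involves only the \<open>q\<close>-th powers of lower coefficients, so the equation can be solved recursively.
\<close>

function g_root_coeff :: "nat \<Rightarrow> 'a ratfun" where
  "g_root_coeff n = (if n = 0 then 1 else
     (if q dvd n then g_root_coeff (n div q) ^ q else 0) - (\<Sum>i\<in>{1..n}. fps_nth gg i * g_root_coeff (n - i)))"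
  by auto
termination
  by (relation "measure id") (auto intro: div_less_dividend)

declare g_root_coeff.simps [simp del]

definition g_root :: "'a ratfun fps" where "g_root = Abs_fps g_root_coeff"

lemma g_root_0: "fps_nth g_root 0 = 1" by (simp add: g_root_def g_root_coeff.simps[of 0])

lemma g_root_q: "g_root ^ q = gg * g_root"
proof (rule fps_ext)
  fix n
  show "fps_nth (g_root ^ q) n = fps_nth (gg * g_root) n"
  proof (cases "n = 0")
    case True
    thus ?thesis by (simp add: fps_q_power_nth g_root_0 gg_0)
  next
    case False
    have "fps_nth (gg * g_root) n = fps_nth gg 0 * fps_nth g_root n + (\<Sum>i\<in>{1..n}. fps_nth gg i * fps_nth g_root (n - i))"
      unfolding fps_mult_nth by (subst sum.atLeast_Suc_atMost) simp_all
    also have "fps_nth g_root n = (if q dvd n then g_root_coeff (n div q) ^ q else 0) - (\<Sum>i\<in>{1..n}. fps_nth gg i * g_root_coeff (n - i))"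
      using False by (simp add: g_root_def g_root_coeff.simps[of n])
    finally show ?thesis by (simp add: fps_q_power_nth gg_0 g_root_def)
  qed
qed

lemma g_root_nz: "g_root \<noteq> 0" using g_root_0 by auto

lemma g_root_gg: "g_root ^ (q - 1) = gg"
proof -
  have "g_root ^ (q - 1) * g_root = gg * g_root" unfolding g_root_q[symmetric] by (rule power_minus_mult) simp
  thus ?thesis using g_root_nz by simp
qed

lemma g_root_inverse: "g_root * inverse g_root = 1" using g_root_0 by (intro inverse_mult_eq_1') simp

lemma g_root_inverse_power: "g_root ^ n * inverse g_root ^ n = 1"
  by (simp add: g_root_inverse flip: power_mult_distrib)

lemma g_root_subdegree [simp]: "subdegree (g_root ^ n) = 0"
  using g_root_0 by (simp add: subdegree_eq_0_iff fps_nth_power_0)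

definition eta :: "'a ratfun fps" where "eta = hh * inverse g_root ^ (q + 1)"
definition eps :: "'a ratfun fps" where "eps = EE * inverse g_root ^ 2"

lemma hh_eta: "hh = g_root ^ (q + 1) * eta"
proof -
  have "g_root ^ (q + 1) * eta = hh * (g_root ^ (q + 1) * inverse g_root ^ (q + 1))"
    unfolding eta_def by (simp only: mult_ac)
  thus ?thesis by (simp only: g_root_inverse_power mult_1_right)
qed

lemma EE_eps: "EE = g_root ^ 2 * eps"
proof -
  have "g_root ^ 2 * eps = EE * (g_root ^ 2 * inverse g_root ^ 2)"
    unfolding eps_def by (simp only: mult_ac)
  thus ?thesis by (simp only: g_root_inverse_power mult_1_right)
qed

lemma eta_nz: "eta \<noteq> 0" using hh_eta hh_nz by auto

lemma eta_subdegree: "subdegree eta = 1"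
proof -
  have "subdegree hh = subdegree (g_root ^ (q + 1)) + subdegree eta"
    unfolding hh_eta by (rule subdegree_mult) (use g_root_nz eta_nz in auto)
  thus ?thesis unfolding g_root_subdegree hh_subdegree by simp
qed

sublocale fc: comm_ring_hom "fps_const :: 'a ratfun \<Rightarrow> 'a ratfun fps"
  by unfold_locales (simp_all flip: fps_const_add fps_const_mult)
sublocale fcm: map_poly_comm_ring_hom "fps_const :: 'a ratfun \<Rightarrow> 'a ratfun fps" ..

text \<open>\<open>evx r\<close> is r(\<eta>); \<open>ev2 P\<close> below is P(\<eta>, \<epsilon>),
  where P is a polynomial in \<epsilon> with coefficients in K[\<eta>].\<close>

definition evx :: "'a ratfun poly \<Rightarrow> 'a ratfun fps" where
  "evx r = poly (map_poly fps_const r) eta"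

sublocale evx: comm_ring_hom evx
  by unfold_locales (simp_all add: evx_def fcm.hom_add fcm.hom_mult)
sublocale evxm: map_poly_comm_ring_hom evx ..

definition ev2 :: "'a ratfun poly poly \<Rightarrow> 'a ratfun fps" where
  "ev2 P = poly (map_poly evx P) eps"

sublocale ev2: comm_ring_hom ev2
  by unfold_locales (simp_all add: ev2_def evxm.hom_add evxm.hom_mult)

lemma evx_pCons: "evx (pCons a r) = fps_const a + eta * evx r"
  unfolding evx_def fc.map_poly_pCons_hom poly_pCons by (rule refl)

lemma evx_monom: "evx (monom a n) = fps_const a * eta ^ n"
  by (simp add: evx_def map_poly_monom poly_monom)

lemma ev2_pCons: "ev2 (pCons r P) = evx r + eps * ev2 P"
  unfolding ev2_def evx.map_poly_pCons_hom poly_pCons by (rule refl)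

lemma ev2_monom: "ev2 (monom r n) = evx r * eps ^ n"
  by (simp add: ev2_def map_poly_monom poly_monom)

lemma ev2_const: "ev2 [:r:] = evx r"
  by (simp add: ev2_pCons)

lemma evx_const: "evx [:a:] = fps_const a"
  by (simp add: evx_pCons)

lemma eta_0: "fps_nth eta 0 = 0"
  using eta_subdegree by (intro nth_less_subdegree_zero) simp

lemma evx_0: "fps_nth (evx r) 0 = poly r 0"
  by (cases r) (simp add: evx_pCons eta_0)

text \<open>Since \<open>eta\<close> has order 1, the order of r(\<eta>) is the lowest exponent that
  occurs in r. The resulting upper bound for the order is played off against the vanishing of the
  resultant.\<close>

lemma evx_order: "r \<noteq> 0 \<Longrightarrow> evx r \<noteq> 0 \<and> subdegree (evx r) \<le> degree r"
proof (induction r)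
  case (pCons a r)
  show ?case
  proof (cases "a = 0")
    case True
    hence r: "r \<noteq> 0" using pCons by auto
    hence IH: "evx r \<noteq> 0" "subdegree (evx r) \<le> degree r" using pCons.IH by auto
    have "evx (pCons a r) = eta * evx r" by (simp add: evx_pCons True)
    thus ?thesis using IH eta_nz r by (simp add: eta_subdegree)
  next
    case False
    have "fps_nth (evx (pCons a r)) 0 \<noteq> 0" using False by (simp add: evx_0)
    thus ?thesis by (auto simp: subdegree_eq_0)
  qed
qed simp

lemma evx_nz_iff: "evx r = 0 \<longleftrightarrow> r = 0" using evx_order by auto

subsection \<open>Weights\<close>

text \<open>
  The weight of a polynomial in \<open>\<eta>\<close> and \<open>\<epsilon>\<close> is its degree in \<open>t\<close> after the substitution of \<open>\<eta> t^(q+1)\<close>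
  for \<open>\<eta>\<close> and \<open>\<epsilon> t\<^sup>2\<close> for \<open>\<epsilon>\<close>, so that it is additive on products.
\<close>

definition const3 :: "'a ratfun \<Rightarrow> 'a ratfun poly poly poly" where "const3 c = [:[:[:c:]:]:]"

sublocale const3: comm_ring_hom const3
  by unfold_locales (simp_all add: const3_def)
sublocale const3m: map_poly_comm_ring_hom const3 ..

definition \<phi>1 :: "'a ratfun poly \<Rightarrow> 'a ratfun poly poly poly" where
  "\<phi>1 r = poly (map_poly const3 r) (monom [:[:0, 1:]:] (q + 1))"

sublocale \<phi>1: comm_ring_hom \<phi>1
  by unfold_locales (simp_all add: \<phi>1_def const3m.hom_add const3m.hom_mult)
sublocale \<phi>1m: map_poly_comm_ring_hom \<phi>1 ..

definition \<Phi> :: "'a ratfun poly poly \<Rightarrow> 'a ratfun poly poly poly" where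
  "\<Phi> P = poly (map_poly \<phi>1 P) (monom [:0, 1:] 2)"

sublocale \<Phi>: comm_ring_hom \<Phi>
  by unfold_locales (simp_all add: \<Phi>_def \<phi>1m.hom_add \<phi>1m.hom_mult)

lemma pCons01_power: "([:0, 1:] :: 'b::comm_semiring_1 poly) ^ n = monom 1 n"
  by (simp add: monom_altdef)

lemma \<phi>1_monom: "\<phi>1 (monom (c :: 'a ratfun) a) = monom [:monom c a:] ((q + 1) * a)"
proof -
  have "\<phi>1 (monom c a) = const3 c * monom [:[:0, 1:]:] (q + 1) ^ a"
    by (simp add: \<phi>1_def map_poly_monom poly_monom)
  also have "\<dots> = smult [:[:c:]:] (monom ([:[:0, 1:]:] ^ a) ((q + 1) * a))"
    unfolding const3_def monom_power mult_pCons_left mult_zero_left pCons_0_0 add_0_right by (rule refl)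
  also have "[:[:0, 1 :: 'a ratfun:]:] ^ a = [:monom 1 a:]"
    by (simp only: poly_const_pow pCons01_power)
  also have "smult [:[:c:]:] (monom [:monom 1 a:] ((q + 1) * a)) = monom [:monom c a:] ((q + 1) * a)"
    by (simp add: smult_monom)
  finally show ?thesis .
qed

lemma \<Phi>_monom: "\<Phi> (monom (monom (c :: 'a ratfun) a) i) = monom (monom (monom c a) i) ((q + 1) * a + 2 * i)"
proof -
  have "\<Phi> (monom (monom c a) i) = \<phi>1 (monom c a) * monom [:0, 1:] 2 ^ i"
    by (simp add: \<Phi>_def map_poly_monom poly_monom)
  also have "\<dots> = monom [:monom c a:] ((q + 1) * a) * monom (monom 1 i) (2 * i)"
    by (simp only: \<phi>1_monom monom_power pCons01_power)
  also have "\<dots> = monom (monom (monom c a) i) ((q + 1) * a + 2 * i)"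
    by (simp add: mult_monom smult_monom)
  finally show ?thesis .
qed

text \<open>Each monomial keeps its exponents in \<eta> and \<epsilon>, so nothing cancels:
  \<open>\<Phi>\<close> is injective, and the degree in t is a maximum over the monomials that
  occur.\<close>

lemma \<Phi>_coeff:
  "coeff (coeff (coeff (\<Phi> P) n) i) a = (if n = (q + 1) * a + 2 * i then coeff (coeff P i) a else 0)"
proof -
  define N where "N = degree P + i + 1"
  define M where "M = (\<Sum>j<N. degree (coeff P j)) + a + 1"
  have "coeff P j = (\<Sum>b<M. monom (coeff (coeff P j) b) b)" if "j < N" for j
  proof -
    have "degree (coeff P j) \<le> (\<Sum>j<N. degree (coeff P j))"
      by (rule member_le_sum) (use that in auto)
    hence "degree (coeff P j) < M" by (simp add: M_def)
    thus ?thesis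
      by (intro poly_eqI) (auto simp: coeff_sum coeff_eq_0 not_less cong: if_cong)
  qed
  hence "(\<Sum>j<N. monom (\<Sum>b<M. monom (coeff (coeff P j) b) b) j) = (\<Sum>j<N. monom (coeff P j) j)"
    by (intro sum.cong refl arg_cong2[where f = monom]) (simp only: lessThan_iff)
  also have "\<dots> = P"
    by (intro poly_eqI) (auto simp: coeff_sum coeff_eq_0 N_def not_less cong: if_cong)
  finally have "P = (\<Sum>j<N. monom (\<Sum>b<M. monom (coeff (coeff P j) b) b) j)" by (rule sym)
  also have "\<dots> = (\<Sum>j<N. \<Sum>b<M. monom (monom (coeff (coeff P j) b) b) j)"
    by (simp only: monom_sum)
  finally have P: "P = \<dots>" .
  have "\<Phi> P = (\<Sum>j<N. \<Sum>b<M. monom (monom (monom (coeff (coeff P j) b) b) j) ((q + 1) * b + 2 * j))"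
    by (subst P) (simp only: \<Phi>.hom_sum \<Phi>_monom)
  hence "coeff (coeff (coeff (\<Phi> P) n) i) a =
     (\<Sum>j<N. \<Sum>b<M. if j = i then (if b = a then (if n = (q + 1) * a + 2 * i then coeff (coeff P i) a else 0) else 0) else 0)"
    by (simp only: coeff_sum coeff_monom) (intro sum.cong refl, auto)
  also have "\<dots> = (\<Sum>j<N. if j = i then (\<Sum>b<M. if b = a then (if n = (q + 1) * a + 2 * i then coeff (coeff P i) a else 0) else 0) else 0)"
    by (intro sum.cong refl) auto
  also have "\<dots> = (if n = (q + 1) * a + 2 * i then coeff (coeff P i) a else 0)"
    unfolding sum.delta[OF finite_lessThan] by (simp add: N_def M_def)
  finally show ?thesis .
qed

definition weight :: "'a ratfun poly poly \<Rightarrow> nat" where "weight P = degree (\<Phi> P)"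

lemma \<Phi>_eq_0_iff: "\<Phi> P = 0 \<longleftrightarrow> P = 0"
proof
  assume *: "\<Phi> P = 0"
  have "coeff (coeff P i) a = 0" for i a
    using \<Phi>_coeff[of P "(q + 1) * a + 2 * i" i a] by (simp add: *)
  thus "P = 0" by (simp add: poly_eq_iff)
qed simp

lemma weight_mult: "P \<noteq> 0 \<Longrightarrow> Q \<noteq> 0 \<Longrightarrow> weight (P * Q) = weight P + weight Q"
  unfolding weight_def by (simp only: \<Phi>.hom_mult degree_mult_eq \<Phi>_eq_0_iff not_False_eq_True)

lemma weight_mult_le: "weight P \<le> w \<Longrightarrow> weight Q \<le> w' \<Longrightarrow> weight (P * Q) \<le> w + w'"
  unfolding weight_def \<Phi>.hom_mult using degree_mult_le le_trans add_mono by metis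

lemma weight_power_le: "weight P \<le> w \<Longrightarrow> weight (P ^ n) \<le> n * w"
  unfolding weight_def \<Phi>.hom_power using degree_power_le[of "\<Phi> P" n] mult_le_mono2[of "degree (\<Phi> P)" w n]
  by (metis le_trans mult.commute)

lemma weight_sum_le: "(\<And>x. x \<in> A \<Longrightarrow> weight (f x) \<le> w) \<Longrightarrow> weight (sum f A) \<le> w"
  unfolding weight_def \<Phi>.hom_sum by (cases "finite A") (auto intro: degree_sum_le)

lemma weight_prod_le: "finite A \<Longrightarrow> (\<And>x. x \<in> A \<Longrightarrow> weight (f x) \<le> w x) \<Longrightarrow> weight (prod f A) \<le> sum w A"
proof (induction A rule: finite_induct)
  case empty
  thus ?case by (simp add: weight_def)
next
  case (insert x A)
  thus ?case by (simp add: weight_mult_le)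
qed

lemma weight_uminus: "weight (- P) = weight P"
  unfolding weight_def \<Phi>.hom_uminus by simp

lemma weight_le_iff: "weight P \<le> w \<longleftrightarrow> (\<forall>i a. coeff (coeff P i) a \<noteq> 0 \<longrightarrow> (q + 1) * a + 2 * i \<le> w)"
proof
  assume w: "weight P \<le> w"
  show "\<forall>i a. coeff (coeff P i) a \<noteq> 0 \<longrightarrow> (q + 1) * a + 2 * i \<le> w"
  proof (intro allI impI)
    fix i a assume "coeff (coeff P i) a \<noteq> 0"
    hence "coeff (coeff (coeff (\<Phi> P) ((q + 1) * a + 2 * i)) i) a \<noteq> 0" by (simp only: \<Phi>_coeff) simp
    hence "coeff (\<Phi> P) ((q + 1) * a + 2 * i) \<noteq> 0" by (metis coeff_0)
    hence "(q + 1) * a + 2 * i \<le> degree (\<Phi> P)" by (rule le_degree)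
    thus "(q + 1) * a + 2 * i \<le> w" using w by (simp add: weight_def)
  qed
next
  assume *: "\<forall>i a. coeff (coeff P i) a \<noteq> 0 \<longrightarrow> (q + 1) * a + 2 * i \<le> w"
  show "weight P \<le> w" unfolding weight_def
  proof (rule degree_le, intro allI impI)
    fix n assume n: "w < n"
    have "coeff (coeff (coeff (\<Phi> P) n) i) a = 0" for i a
      unfolding \<Phi>_coeff using * n by (metis not_less)
    thus "coeff (\<Phi> P) n = 0" by (simp add: poly_eq_iff)
  qed
qed

lemma weight_coeff: "coeff P i \<noteq> 0 \<Longrightarrow> (q + 1) * degree (coeff P i) + 2 * i \<le> weight P"
  using weight_le_iff[of P "weight P"] by (metis leading_coeff_0_iff order_refl)

lemma weight_leI: "(\<And>i. coeff P i \<noteq> 0 \<Longrightarrow> (q + 1) * degree (coeff P i) + 2 * i \<le> w) \<Longrightarrow> weight P \<le> w"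
  unfolding weight_le_iff
proof (intro allI impI)
  fix i a assume *: "\<And>i. coeff P i \<noteq> 0 \<Longrightarrow> (q + 1) * degree (coeff P i) + 2 * i \<le> w"
    and a: "coeff (coeff P i) a \<noteq> 0"
  have "coeff P i \<noteq> 0" using a by auto
  from *[OF this] have "(q + 1) * degree (coeff P i) + 2 * i \<le> w" .
  moreover have "(q + 1) * a \<le> (q + 1) * degree (coeff P i)" by (intro mult_le_mono2 le_degree a)
  ultimately show "(q + 1) * a + 2 * i \<le> w" by linarith
qed

subsection \<open>Modular and quasi-modular forms\<close>

abbreviation MF :: "int \<Rightarrow> int \<Rightarrow> 'a ratfun fps set" where "MF \<equiv> modular_forms"
abbreviation QM :: "nat \<Rightarrow> int \<Rightarrow> int \<Rightarrow> 'a ratfun fps set" where "QM \<equiv> quasi_modular_forms"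

sublocale vs: vector_space "\<lambda>(c :: 'a ratfun) f. fps_const c * f" by (rule vector_space_fps)

definition gens :: "int \<Rightarrow> int \<Rightarrow> 'a ratfun fps set" where
  "gens w m = {gg ^ a * hh ^ b | a b. int a * (int q - 1) + int b * (int q + 1) = w \<and> [int b = m] (mod (int q - 1))}"

lemma MF_eq: "MF w m = vs.span (gens w m)"
  by (simp add: modular_forms_def gens_def card_q)

lemma MF_subspace: "vs.subspace (MF w m)" unfolding MF_eq by (rule vs.subspace_span)

lemma MF_repr: "f \<in> MF (int n) m \<Longrightarrow> \<exists>r. f = g_root ^ n * evx r \<and> (q + 1) * degree r \<le> n"
  unfolding MF_eq
proof (induction rule: vs.span_induct)
  case base
  show ?case
  proof (rule vs.subspaceI, unfold mem_Collect_eq)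
    show "\<exists>r. 0 = g_root ^ n * evx r \<and> (q + 1) * degree r \<le> n" by (intro exI[of _ 0]) simp
  next
    fix x y :: "'a ratfun fps" assume "\<exists>r. x = g_root ^ n * evx r \<and> (q + 1) * degree r \<le> n" "\<exists>r. y = g_root ^ n * evx r \<and> (q + 1) * degree r \<le> n"
    then obtain r r' where r: "x = g_root ^ n * evx r" "(q + 1) * degree r \<le> n" "y = g_root ^ n * evx r'" "(q + 1) * degree r' \<le> n" by blast
    have "degree (r + r') \<le> degree r \<or> degree (r + r') \<le> degree r'"
      using degree_add_le_max[of r r'] by linarith
    hence "(q + 1) * degree (r + r') \<le> n" using r(2,4) by (meson le_trans mult_le_mono2)
    thus "\<exists>r. x + y = g_root ^ n * evx r \<and> (q + 1) * degree r \<le> n"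
      using r by (intro exI[of _ "r + r'"]) (simp add: evx.hom_add distrib_left)
  next
    fix c and x :: "'a ratfun fps" assume "\<exists>r. x = g_root ^ n * evx r \<and> (q + 1) * degree r \<le> n"
    then obtain r where r: "x = g_root ^ n * evx r" "(q + 1) * degree r \<le> n" by blast
    have "(q + 1) * degree ([:c:] * r) \<le> n"
      using r(2) le_trans[OF mult_le_mono2[OF degree_smult_le[of c r]]] by simp
    thus "\<exists>r. fps_const c * x = g_root ^ n * evx r \<and> (q + 1) * degree r \<le> n"
      using r by (intro exI[of _ "[:c:] * r"]) (simp only: evx.hom_mult evx_const mult.left_commute simp_thms)
  qed
next
  case (step x)
  then obtain a b where x: "x = gg ^ a * hh ^ b" "int a * (int q - 1) + int b * (int q + 1) = int n"
    by (auto simp: gens_def)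
  have q1: "int (q - 1) = int q - 1" using q2 by (simp add: of_nat_diff)
  have "int ((q - 1) * a + (q + 1) * b) = int n"
    unfolding x(2)[symmetric] of_nat_add of_nat_mult q1 of_nat_1 by (simp only: mult.commute)
  hence n: "(q - 1) * a + (q + 1) * b = n" by (simp only: of_nat_eq_iff)
  have "x = (g_root ^ (q - 1)) ^ a * (g_root ^ (q + 1) * eta) ^ b" by (simp only: x(1) g_root_gg hh_eta[symmetric])
  also have "\<dots> = g_root ^ ((q - 1) * a + (q + 1) * b) * evx (monom 1 b)"
    by (simp only: evx_monom power_mult_distrib power_add power_mult fps_const_1_eq_1 mult_1_left mult.assoc)
  finally show ?case using n by (intro exI[of _ "monom 1 b"]) (auto simp: degree_monom_eq)
qed

lemma MF_neg: "w < 0 \<Longrightarrow> f \<in> MF w m \<Longrightarrow> f = 0"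
proof -
  assume w: "w < 0" and f: "f \<in> MF w m"
  have "gens w m = {}"
  proof (rule ccontr)
    assume "gens w m \<noteq> {}"
    then obtain a b where "int a * (int q - 1) + int b * (int q + 1) = w" by (auto simp: gens_def)
    moreover have "int a * (int q - 1) \<ge> 0" "int b * (int q + 1) \<ge> 0" using q2 by (auto intro!: mult_nonneg_nonneg)
    ultimately show False using w by linarith
  qed
  thus "f = 0" using f by (simp add: MF_eq)
qed

text \<open>The modular coefficients of negative weight vanish, so the exponents of
  \<open>g_root\<close> are natural numbers; the depth becomes a bound for the degree in
  \<epsilon>.\<close>

lemma QM_repr:
  assumes "f \<in> QM l (int w) m"
  shows "\<exists>P. f = g_root ^ w * ev2 P \<and> degree P \<le> l \<and> weight P \<le> w"
proof -
  obtain F where F: "f = (\<Sum>i\<le>l. F i * EE ^ i)" "\<forall>i\<le>l. F i \<in> MF (int w - 2 * int i) (m - int i)"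
    using assms by (auto simp: quasi_modular_forms_def)
  have "\<exists>r. F i * EE ^ i = g_root ^ w * ev2 (monom r i) \<and> weight (monom r i) \<le> w" if i: "i \<le> l" for i
  proof (cases "2 * i \<le> w")
    case True
    hence "F i \<in> MF (int (w - 2 * i)) (m - int i)" using F(2) i by (simp add: of_nat_diff)
    then obtain r where r: "F i = g_root ^ (w - 2 * i) * evx r" "(q + 1) * degree r \<le> w - 2 * i"
      using MF_repr by blast
    have "F i * EE ^ i = (g_root ^ (w - 2 * i) * g_root ^ (2 * i)) * (evx r * eps ^ i)"
      unfolding r(1) EE_eps by (simp only: power_mult_distrib power_mult[symmetric] mult_ac)
    also have "g_root ^ (w - 2 * i) * g_root ^ (2 * i) = g_root ^ w" using True by (simp flip: power_add)
    finally have "F i * EE ^ i = g_root ^ w * ev2 (monom r i)" by (simp only: ev2_monom)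
    moreover have "weight (monom r i) \<le> w" using r(2) True by (intro weight_leI) (auto split: if_splits)
    ultimately show ?thesis by blast
  next
    case False
    hence "F i = 0" using F(2) i by (intro MF_neg[of _ "F i"]) auto
    thus ?thesis by (intro exI[of _ 0]) (simp add: weight_def)
  qed
  then obtain r where r: "\<And>i. i \<le> l \<Longrightarrow> F i * EE ^ i = g_root ^ w * ev2 (monom (r i) i)"
      "\<And>i. i \<le> l \<Longrightarrow> weight (monom (r i) i) \<le> w" by metis
  define P where "P = (\<Sum>i\<le>l. monom (r i) i)"
  have "f = g_root ^ w * ev2 P" unfolding F(1) P_def ev2.hom_sum sum_distrib_left
    by (intro sum.cong refl r(1)) simp
  moreover have "degree P \<le> l" unfolding P_def
    by (intro degree_sum_le) (auto intro: le_trans[OF degree_monom_le])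
  moreover have "weight P \<le> w" unfolding P_def by (intro weight_sum_le r(2)) simp
  ultimately show ?thesis by blast
qed

section \<open>Products of quasi-modular forms and the forms to which the determinants
  belong\<close>

lemma gens_mult: "x \<in> gens w m \<Longrightarrow> y \<in> gens w' m' \<Longrightarrow> x * y \<in> gens (w + w') (m + m')"
proof -
  assume "x \<in> gens w m" "y \<in> gens w' m'"
  then obtain a b a' b' where x: "x = gg ^ a * hh ^ b" "int a * (int q - 1) + int b * (int q + 1) = w" "[int b = m] (mod (int q - 1))"
    and y: "y = gg ^ a' * hh ^ b'" "int a' * (int q - 1) + int b' * (int q + 1) = w'" "[int b' = m'] (mod (int q - 1))"
    by (auto simp: gens_def)
  have "x * y = gg ^ (a + a') * hh ^ (b + b')" unfolding x(1) y(1) by (simp only: power_add mult_ac)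
  moreover have "int (a + a') * (int q - 1) + int (b + b') * (int q + 1) = w + w'"
    unfolding x(2)[symmetric] y(2)[symmetric] by (simp add: algebra_simps)
  moreover have "[int (b + b') = m + m'] (mod (int q - 1))"
    using cong_add[OF x(3) y(3)] by simp
  ultimately show "x * y \<in> gens (w + w') (m + m')" unfolding gens_def by blast
qed

lemma span_mult:
  assumes "x \<in> vs.span S" "y \<in> vs.span T" "\<And>s t. s \<in> S \<Longrightarrow> t \<in> T \<Longrightarrow> s * t \<in> vs.span U"
  shows "x * y \<in> vs.span U"
proof -
  have 1: "s * y \<in> vs.span U" if s: "s \<in> S" for s
    using assms(2)
  proof (induction rule: vs.span_induct)
    case base
    show ?case
      by (rule vs.subspaceI) (auto simp: distrib_left vs.span_add vs.span_zero mult.left_commute[of s] intro: vs.span_scale)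
  qed (use assms(3) s in auto)
  show ?thesis using assms(1)
  proof (induction rule: vs.span_induct)
    case base
    show ?case
      by (rule vs.subspaceI) (auto simp: distrib_right vs.span_add vs.span_zero mult.assoc intro: vs.span_scale)
  qed (rule 1)
qed

lemma MF_mult: "x \<in> MF w m \<Longrightarrow> y \<in> MF w' m' \<Longrightarrow> x * y \<in> MF (w + w') (m + m')"
  unfolding MF_eq by (rule span_mult) (auto intro: vs.span_base gens_mult)

lemma MF_cong: "[m = m'] (mod (int q - 1)) \<Longrightarrow> MF w m = MF w m'"
proof -
  assume "[m = m'] (mod (int q - 1))"
  hence "[b = m] (mod (int q - 1)) \<longleftrightarrow> [b = m'] (mod (int q - 1))" for b
    using cong_trans cong_sym by blast
  hence "gens w m = gens w m'" by (simp add: gens_def)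
  thus ?thesis by (simp add: MF_eq)
qed

lemma QM_subspace: "vs.subspace (QM l w m)" by (rule subspace_quasi_modular_forms)

lemma QM_term:
  assumes "f \<in> MF (w - 2 * int k) (m - int k)" "k \<le> l"
  shows "f * EE ^ k \<in> QM l w m"
  unfolding quasi_modular_forms_def mem_Collect_eq
proof (intro exI[of _ "\<lambda>i. if i = k then f else 0"] conjI allI impI)
  have "(\<Sum>i\<le>l. (if i = k then f else 0) * EE ^ i) = (\<Sum>i\<le>l. if i = k then f * EE ^ k else 0)"
    by (intro sum.cong refl) auto
  also have "\<dots> = f * EE ^ k" using assms(2) by simp
  finally show "f * EE ^ k = (\<Sum>i\<le>l. (if i = k then f else 0) * EE ^ i)" by (rule sym)
  fix i show "(if i = k then f else 0) \<in> MF (w - 2 * int i) (m - int i)"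
    using assms(1) vs.subspace_0[OF MF_subspace] by simp
qed

lemma QM_mult:
  assumes "x \<in> QM l w m" "y \<in> QM l' w' m'"
  shows "x * y \<in> QM (l + l') (w + w') (m + m')"
proof -
  obtain F F' where F: "x = (\<Sum>i\<le>l. F i * EE ^ i)" "\<forall>i\<le>l. F i \<in> MF (w - 2 * int i) (m - int i)"
    and F': "y = (\<Sum>i\<le>l'. F' i * EE ^ i)" "\<forall>i\<le>l'. F' i \<in> MF (w' - 2 * int i) (m' - int i)"
    using assms by (auto simp: quasi_modular_forms_def)
  have "x * y = (\<Sum>i\<le>l. \<Sum>k\<le>l'. (F i * F' k) * EE ^ (i + k))"
    unfolding F(1) F'(1) sum_product by (simp only: power_add mult_ac)
  also have "\<dots> \<in> QM (l + l') (w + w') (m + m')"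
  proof (intro vs.subspace_sum[OF QM_subspace] QM_term)
    fix i k assume "i \<in> {..l}" "k \<in> {..l'}"
    hence "F i * F' k \<in> MF ((w - 2 * int i) + (w' - 2 * int k)) ((m - int i) + (m' - int k))"
      using F(2) F'(2) by (intro MF_mult) auto
    moreover have "(w - 2 * int i) + (w' - 2 * int k) = w + w' - 2 * int (i + k)" by simp
    moreover have "(m - int i) + (m' - int k) = m + m' - int (i + k)" by simp
    ultimately show "F i * F' k \<in> MF (w + w' - 2 * int (i + k)) (m + m' - int (i + k))" by (simp only:)
  qed auto
  finally show ?thesis .
qed

lemma QM_cong: "[m = m'] (mod (int q - 1)) \<Longrightarrow> QM l w m = QM l w m'"
proof -
  assume m: "[m = m'] (mod (int q - 1))"
  have "MF w (m - int i) = MF w (m' - int i)" for w i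
    by (rule MF_cong) (rule cong_diff[OF m cong_refl])
  thus ?thesis by (simp add: quasi_modular_forms_def)
qed

lemma QM_gens: "x \<in> gens w m \<Longrightarrow> x \<in> QM l w m"
  using QM_term[of x w 0 m l] by (simp add: MF_eq vs.span_base)

lemma QM_1: "1 \<in> QM l 0 0"
  by (rule QM_gens) (auto simp: gens_def intro!: exI[of _ 0])

lemma QM_gg: "gg \<in> QM l (int q - 1) 0"
  by (rule QM_gens, unfold gens_def mem_Collect_eq, rule exI[of _ 1], rule exI[of _ 0]) simp

lemma QM_hh: "hh \<in> QM l (int q + 1) 1"
  by (rule QM_gens, unfold gens_def mem_Collect_eq, rule exI[of _ 0], rule exI[of _ 1]) simp

lemma QM_EE: "EE \<in> QM 1 2 1"
proof -
  have "1 \<in> gens 0 0" unfolding gens_def mem_Collect_eq by (rule exI[of _ 0], rule exI[of _ 0]) simp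
  hence "1 \<in> MF (2 - 2 * int 1) (1 - int 1)" by (simp add: MF_eq vs.span_base)
  from QM_term[OF this order_refl] show ?thesis by simp
qed

lemma QM_power: "x \<in> QM l w m \<Longrightarrow> x ^ n \<in> QM (n * l) (int n * w) (int n * m)"
proof (induction n)
  case 0
  show ?case using QM_1[of 0] by simp
next
  case (Suc n)
  have "x * x ^ n \<in> QM (l + n * l) (w + int n * w) (m + int n * m)"
    using Suc by (intro QM_mult) auto
  thus ?case by (simp add: algebra_simps)
qed

lemma QM_scale: "x \<in> QM l w m \<Longrightarrow> fps_const c * x \<in> QM l w m"
  by (rule vs.subspace_scale[OF QM_subspace])

lemma QM_mono: "x \<in> QM l w m \<Longrightarrow> l \<le> l' \<Longrightarrow> x \<in> QM l' w m"
  using QM_mult[OF _ QM_1[of "l' - l"], of x l w m] by simp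

lemma q_cong_1: "[int q ^ n = 1] (mod (int q - 1))"
proof -
  have "[int q = 1] (mod (int q - 1))" by (simp add: cong_iff_dvd_diff)
  from cong_pow[OF this, of n] show ?thesis by simp
qed

text \<open>All terms of \<open>Ehat_rec\<close> have the same weight and depth at most 1, and the
  types agree because the type of h^((q-1) q^m) is 0 modulo q - 1. The coefficient of the highest
  term is a nonzero constant and can be divided out.\<close>

lemma QM_Ehat_0: "Ehat 0 n \<in> QM 1 (int (q ^ n + 1)) 1"
proof (induction n rule: less_induct)
  case (less n)
  have scale_back: "x \<in> QM l w m" if "kc a * x \<in> QM l w m" "a \<noteq> 0" for x l w m a
  proof -
    have "fps_const (inverse (to_fract a)) * (kc a * x) \<in> QM l w m" using that(1) by (rule QM_scale)
    also have "fps_const (inverse (to_fract a)) * (kc a * x) = x"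
      using that(2) by (simp add: kc_def fps_const_mult flip: mult.assoc)
    finally show ?thesis .
  qed
  have diff: "x - y \<in> QM l w m" if "x \<in> QM l w m" "y \<in> QM l w m" for x y l w m
    by (rule vs.subspace_diff[OF QM_subspace that])
  consider "n = 0" | "n = 1" | m where "n = Suc (Suc m)" by (metis One_nat_def not0_implies_Suc)
  thus ?case
  proof cases
    case 1
    thus ?thesis using QM_EE by (simp add: Ehat_0_0)
  next
    case 2
    have "gg * EE \<in> QM (0 + 1) (int q - 1 + 2) (0 + 1)" by (intro QM_mult QM_gg QM_EE)
    hence g: "- (gg * EE) \<in> QM 1 (int q + 1) 1"
      using vs.subspace_neg[OF QM_subspace] by (simp add: add.commute)
    have "- (gg * EE) - hh \<in> QM 1 (int q + 1) 1" by (rule diff[OF g QM_hh])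
    also have "- (gg * EE) - hh = kc (theta ^ q - theta) * Ehat 0 1"
      using Ehat_0_1 unfolding kc.hom_minus kc.hom_power by (simp add: algebra_simps eq_diff_eq)
    finally have "Ehat 0 1 \<in> QM 1 (int q + 1) 1"
      by (rule scale_back) (use theta_power_neq[of 1 0] in simp)
    thus ?thesis using 2 by (simp add: add.commute)
  next
    case (3 m)
    have t: "[1 + int n * 0 + x = x + 1] (mod (int q - 1))" for x by (simp add: add.commute)
    have "gg ^ (q ^ Suc m) * Ehat 0 (Suc m) \<in> QM (q ^ Suc m * 0 + 1) (int (q ^ Suc m) * (int q - 1) + int (q ^ Suc m + 1)) (int (q ^ Suc m) * 0 + 1)"
      by (intro QM_mult QM_power QM_gg less.IH) (use 3 in simp)
    hence 1: "gg ^ (q ^ Suc m) * Ehat 0 (Suc m) \<in> QM 1 (int (q ^ n + 1)) 1"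
      using 3 by (simp add: algebra_simps)
    have "(hh ^ (q - 1)) ^ (q ^ m) * Ehat 0 m \<in> 
        QM (q ^ m * ((q - 1) * 0) + 1) (int (q ^ m) * (int (q - 1) * (int q + 1)) + int (q ^ m + 1)) (int (q ^ m) * (int (q - 1) * 1) + 1)"
      by (intro QM_mult QM_power QM_hh less.IH) (use 3 in simp)
    also have "int (q ^ m) * (int (q - 1) * (int q + 1)) + int (q ^ m + 1) = int (q ^ n + 1)"
      using 3 q2 by (simp add: of_nat_diff algebra_simps)
    also have "q ^ m * ((q - 1) * 0) + 1 = 1" by simp
    also have "QM 1 (int (q ^ n + 1)) (int (q ^ m) * (int (q - 1) * 1) + 1) = QM 1 (int (q ^ n + 1)) 1"
      by (rule QM_cong) (use q2 in \<open>simp add: cong_iff_dvd_diff of_nat_diff\<close>)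
    finally have 2: "(hh ^ (q - 1)) ^ (q ^ m) * Ehat 0 m \<in> QM 1 (int (q ^ n + 1)) 1" .
    have "(hh ^ (q - 1)) ^ (q ^ m) * Ehat 0 m - gg ^ (q ^ Suc m) * Ehat 0 (Suc m) =
        kc (theta ^ (q ^ n) - theta) * Ehat 0 n"
      unfolding Ehat_rec[symmetric] 3 kc.hom_minus kc.hom_power by simp
    with diff[OF 2 1] have "kc (theta ^ (q ^ n) - theta) * Ehat 0 n \<in> QM 1 (int (q ^ n + 1)) 1" by simp
    thus ?thesis by (rule scale_back) (use theta_power_neq[of n 0] 3 in simp)
  qed
qed

text \<open>For s \<le> n the series is a q^s-th power of \<open>Ehat 0 (n - s)\<close>, and q^s is
  1 modulo q - 1. In the boundary case s = n + 1 it is a power of -h; including this case makes the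
  determinants quasi-modular for all k \<le> j + 2, in particular for k \<le> 2 and every j.\<close>

lemma QM_Ehat:
  assumes "s \<le> n + 1"
  shows "Ehat s n \<in> QM (q ^ s) (int (q ^ n + q ^ s)) 1"
proof (cases "s \<le> n")
  case True
  have "Ehat 0 (n - s) ^ (q ^ s) \<in> QM (q ^ s * 1) (int (q ^ s) * int (q ^ (n - s) + 1)) (int (q ^ s) * 1)"
    by (intro QM_power QM_Ehat_0)
  also have "Ehat 0 (n - s) ^ (q ^ s) = Ehat s n" using Ehat_power[of 0 "n - s" s] True by simp
  also have "int (q ^ s) * int (q ^ (n - s) + 1) = int (q ^ n + q ^ s)"
    using True by (simp add: distrib_left flip: power_add)
  also have "QM (q ^ s * 1) (int (q ^ n + q ^ s)) (int (q ^ s) * 1) = QM (q ^ s) (int (q ^ n + q ^ s)) 1"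
    using QM_cong[OF q_cong_1[of s], of "q ^ s"] by simp
  finally show ?thesis .
next
  case False
  hence s: "s = Suc n" using assms by simp
  have "(- hh) \<in> QM 0 (int q + 1) 1" using vs.subspace_neg[OF QM_subspace QM_hh] .
  hence "(- hh) ^ (q ^ n) \<in> QM (q ^ n * 0) (int (q ^ n) * (int q + 1)) (int (q ^ n) * 1)" by (rule QM_power)
  also have "(- hh) ^ (q ^ n) = Ehat s n" using Ehat_power[of 1 0 n] s by (simp add: Ehat_1_0[simplified])
  also have "int (q ^ n) * (int q + 1) = int (q ^ n + q ^ s)" by (simp add: s algebra_simps)
  also have "QM (q ^ n * 0) (int (q ^ n + q ^ s)) (int (q ^ n) * 1) = QM 0 (int (q ^ n + q ^ s)) 1"
    using QM_cong[OF q_cong_1[of n], of 0] by simp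
  finally show ?thesis by (rule QM_mono) simp
qed

text \<open>The depth (q^k - 1)/(q - 1), written as a sum to avoid the division.\<close>

definition q_geom :: "nat \<Rightarrow> nat" where "q_geom k = (\<Sum>a<k. q ^ a)"

lemma QM_prod:
  assumes "finite A" "\<And>x. x \<in> A \<Longrightarrow> f x \<in> QM (l x) (w x) (m x)"
  shows "prod f A \<in> QM (sum l A) (sum w A) (sum m A)"
  using assms by (induction A rule: finite_induct) (auto simp: QM_1 intro: QM_mult)

text \<open>All terms of the determinant have the same weight, because a permutation only reorders
  the columns that enter the sum.\<close>

lemma perm_weight:
  assumes "r permutes {..<k}"
  shows "(\<Sum>a<k. q ^ (j + r a) + q ^ a) = q_geom k * (q ^ j + 1)"
proof -
  have "(\<Sum>a<k. q ^ (j + r a)) = (\<Sum>a<k. q ^ (j + a))"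
    using sum.permute[OF assms, of "\<lambda>a. q ^ (j + a)"] by (simp add: o_def)
  thus ?thesis by (simp add: sum.distrib q_geom_def power_add sum_distrib_left algebra_simps)
qed

lemma QM_det_Gmat:
  assumes "k \<le> j + 2"
  shows "det (Gmat j k) \<in> QM (q_geom k) (int (q_geom k * (q ^ j + 1))) (int k)"
proof -
  have "det (Emat j k) \<in> QM (q_geom k) (int (q_geom k * (q ^ j + 1))) (int k)"
    unfolding Emat_def det_expand
  proof (intro vs.subspace_sum[OF QM_subspace])
    fix r assume "r \<in> {r. r permutes {..<k}}"
    hence r: "r permutes {..<k}" by simp
    have "(\<Prod>a<k. Ehat a (j + r a)) \<in> QM (\<Sum>a<k. q ^ a) (\<Sum>a<k. int (q ^ (j + r a) + q ^ a)) (\<Sum>a<k. 1)"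
      by (intro QM_prod QM_Ehat) (use assms in auto)
    also have "(\<Sum>a<k. int (q ^ (j + r a) + q ^ a)) = int (q_geom k * (q ^ j + 1))"
      unfolding perm_weight[OF r, symmetric] by (rule of_nat_sum[symmetric])
    finally have "(\<Prod>a<k. Ehat a (j + r a)) \<in> QM (q_geom k) (int (q_geom k * (q ^ j + 1))) (int k)" by (simp add: q_geom_def)
    hence "fps_const (of_int (sign r)) * (\<Prod>a<k. Ehat a (j + r a)) \<in> QM (q_geom k) (int (q_geom k * (q ^ j + 1))) (int k)"
      by (rule QM_scale)
    thus "of_int (sign r) * (\<Prod>a<k. Ehat a (j + r a)) \<in> QM (q_geom k) (int (q_geom k * (q ^ j + 1))) (int k)"
      by (simp add: fps_of_int)
  qed
  hence "fps_const (inverse (to_fract (B_poly k))) * (kc (B_poly k) * det (Gmat j k)) \<in> QM (q_geom k) (int (q_geom k * (q ^ j + 1))) (int k)"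
    unfolding det_Emat by (rule QM_scale)
  also have "fps_const (inverse (to_fract (B_poly k))) * (kc (B_poly k) * det (Gmat j k)) = det (Gmat j k)"
    using B_poly_nz[of k] by (simp add: kc_def flip: mult.assoc)
  finally show ?thesis .
qed

lemma q_geom_eq: "(q ^ k - 1) div (q - 1) = q_geom k"
  and q_geom_weight: "(q ^ k - 1) * (q ^ j + 1) div (q - 1) = q_geom k * (q ^ j + 1)"
proof -
  have *: "q ^ k - 1 = (q - 1) * q_geom k" unfolding q_geom_def by (rule cf.sum_q_powers[symmetric])
  have nz: "q - 1 \<noteq> 0" using q2 by linarith
  show "(q ^ k - 1) div (q - 1) = q_geom k" unfolding * using nz by (rule nonzero_mult_div_cancel_left)
  show "(q ^ k - 1) * (q ^ j + 1) div (q - 1) = q_geom k * (q ^ j + 1)"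
    unfolding * mult.assoc using nz by (rule nonzero_mult_div_cancel_left)
qed

end

subsection \<open>Resultants\<close>

lemma coeff_mult_top:
  fixes P Q :: "'b::comm_semiring_1 poly"
  assumes "degree P \<le> a" "degree Q \<le> b"
  shows "coeff (P * Q) (a + b) = coeff P a * coeff Q b"
proof (cases "degree P = a \<and> degree Q = b")
  case True
  thus ?thesis using coeff_mult_degree_sum[of P Q] by simp
next
  case False
  hence lt: "degree P < a \<or> degree Q < b" using assms by linarith
  hence "degree P + degree Q < a + b" using assms by linarith
  hence "degree (P * Q) < a + b" using degree_mult_le[of P Q] by linarith
  hence "coeff (P * Q) (a + b) = 0" by (rule coeff_eq_0)
  moreover have "coeff P a = 0 \<or> coeff Q b = 0" using lt coeff_eq_0 by blast
  ultimately show ?thesis by auto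
qed

lemma coeff_prod_top:
  fixes f :: "'c \<Rightarrow> 'b::comm_semiring_1 poly"
  assumes "finite A" "\<And>a. a \<in> A \<Longrightarrow> degree (f a) \<le> d a"
  shows "coeff (prod f A) (sum d A) = (\<Prod>a\<in>A. coeff (f a) (d a)) \<and> degree (prod f A) \<le> sum d A"
  using assms
proof (induction A rule: finite_induct)
  case (insert x A)
  have f: "degree (f x) \<le> d x" and IH: "coeff (prod f A) (sum d A) = (\<Prod>a\<in>A. coeff (f a) (d a))"
    "degree (prod f A) \<le> sum d A" using insert by auto
  have "degree (f x * prod f A) \<le> d x + sum d A"
    using f IH(2) degree_mult_le[of "f x" "prod f A"] by linarith
  thus ?case using insert(1,2) by (simp add: coeff_mult_top[OF f IH(2)] IH(1))
qed simp

lemma sum_if_less: "(\<Sum>i<n + m. if i < n then (a :: nat) else b) = n * a + m * b"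
proof -
  have "(\<Sum>i<n. if i < n then a else b) = n * a" by (simp cong: sum.cong_simp)
  thus ?thesis by (induction m) simp_all
qed

context drinfeld
begin

text \<open>The Sylvester determinant is isobaric. The degree of a nonzero entry is bounded in terms
  of column minus row; along a permutation these differences cancel, and the offset deg P in the
  rows that contain P, one for each of deg Q rows, leaves the saving 2 deg P deg Q.\<close>

lemma resultant_degree:
  assumes nz: "resultant P Q \<noteq> 0" and w: "weight P \<le> w" "weight Q \<le> w'"
  shows "(q + 1) * degree (resultant P Q) + 2 * (degree P * degree Q) \<le> degree Q * w + degree P * w'"
proof -
  define n m where "n = degree Q" and "m = degree P"
  define S where "S = sylvester_mat P Q"
  have S: "S \<in> carrier_mat (n + m) (n + m)" using sylvester_carrier_mat[of P Q] by (simp add: S_def n_def m_def add.commute)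
  define D where "D = degree (resultant P Q)"
  have "coeff (det S) D \<noteq> 0" using nz by (simp add: D_def S_def resultant_def)
  hence "(\<Sum>r\<in>{r. r permutes {..<n + m}}. coeff (of_int (sign r) * (\<Prod>i<n + m. S $$ (i, r i))) D) \<noteq> 0"
    by (simp only: det_def'[OF S] coeff_sum atLeast0LessThan not_False_eq_True)
  \<comment> \<open>Some permutation contributes to the leading coefficient of the resultant; its
    entries are nonzero and their degrees bound that of the resultant.\<close>
  then obtain r where r: "r permutes {..<n + m}" and c: "coeff (of_int (sign r) * (\<Prod>i<n + m. S $$ (i, r i))) D \<noteq> 0"
    using sum.not_neutral_contains_not_neutral by blast
  have "D \<le> degree (of_int (sign r) * (\<Prod>i<n + m. S $$ (i, r i)))" by (rule le_degree[OF c])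
  also have "\<dots> \<le> degree (of_int (sign r) :: 'a ratfun poly) + degree (\<Prod>i<n + m. S $$ (i, r i))" by (rule degree_mult_le)
  also have "\<dots> \<le> (\<Sum>i<n + m. degree (S $$ (i, r i)))"
    using degree_prod_sum_le[of "{..<n + m}" "\<lambda>i. S $$ (i, r i)"] by (simp add: o_def)
  finally have D: "D \<le> (\<Sum>i<n + m. degree (S $$ (i, r i)))" .
  have "(\<Prod>i<n + m. S $$ (i, r i)) \<noteq> 0" using c mult_zero_right coeff_0 by metis
  hence Snz: "S $$ (i, r i) \<noteq> 0" if "i < n + m" for i using that by simp
  have entry: "(q + 1) * degree (S $$ (i, r i)) + 2 * (i + (if i < n then m else 0)) \<le> (if i < n then w else w') + 2 * r i"
    if i: "i < n + m" for i
  proof -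
    have ri: "r i < n + m" using i permutes_in_image[OF r, of i] by simp
    have idx: "S $$ (i, r i) = (if i < n then if i \<le> r i \<and> r i - i \<le> m then coeff P (m + i - r i) else 0
                 else if i - n \<le> r i \<and> r i \<le> i then coeff Q (i - r i) else 0)"
      unfolding S_def n_def m_def by (rule sylvester_index_mat) (use i ri in \<open>simp_all add: n_def m_def\<close>)
    show ?thesis
    proof (cases "i < n")
      case True
      hence a: "i \<le> r i" "r i - i \<le> m" "S $$ (i, r i) = coeff P (m + i - r i)"
        using idx Snz[OF i] by (auto split: if_splits)
      have "(q + 1) * degree (S $$ (i, r i)) + 2 * (m + i - r i) \<le> w"
        unfolding a(3) using weight_coeff[of P "m + i - r i"] Snz[OF i] w(1) a(3) by simp
      moreover have "m + i - r i + r i = m + i" using a(1,2) by linarith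
      ultimately show ?thesis using True by simp
    next
      case False
      hence a: "r i \<le> i" "S $$ (i, r i) = coeff Q (i - r i)"
        using idx Snz[OF i] by (auto split: if_splits)
      have "(q + 1) * degree (S $$ (i, r i)) + 2 * (i - r i) \<le> w'"
        unfolding a(2) using weight_coeff[of Q "i - r i"] Snz[OF i] w(2) a(2) by simp
      thus ?thesis using False a(1) by simp
    qed
  qed
  have "(\<Sum>i<n + m. (q + 1) * degree (S $$ (i, r i)) + 2 * (i + (if i < n then m else 0))) \<le>
        (\<Sum>i<n + m. (if i < n then w else w') + 2 * r i)"
    by (rule sum_mono) (use entry in simp)
  hence "(q + 1) * (\<Sum>i<n + m. degree (S $$ (i, r i))) + 2 * ((\<Sum>i<n + m. i) + (\<Sum>i<n + m. if i < n then m else 0)) \<le>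
        (\<Sum>i<n + m. if i < n then w else w') + 2 * (\<Sum>i<n + m. r i)"
    by (simp only: sum.distrib sum_distrib_left[symmetric])
  moreover have "(\<Sum>i<n + m. r i) = (\<Sum>i<n + m. i)"
    using sum.permute[OF r, of "\<lambda>i. i"] by (simp add: o_def)
  ultimately have "(q + 1) * (\<Sum>i<n + m. degree (S $$ (i, r i))) + 2 * (n * m) \<le> n * w + m * w'"
    by (simp only: sum_if_less) simp
  moreover have "(q + 1) * D \<le> (q + 1) * (\<Sum>i<n + m. degree (S $$ (i, r i)))" by (rule mult_le_mono2[OF D])
  ultimately have "(q + 1) * D + 2 * (n * m) \<le> n * w + m * w'" by linarith
  thus ?thesis by (simp only: D_def n_def m_def mult.commute[of "degree P" "degree Q"])
qed

lemma ev2_sum: "degree T < M \<Longrightarrow> ev2 T = (\<Sum>t<M. evx (coeff T t) * eps ^ t)"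
proof -
  assume "degree T < M"
  then obtain M' where M': "M = Suc M'" "degree T \<le> M'" by (cases M) auto
  have "T = (\<Sum>t<M. monom (coeff T t) t)"
    unfolding M' lessThan_Suc_atMost by (rule poly_as_sum_of_monoms'[OF M'(2), symmetric])
  hence "ev2 T = ev2 (\<Sum>t<M. monom (coeff T t) t)" by (rule arg_cong)
  thus ?thesis by (simp only: ev2.hom_sum ev2_monom)
qed

text \<open>
  Applied to the vector of powers of \<open>\<epsilon>\<close>, the Sylvester matrix gives multiples of the values of
  \<open>P\<close> and \<open>Q\<close>; multiplying by the adjugate matrix leaves the resultant.
\<close>

lemma resultant_dvd:
  assumes pos: "degree P + degree Q \<noteq> 0" and d: "f dvd ev2 P" "f dvd ev2 Q"
  shows "f dvd evx (resultant P Q)"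
proof -
  define n m where "n = degree Q" and "m = degree P"
  define M where "M = m + n"
  define S where "S = sylvester_mat P Q"
  have S: "S \<in> carrier_mat M M" using sylvester_carrier_mat[of P Q] by (simp add: S_def M_def n_def m_def)
  define A where "A = map_mat evx S"
  have A: "A \<in> carrier_mat M M" using S by (simp add: A_def)
  have detA: "det A = evx (resultant P Q)" by (simp add: A_def S_def resultant_def evx.hom_det)
  have Mpos: "M > 0" using pos by (simp add: M_def n_def m_def)
  define v where "v = vec M (\<lambda>j. eps ^ (M - Suc j))"
  have v: "v \<in> carrier_vec M" by (simp add: v_def)
  have row: "f dvd (A *\<^sub>v v) $ i" if i: "i < M" for i
  proof -
    define T where "T = (if i < n then monom 1 (n - Suc i) * P else monom 1 (M - Suc i) * Q)"
    have idx: "S $$ (i, j) = coeff T (M - Suc j)" if j: "j < M" for j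
    proof -
      have "S $$ (i, j) = (if i < n then coeff (monom 1 (n - i) * P) (M - j) else coeff (monom 1 (M - i) * Q) (M - j))"
        unfolding S_def M_def n_def m_def by (rule sylvester_index_mat2) (use i j in \<open>simp_all add: M_def n_def m_def\<close>)
      moreover have "coeff (monom 1 (n - i) * P) (M - j) = coeff (monom 1 (n - Suc i) * P) (M - Suc j)" if "i < n"
      proof -
        have "n - i = Suc (n - Suc i)" "M - j = Suc (M - Suc j)" using that j by linarith+
        thus ?thesis by (simp only: coeff_monom_mult Suc_less_eq diff_Suc_Suc Suc_le_mono)
      qed
      moreover have "coeff (monom 1 (M - i) * Q) (M - j) = coeff (monom 1 (M - Suc i) * Q) (M - Suc j)"
      proof -
        have "M - i = Suc (M - Suc i)" "M - j = Suc (M - Suc j)" using i j by linarith+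
        thus ?thesis by (simp only: coeff_monom_mult Suc_less_eq diff_Suc_Suc Suc_le_mono)
      qed
      ultimately show ?thesis by (simp add: T_def)
    qed
    have degT: "degree T < M"
    proof (cases "i < n")
      case True
      have "degree T \<le> n - Suc i + m"
        using True degree_mult_le[of "monom 1 (n - Suc i)" P] degree_monom_le[of "1 :: 'a ratfun poly" "n - Suc i"]
        by (simp add: T_def m_def)
      thus ?thesis using True by (simp add: M_def)
    next
      case False
      have "degree T \<le> M - Suc i + n"
        using False degree_mult_le[of "monom 1 (M - Suc i)" Q] degree_monom_le[of "1 :: 'a ratfun poly" "M - Suc i"]
        by (simp add: T_def n_def)
      thus ?thesis using False i by simp
    qed
    have "(A *\<^sub>v v) $ i = (\<Sum>j<M. evx (S $$ (i, j)) * eps ^ (M - Suc j))"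
      using i A S by (simp add: scalar_prod_def v_def A_def atLeast0LessThan)
    also have "\<dots> = (\<Sum>j<M. evx (coeff T (M - Suc j)) * eps ^ (M - Suc j))"
      by (intro sum.cong refl) (simp add: idx)
    also have "\<dots> = ev2 T" unfolding ev2_sum[OF degT] by (rule sum.nat_diff_reindex)
    also have "f dvd ev2 T"
      unfolding T_def using d by (simp add: ev2.hom_mult)
    finally show ?thesis .
  qed
  have "adj_mat A *\<^sub>v (A *\<^sub>v v) = (adj_mat A * A) *\<^sub>v v"
    by (rule assoc_mult_mat_vec[symmetric, OF adj_mat(1)[OF A] A v])
  also have "adj_mat A * A = det A \<cdot>\<^sub>m 1\<^sub>m M" by (rule adj_mat(3)[OF A])
  finally have *: "adj_mat A *\<^sub>v (A *\<^sub>v v) = (det A \<cdot>\<^sub>m 1\<^sub>m M) *\<^sub>v v" .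
  have "((det A \<cdot>\<^sub>m 1\<^sub>m M) *\<^sub>v v) $ (M - 1) = (\<Sum>j<M. det A * (if j = M - Suc 0 then 1 else 0) * eps ^ (M - Suc j))"
    using Mpos by (simp add: scalar_prod_def v_def atLeast0LessThan)
  also have "\<dots> = (\<Sum>j<M. if j = M - Suc 0 then det A * eps ^ (M - Suc j) else 0)"
    by (intro sum.cong refl) auto
  \<comment> \<open>The last entry of \<open>v\<close> is \<open>eps ^ 0\<close>, so this coordinate
    is the determinant itself.\<close>
  also have "\<dots> = det A" using Mpos by simp
  finally have "det A = (adj_mat A *\<^sub>v (A *\<^sub>v v)) $ (M - 1)" by (simp only: *)
  also have "\<dots> = (\<Sum>j<M. adj_mat A $$ (M - 1, j) * (A *\<^sub>v v) $ j)"
    using Mpos adj_mat(1)[OF A] A by (simp add: scalar_prod_def atLeast0LessThan)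
  also have "f dvd \<dots>" by (intro dvd_sum dvd_mult row) simp
  finally show ?thesis by (simp only: detA)
qed

lemma X_power_dvd: "f \<noteq> 0 \<Longrightarrow> fps_X ^ N dvd (f :: 'a ratfun fps) \<longleftrightarrow> N \<le> subdegree f"
  by (subst fps_dvd_iff) simp_all

lemma resultant_order:
  assumes nz: "resultant P Q \<noteq> 0" and pos: "degree P + degree Q \<noteq> 0"
    and w: "weight P \<le> w" "weight Q \<le> w'" and d: "fps_X ^ N dvd ev2 P" "fps_X ^ N dvd ev2 Q"
  shows "(q + 1) * N + 2 * (degree P * degree Q) \<le> degree Q * w + degree P * w'"
proof -
  have "N \<le> subdegree (evx (resultant P Q))"
    using resultant_dvd[OF pos d] X_power_dvd evx_order[OF nz] by blast
  also have "\<dots> \<le> degree (resultant P Q)" using evx_order[OF nz] by blast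
  finally have "(q + 1) * N \<le> (q + 1) * degree (resultant P Q)" by (rule mult_le_mono2)
  thus ?thesis using resultant_degree[OF nz w] by linarith
qed

text \<open>The ring K[\<eta>] is factorial, so the greatest common divisor exists without
  denominators in \<eta>; it has positive degree in \<epsilon> exactly when the resultant
  vanishes.\<close>

lemma resultant_0_factor:
  fixes P Q :: "'a ratfun poly poly"
  assumes "resultant P Q = 0"
  shows "\<exists>C B D. P = C * B \<and> Q = C * D \<and> degree C \<noteq> 0"
proof -
  have "degree (gcd P Q) \<noteq> 0" using assms by (simp add: resultant_0_gcd)
  moreover have "P = gcd P Q * (P div gcd P Q)" "Q = gcd P Q * (Q div gcd P Q)" by simp_all
  ultimately show ?thesis by blast
qed

subsection \<open>The dehomogenised forms\<close>

definition br :: "nat \<Rightarrow> 'a ratfun" where "br n = to_fract (theta ^ (q ^ n) - theta)"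

lemma br_nz: "n \<noteq> 0 \<Longrightarrow> br n \<noteq> 0"
  using theta_power_neq[of n 0] by (simp add: br_def)

lemma kc_br: "kc theta ^ (q ^ n) - kc theta = fps_const (br n)"
  unfolding br_def kc_def[symmetric] kc.hom_minus kc.hom_power by (rule refl)

text \<open>The weight (q + 1)(q - 1) q^m belongs to h^((q-1) q^m), and (q - 1) q^(m+1) to
  g^(q^(m+1)), the two coefficients of the recursion.\<close>

lemma weight_step:
  "(q + 1) * ((q - 1) * q ^ m) + q ^ m = q ^ Suc (Suc m)"
  "(q - 1) * q ^ Suc m + q ^ Suc m = q ^ Suc (Suc m)"
proof -
  have "(q + 1) * (q - 1) + 1 = q * q" using q2 by (cases q) (simp_all add: algebra_simps)
  hence "((q + 1) * (q - 1) + 1) * q ^ m = q ^ Suc (Suc m)" by (simp only: power_Suc mult.assoc)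
  thus "(q + 1) * ((q - 1) * q ^ m) + q ^ m = q ^ Suc (Suc m)" by (simp only: add_mult_distrib mult_1 mult.assoc)
  have "(q - 1) + 1 = q" using q2 by linarith
  hence "((q - 1) + 1) * q ^ Suc m = q ^ Suc (Suc m)" by (simp only: power_Suc)
  thus "(q - 1) * q ^ Suc m + q ^ Suc m = q ^ Suc (Suc m)" by (simp only: add_mult_distrib mult_1)
qed

text \<open>
  The recursion of the \<open>E\<^bsub>n,1\<^esub>\<close> after division by \<open>g_root^(q^n + 1)\<close>; it is satisfied by both coefficients of
  \<open>E\<^bsub>n,1\<^esub> / g_root^(q^n + 1) = al n \<epsilon> + be n\<close>.
\<close>

fun two_step :: "'a ratfun poly \<Rightarrow> 'a ratfun poly \<Rightarrow> nat \<Rightarrow> 'a ratfun poly" where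
  "two_step u v 0 = u"
| "two_step u v (Suc 0) = v"
| "two_step u v (Suc (Suc n)) = [:inverse (br (Suc (Suc n))):] * (monom 1 ((q - 1) * q ^ n) * two_step u v n - two_step u v (Suc n))"

definition al :: "nat \<Rightarrow> 'a ratfun poly" where "al = two_step 1 [:- inverse (br 1):]"
definition be :: "nat \<Rightarrow> 'a ratfun poly" where "be = two_step 0 [:0, - inverse (br 1):]"
definition eP :: "nat \<Rightarrow> 'a ratfun poly poly" where "eP n = [:be n, al n:]"

lemma al_simps [simp]: "al 0 = 1" "al (Suc 0) = [:- inverse (br 1):]"
  "al (Suc (Suc n)) = [:inverse (br (Suc (Suc n))):] * (monom 1 ((q - 1) * q ^ n) * al n - al (Suc n))"
  by (simp_all only: al_def two_step.simps)

lemma be_simps [simp]: "be 0 = 0" "be (Suc 0) = [:0, - inverse (br 1):]"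
  "be (Suc (Suc n)) = [:inverse (br (Suc (Suc n))):] * (monom 1 ((q - 1) * q ^ n) * be n - be (Suc n))"
  by (simp_all only: be_def two_step.simps)

declare al_simps(3) [simp del] be_simps(3) [simp del]

lemma ev2_eP_expand: "ev2 (eP n) = evx (be n) + eps * evx (al n)"
  by (simp add: eP_def ev2_pCons)

lemma ev2_eP: "g_root ^ (q ^ n + 1) * ev2 (eP n) = Ehat 0 n"
proof (induction n rule: less_induct)
  case (less n)
  have cancel: "x = y" if "fps_const (br n) * x = fps_const (br n) * y" "n \<noteq> 0" for x y
    using that br_nz[OF that(2)] by simp
  consider "n = 0" | "n = 1" | m where "n = Suc (Suc m)" by (metis One_nat_def not0_implies_Suc)
  thus ?case
  proof cases
    case 1
    thus ?thesis by (simp add: ev2_eP_expand Ehat_0_0 EE_eps numeral_2_eq_2)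
  next
    case 2
    have "fps_const (br 1 * - inverse (br 1)) = fps_const (- 1)" using br_nz[of 1] by simp
    also have "fps_const (- 1) = (- 1 :: 'a ratfun fps)" by (simp flip: fps_const_neg)
    finally have c: "fps_const (br 1 * - inverse (br 1)) = - 1" .
    have "fps_const (br 1) * evx (be 1) = fps_const (br 1 * - inverse (br 1)) * eta"
      by (simp only: One_nat_def be_simps(2) evx_pCons evx.hom_zero mult_zero_right add_0_right
        fps_const_0_eq_0 add_0_left fps_const_mult[symmetric] mult_zero_left mult_ac)
    moreover have "fps_const (br 1) * evx (al 1) = fps_const (br 1 * - inverse (br 1))"
      by (simp only: One_nat_def al_simps(2) evx_const fps_const_mult)
    ultimately have b: "fps_const (br 1) * evx (be 1) = - eta" "fps_const (br 1) * evx (al 1) = - 1"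
      by (simp_all only: c mult_minus_left mult_1_left)
    have "fps_const (br 1) * (g_root ^ (q + 1) * ev2 (eP 1)) = g_root ^ (q + 1) * (fps_const (br 1) * evx (be 1) + eps * (fps_const (br 1) * evx (al 1)))"
      unfolding ev2_eP_expand by (simp only: distrib_left mult_ac)
    also have "\<dots> = - (g_root ^ (q + 1) * eta) - g_root ^ (q + 1) * eps"
      unfolding b by (simp add: algebra_simps)
    also have "g_root ^ (q + 1) * eps = gg * EE"
    proof -
      have "g_root ^ (q + 1) = g_root ^ (q - 1) * g_root ^ 2" using q2 by (simp flip: power_add)
      thus ?thesis by (simp only: g_root_gg EE_eps mult.assoc)
    qed
    also have "- (g_root ^ (q + 1) * eta) - gg * EE = fps_const (br 1) * Ehat 0 1"
      using Ehat_0_1 kc_br[of 1] unfolding hh_eta[symmetric] by (simp add: algebra_simps add_eq_0_iff)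
    finally show ?thesis using 2 cancel by simp
  next
    case (3 m)
    have mon: "evx (monom 1 ((q - 1) * q ^ m)) = (eta ^ (q - 1)) ^ (q ^ m)"
      by (simp only: evx_monom fps_const_1_eq_1 mult_1_left power_mult)
    have scale: "fps_const (br n) * evx ([:inverse (br n):] * r) = evx r" for r
    proof -
      have "fps_const (br n) * evx ([:inverse (br n):] * r) = (fps_const (br n) * fps_const (inverse (br n))) * evx r"
        by (simp only: evx.hom_mult evx_const mult.assoc)
      thus ?thesis using br_nz[of n] 3 by simp
    qed
    have "fps_const (br n) * ev2 (eP n) = fps_const (br n) * evx (be n) + eps * (fps_const (br n) * evx (al n))"
      unfolding ev2_eP_expand by (simp only: distrib_left mult_ac)
    also have "fps_const (br n) * evx (be n) = (eta ^ (q - 1)) ^ (q ^ m) * evx (be m) - evx (be (Suc m))"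
      using scale[of "monom 1 ((q - 1) * q ^ m) * be m - be (Suc m)"] unfolding 3 be_simps(3)
      by (simp only: evx.hom_minus evx.hom_mult mon)
    also have "fps_const (br n) * evx (al n) = (eta ^ (q - 1)) ^ (q ^ m) * evx (al m) - evx (al (Suc m))"
      using scale[of "monom 1 ((q - 1) * q ^ m) * al m - al (Suc m)"] unfolding 3 al_simps(3)
      by (simp only: evx.hom_minus evx.hom_mult mon)
    finally have rec: "fps_const (br n) * ev2 (eP n) = (eta ^ (q - 1)) ^ (q ^ m) * ev2 (eP m) - ev2 (eP (Suc m))"
      unfolding ev2_eP_expand by (simp add: algebra_simps)
    have g1: "g_root ^ (q ^ n + 1) = (g_root ^ (q + 1)) ^ ((q - 1) * q ^ m) * g_root ^ (q ^ m + 1)"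
    proof -
      have "(q + 1) * ((q - 1) * q ^ m) + (q ^ m + 1) = q ^ n + 1"
        unfolding 3 add.assoc[symmetric] weight_step by (rule refl)
      thus ?thesis by (simp only: power_mult[symmetric] power_add[symmetric])
    qed
    have g2: "g_root ^ (q ^ n + 1) = gg ^ (q ^ Suc m) * g_root ^ (q ^ Suc m + 1)"
    proof -
      have "(q - 1) * q ^ Suc m + (q ^ Suc m + 1) = q ^ n + 1"
        unfolding 3 add.assoc[symmetric] weight_step by (rule refl)
      thus ?thesis by (simp only: g_root_gg[symmetric] power_mult[symmetric] power_add[symmetric])
    qed
    have hp: "(g_root ^ (q + 1)) ^ ((q - 1) * q ^ m) * (eta ^ (q - 1)) ^ (q ^ m) = (hh ^ (q - 1)) ^ (q ^ m)"
      by (simp only: hh_eta power_mult_distrib power_mult)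
    have "fps_const (br n) * (g_root ^ (q ^ n + 1) * ev2 (eP n)) = g_root ^ (q ^ n + 1) * ((eta ^ (q - 1)) ^ (q ^ m) * ev2 (eP m)) - g_root ^ (q ^ n + 1) * ev2 (eP (Suc m))"
      unfolding mult.left_commute[of "fps_const (br n)"] rec by (rule right_diff_distrib)
    also have "g_root ^ (q ^ n + 1) * ((eta ^ (q - 1)) ^ (q ^ m) * ev2 (eP m)) =
       ((g_root ^ (q + 1)) ^ ((q - 1) * q ^ m) * (eta ^ (q - 1)) ^ (q ^ m)) * (g_root ^ (q ^ m + 1) * ev2 (eP m))"
      unfolding g1 by (simp only: mult_ac)
    also have "\<dots> = (hh ^ (q - 1)) ^ (q ^ m) * Ehat 0 m"
      unfolding hp using less.IH[of m] 3 by simp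
    also have "g_root ^ (q ^ n + 1) * ev2 (eP (Suc m)) = gg ^ (q ^ Suc m) * Ehat 0 (Suc m)"
      unfolding g2 mult.assoc using less.IH[of "Suc m"] 3 by simp
    also have "(hh ^ (q - 1)) ^ (q ^ m) * Ehat 0 m - gg ^ (q ^ Suc m) * Ehat 0 (Suc m) = fps_const (br n) * Ehat 0 n"
      unfolding Ehat_rec[symmetric] 3 kc_br[symmetric] by simp
    finally show ?thesis by (rule cancel) (use 3 in simp)
  qed
qed

text \<open>The parameters treat both coefficients at once: c = 1, d = 0 for \<open>al\<close>,
  which stands with a factor \<epsilon> of weight 2, and c = 0, d = 1 for \<open>be\<close>.\<close>

lemma two_step_degree:
  assumes "(q + 1) * degree u + c \<le> 1 + d" "(q + 1) * degree v + c \<le> q + d"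
  shows "(q + 1) * degree (two_step u v n) + c \<le> q ^ n + d"
proof (induction n rule: less_induct)
  case (less n)
  consider "n = 0" | "n = 1" | m where "n = Suc (Suc m)" by (metis One_nat_def not0_implies_Suc)
  thus ?case
  proof cases
    case (3 m)
    define A B where "A = monom 1 ((q - 1) * q ^ m) * two_step u v m" and "B = two_step u v (Suc m)"
    have A: "(q + 1) * degree A + c \<le> q ^ n + d"
    proof -
      have "degree A \<le> (q - 1) * q ^ m + degree (two_step u v m)"
        unfolding A_def using degree_mult_le[of "monom 1 ((q - 1) * q ^ m)" "two_step u v m"]
          degree_monom_le[of "1 :: 'a ratfun" "(q - 1) * q ^ m"] by linarith
      hence "(q + 1) * degree A \<le> (q + 1) * ((q - 1) * q ^ m + degree (two_step u v m))" by (rule mult_le_mono2)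
      moreover have "(q + 1) * degree (two_step u v m) + c \<le> q ^ m + d" using less 3 by simp
      moreover have "(q + 1) * ((q - 1) * q ^ m) + q ^ m = q ^ n" unfolding 3 by (rule weight_step)
      ultimately show ?thesis unfolding distrib_left[of "q + 1" "(q - 1) * q ^ m"] by linarith
    qed
    have B: "(q + 1) * degree B + c \<le> q ^ n + d"
    proof -
      have "(q + 1) * degree B + c \<le> q ^ Suc m + d" unfolding B_def using less[of "Suc m"] 3 by simp
      moreover have "q ^ Suc m \<le> q ^ n" using 3 q2 by (intro power_increasing) auto
      ultimately show ?thesis by linarith
    qed
    have "degree (A - B) \<le> degree A \<or> degree (A - B) \<le> degree B"
      using degree_diff_le_max[of A B] by linarith
    hence AB: "(q + 1) * degree (A - B) + c \<le> q ^ n + d"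
      using A B mult_le_mono2[of "degree (A - B)" _ "q + 1"] by (metis add_le_mono1 le_trans)
    have "two_step u v n = [:inverse (br n):] * (A - B)" unfolding 3 two_step.simps A_def B_def by (rule refl)
    also have "degree \<dots> \<le> degree (A - B)" using degree_mult_le[of "[:inverse (br n):]" "A - B"] by simp
    finally have "(q + 1) * degree (two_step u v n) \<le> (q + 1) * degree (A - B)" by (rule mult_le_mono2)
    thus ?thesis using AB by linarith
  qed (use assms in auto)
qed

lemma al_degree: "(q + 1) * degree (al n) + 1 \<le> q ^ n"
  unfolding al_def using two_step_degree[of 1 1 0 "[:- inverse (br 1):]" n] q2 by simp

lemma be_degree: "(q + 1) * degree (be n) \<le> q ^ n + 1"
proof -
  have "degree [:0, - inverse (br 1):] = 1" using br_nz[of 1] by simp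
  thus ?thesis
    unfolding be_def using two_step_degree[of 0 0 1 "[:0, - inverse (br 1):]" n] by simp
qed

lemma eP_degree: "degree (eP n) \<le> 1" by (simp add: eP_def)

lemma eP_weight: "weight (eP n) \<le> q ^ n + 1"
proof (rule weight_leI)
  fix i assume nz: "coeff (eP n) i \<noteq> 0"
  have "i \<le> 1" using le_degree[OF nz] eP_degree[of n] by linarith
  hence "i = 0 \<or> i = 1" by linarith
  thus "(q + 1) * degree (coeff (eP n) i) + 2 * i \<le> q ^ n + 1"
    using al_degree[of n] be_degree[of n] by (auto simp: eP_def)
qed

text \<open>The second case is meant for s = n + 1, where the series is the power q^n of
  \<open>Ehat 1 0 = - hh\<close>.\<close>

definition EP :: "nat \<Rightarrow> nat \<Rightarrow> 'a ratfun poly poly" where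
  "EP s n = (if s \<le> n then eP (n - s) ^ (q ^ s) else [:- [:0, 1:]:] ^ (q ^ n))"

lemma ev2_minus_eta: "ev2 [:- [:0, 1:]:] = - eta"
  unfolding ev2_const evx.hom_uminus by (simp add: evx_pCons)

lemma ev2_EP:
  assumes "s \<le> n + 1"
  shows "g_root ^ (q ^ n + q ^ s) * ev2 (EP s n) = Ehat s n"
proof (cases "s \<le> n")
  case True
  have "q ^ n + q ^ s = (q ^ (n - s) + 1) * q ^ s"
    using True by (simp add: add_mult_distrib flip: power_add)
  hence "g_root ^ (q ^ n + q ^ s) * ev2 (EP s n) = (g_root ^ (q ^ (n - s) + 1) * ev2 (eP (n - s))) ^ (q ^ s)"
    using True by (simp only: EP_def if_True ev2.hom_power power_mult power_mult_distrib)
  also have "\<dots> = Ehat s n" unfolding ev2_eP using Ehat_power[of 0 "n - s" s] True by simp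
  finally show ?thesis .
next
  case False
  hence s: "s = Suc n" using assms by simp
  have "q ^ n + q ^ s = (q + 1) * q ^ n" by (simp add: s)
  hence "g_root ^ (q ^ n + q ^ s) * ev2 (EP s n) = (g_root ^ (q + 1) * - eta) ^ (q ^ n)"
    using False by (simp only: EP_def if_False ev2.hom_power power_mult power_mult_distrib ev2_minus_eta)
  also have "g_root ^ (q + 1) * - eta = Ehat 1 0" unfolding Ehat_1_0 hh_eta by simp
  also have "Ehat 1 0 ^ (q ^ n) = Ehat s n" using Ehat_power[of 1 0 n] s by simp
  finally show ?thesis .
qed

lemma EP_degree: "degree (EP s n) \<le> q ^ s"
proof (cases "s \<le> n")
  case True
  have "degree (EP s n) \<le> degree (eP (n - s)) * q ^ s"
    using True degree_power_le[of "eP (n - s)" "q ^ s"] by (simp add: EP_def)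
  also have "\<dots> \<le> 1 * q ^ s" by (rule mult_le_mono1[OF eP_degree])
  finally show ?thesis by simp
next
  case False
  thus ?thesis using degree_power_le[of "[:- [:0, 1 :: 'a ratfun:]:]" "q ^ n"] by (simp add: EP_def)
qed

lemma EP_weight: "s \<le> n + 1 \<Longrightarrow> weight (EP s n) \<le> q ^ n + q ^ s"
proof (cases "s \<le> n")
  case True
  have "weight (EP s n) \<le> q ^ s * (q ^ (n - s) + 1)"
    using True weight_power_le[OF eP_weight[of "n - s"], of "q ^ s"] by (simp only: EP_def if_True)
  also have "\<dots> = q ^ n + q ^ s" using True by (simp flip: power_add)
  finally show ?thesis .
next
  case False
  assume "s \<le> n + 1"
  hence s: "s = Suc n" using False by simp
  have "weight [:- [:0, 1:]:] \<le> q + 1" by (rule weight_leI) (auto simp: coeff_pCons split: nat.splits)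
  hence "weight (EP s n) \<le> q ^ n * (q + 1)"
    using False weight_power_le[of "[:- [:0, 1:]:]" "q + 1" "q ^ n"] by (simp only: EP_def if_False)
  thus ?thesis by (simp add: s algebra_simps)
qed

text \<open>The factor \<open>B_poly k\<close> is left in: as a nonzero constant it affects neither
  the order nor the degree nor the weight.\<close>

definition QP :: "nat \<Rightarrow> nat \<Rightarrow> 'a ratfun poly poly" where
  "QP j k = det (mat k k (\<lambda>(a, b). EP a (j + b)))"

lemma ev2_QP:
  assumes "k \<le> j + 2"
  shows "g_root ^ (q_geom k * (q ^ j + 1)) * ev2 (QP j k) = kc (B_poly k) * det (Gmat j k)"
proof -
  have t: "g_root ^ (q_geom k * (q ^ j + 1)) * (\<Prod>a<k. ev2 (EP a (j + r a))) = (\<Prod>a<k. Ehat a (j + r a))"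
    if r: "r permutes {..<k}" for r
  proof -
    have "g_root ^ (q_geom k * (q ^ j + 1)) = (\<Prod>a<k. g_root ^ (q ^ (j + r a) + q ^ a))"
      unfolding perm_weight[OF r, symmetric] by (rule power_sum)
    hence "g_root ^ (q_geom k * (q ^ j + 1)) * (\<Prod>a<k. ev2 (EP a (j + r a))) = (\<Prod>a<k. g_root ^ (q ^ (j + r a) + q ^ a) * ev2 (EP a (j + r a)))"
      by (simp only: prod.distrib)
    also have "\<dots> = (\<Prod>a<k. Ehat a (j + r a))"
      by (intro prod.cong refl ev2_EP) (use assms in auto)
    finally show ?thesis .
  qed
  have "g_root ^ (q_geom k * (q ^ j + 1)) * ev2 (QP j k) =
     (\<Sum>r\<in>{r. r permutes {..<k}}. of_int (sign r) * (g_root ^ (q_geom k * (q ^ j + 1)) * (\<Prod>a<k. ev2 (EP a (j + r a)))))"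
    unfolding QP_def det_expand ev2.hom_sum ev2.hom_mult ev2.hom_prod ev2.hom_of_int sum_distrib_left
    by (simp only: mult.left_commute)
  also have "\<dots> = det (Emat j k)" unfolding Emat_def det_expand
    by (intro sum.cong refl) (use t in simp)
  finally show ?thesis by (simp only: det_Emat)
qed

lemma det_Gmat_nz: "det (Gmat j k) \<noteq> 0" using det_Gmat_normalised[of j k] by (simp add: normalised_def)

lemma QP_order:
  assumes "k \<le> j + 2"
  shows "ev2 (QP j k) \<noteq> 0" "subdegree (ev2 (QP j k)) = subdegree (det (Gmat j k))"
proof -
  have kc: "kc (B_poly k) \<noteq> 0" "subdegree (kc (B_poly k)) = 0" using B_poly_nz[of k] by (simp_all add: kc_def)
  show nz: "ev2 (QP j k) \<noteq> 0" using ev2_QP[OF assms] kc det_Gmat_nz[of j k] by auto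
  have "g_root ^ (q_geom k * (q ^ j + 1)) \<noteq> 0" using g_root_nz by simp
  from subdegree_mult[OF this nz]
  have "subdegree (g_root ^ (q_geom k * (q ^ j + 1)) * ev2 (QP j k)) = subdegree (ev2 (QP j k))"
    by (simp only: g_root_subdegree add_0_left)
  thus "subdegree (ev2 (QP j k)) = subdegree (det (Gmat j k))"
    unfolding ev2_QP[OF assms] using kc det_Gmat_nz[of j k] by simp
qed

lemma det_Gmat_order_q_geom: "(q + 1) * subdegree (det (Gmat j k)) = q ^ j * (q ^ k + 1) * q_geom k"
proof -
  have q_geom: "(q - 1) * q_geom k = q ^ k - 1" unfolding q_geom_def by (rule cf.sum_q_powers)
  have sq: "q\<^sup>2 - 1 = (q - 1) * (q + 1)" by (cases q) (simp_all add: power2_eq_square)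
  have sk: "q ^ (2 * k) - 1 = (q ^ k - 1) * (q ^ k + 1)"
    using q_power_ge_1[of k] by (cases "q ^ k") (simp_all add: power_mult power2_eq_square mult.commute[of 2])
  have "(q\<^sup>2 - 1) * subdegree (det (Gmat j k)) = q ^ j * (q ^ (2 * k) - 1)"
    unfolding conjunct1[OF det_Gmat_order] by (rule order_sum)
  hence "(q - 1) * ((q + 1) * subdegree (det (Gmat j k))) = (q - 1) * (q ^ j * (q ^ k + 1) * q_geom k)"
    unfolding sq sk q_geom[symmetric] by (simp only: mult_ac)
  moreover have "q - 1 \<noteq> 0" using q2 by linarith
  ultimately show ?thesis by (simp only: mult_cancel1 simp_thms)
qed

lemma QP_degree: "degree (QP j k) \<le> q_geom k"
  unfolding QP_def det_expand
proof (rule degree_sum_le)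
  fix r
  have "degree (\<Prod>a<k. EP a (j + r a)) \<le> q_geom k"
    unfolding q_geom_def by (rule conjunct2[OF coeff_prod_top]) (auto intro: EP_degree)
  thus "degree (of_int (sign r) * (\<Prod>a<k. EP a (j + r a))) \<le> q_geom k"
    using degree_mult_le[of "of_int (sign r)" "\<Prod>a<k. EP a (j + r a)"] by simp
qed (rule finite_permutations[OF finite_lessThan])

lemma QP_weight: "k \<le> j + 2 \<Longrightarrow> weight (QP j k) \<le> q_geom k * (q ^ j + 1)"
  unfolding QP_def det_expand
proof (rule weight_sum_le)
  fix r assume k: "k \<le> j + 2" and "r \<in> {r. r permutes {..<k}}"
  hence r: "r permutes {..<k}" by simp
  have "weight (\<Prod>a<k. EP a (j + r a)) \<le> (\<Sum>a<k. q ^ (j + r a) + q ^ a)"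
    by (intro weight_prod_le EP_weight) (use k in auto)
  hence p: "weight (\<Prod>a<k. EP a (j + r a)) \<le> q_geom k * (q ^ j + 1)" unfolding perm_weight[OF r] .
  show "weight (of_int (sign r) * (\<Prod>a<k. EP a (j + r a))) \<le> q_geom k * (q ^ j + 1)"
    using p by (cases r rule: sign_cases) (simp_all add: weight_uminus)
qed

text \<open>
  A nonzero relation of minimal degree is coprime to \<open>QP k k\<close>, whose order outgrows the bound on
  the degree of the resultant.
\<close>

lemma ev2_eq_0: "ev2 P = 0 \<Longrightarrow> P = 0"
proof (induction "degree P" arbitrary: P rule: less_induct)
  case less
  show "P = 0"
  proof (rule ccontr)
    assume nz: "P \<noteq> 0"
    have m: "degree P \<noteq> 0"
    proof
      assume "degree P = 0"
      then obtain r where r: "P = [:r:]" by (rule degree_eq_zeroE)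
      hence "evx r = 0" using less.prems by (simp add: ev2_const)
      thus False using r nz by (simp add: evx_nz_iff)
    qed
    \<comment> \<open>This choice makes q^k larger than \<open>weight P + degree P\<close>, which
      beats the bound on the resultant.\<close>
    define k where "k = weight P + degree P"
    define N where "N = subdegree (det (Gmat k k))"
    have Q: "ev2 (QP k k) \<noteq> 0" "subdegree (ev2 (QP k k)) = N" using QP_order[of k k] by (simp_all add: N_def)
    \<comment> \<open>A common factor divides \<open>QP k k\<close>, so it does not evaluate to 0;
      its cofactor in \<open>P\<close> would then be a relation of smaller degree.\<close>
    have res: "resultant P (QP k k) \<noteq> 0"
    proof
      assume "resultant P (QP k k) = 0"
      then obtain C B D where f: "P = C * B" "QP k k = C * D" "degree C \<noteq> 0" using resultant_0_factor by blast
      have "ev2 C \<noteq> 0" using Q(1) unfolding f(2) ev2.hom_mult by auto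
      hence "ev2 B = 0" using less.prems unfolding f(1) ev2.hom_mult by simp
      moreover have "C \<noteq> 0" "B \<noteq> 0" using nz f(1) by auto
      moreover have "degree P = degree C + degree B" unfolding f(1) using \<open>C \<noteq> 0\<close> \<open>B \<noteq> 0\<close> by (rule degree_mult_eq)
      ultimately show False using less.hyps[of B] f(3) by simp
    qed
    have "(q + 1) * N + 2 * (degree P * degree (QP k k)) \<le> degree (QP k k) * weight P + degree P * (q_geom k * (q ^ k + 1))"
    proof (rule resultant_order[OF res _ order.refl QP_weight])
      show "degree P + degree (QP k k) \<noteq> 0" using m by simp
      show "fps_X ^ N dvd ev2 P" using less.prems by simp
      show "fps_X ^ N dvd ev2 (QP k k)" using Q by (simp add: X_power_dvd)
    qed simp
    hence "q ^ k * (q ^ k + 1) * q_geom k \<le> q_geom k * weight P + degree P * (q_geom k * (q ^ k + 1))"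
      unfolding N_def det_Gmat_order_q_geom using mult_le_mono1[OF QP_degree[of k k], of "weight P"] by linarith
    hence "q_geom k * (q ^ k * (q ^ k + 1)) \<le> q_geom k * (weight P + degree P * (q ^ k + 1))"
      by (simp only: distrib_left mult_ac)
    moreover have "q_geom k > 0"
    proof -
      have "q ^ 0 \<le> q_geom k" unfolding q_geom_def by (rule member_le_sum) (use m in \<open>auto simp: k_def\<close>)
      thus ?thesis by simp
    qed
    ultimately have "q ^ k * (q ^ k + 1) \<le> weight P + degree P * (q ^ k + 1)" by simp
    moreover have "(weight P + degree P + 1) * (q ^ k + 1) \<le> q ^ k * (q ^ k + 1)"
      by (rule mult_le_mono1) (use lt_q_power[of k] in \<open>simp add: k_def\<close>)
    ultimately have "(weight P + degree P + 1) * (q ^ k + 1) \<le> weight P + degree P * (q ^ k + 1)" by (rule le_trans[rotated])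
    hence "weight P * (q ^ k + 1) + (q ^ k + 1) \<le> weight P" unfolding add_mult_distrib mult_1 by linarith
    moreover have "weight P * 1 \<le> weight P * (q ^ k + 1)" by (rule mult_le_mono2) simp
    ultimately show False by linarith
  qed
qed

lemma ev2_inj: "ev2 P = ev2 Q \<Longrightarrow> P = Q"
  using ev2_eq_0[of "P - Q"] by (simp add: ev2.hom_minus)

subsection \<open>The depth\<close>

text \<open>At \<eta> = 0 the summand with the power of \<eta> drops out, and the two-term recursion
  that remains has an explicit solution.\<close>

lemma al_0_rec: "poly (al (Suc n)) 0 * - br (Suc n) = poly (al n) 0"
proof (cases n)
  case (Suc m)
  have "poly (monom (1 :: 'a ratfun) ((q - 1) * q ^ m)) 0 = 0" using q2 by (simp add: poly_monom)
  thus ?thesis unfolding Suc al_simps(3) using br_nz[of "Suc (Suc m)"] by simp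
qed (use br_nz[of 1] in simp)

lemma al_at_0: "poly (al n) 0 * to_fract (\<Prod>i\<in>{1..n}. theta - theta ^ (q ^ i)) = 1"
proof -
  have br: "to_fract (theta - theta ^ (q ^ i)) = - br i" for i unfolding br_def by (simp flip: kap_def to_fract_hom.hom_uminus)
  show ?thesis
  proof (induction n)
    case (Suc n)
    have "(\<Prod>i\<in>{1..Suc n}. (theta :: 'a poly) - theta ^ (q ^ i)) = (theta - theta ^ (q ^ Suc n)) * (\<Prod>i\<in>{1..n}. theta - theta ^ (q ^ i))"
      by (simp add: mult.commute)
    thus ?case using Suc al_0_rec[of n] by (simp only: to_fract_mult br mult.assoc[symmetric])
  qed simp
qed

text \<open>
  At \<open>\<eta> = 0\<close> the identity permutation alone contributes a term of smallest \<open>\<theta>\<close>-adic valuation.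
\<close>

lemma QP_top:
  assumes jk: "k \<le> j"
  shows "coeff (QP j k) (q_geom k) \<noteq> 0"
proof
  assume z: "coeff (QP j k) (q_geom k) = 0"
  define c where "c n = poly (al n) 0" for n
  \<comment> \<open>The value \<open>c n\<close> multiplied by the common denominator
    \<open>M\<close>; its \<theta>-adic valuation is j + k - n.\<close>
  define Dn where "Dn n = (\<Prod>i\<in>{Suc n..j + k}. (theta :: 'a poly) - theta ^ (q ^ i))" for n
  define M where "M = (\<Prod>i\<in>{1..j + k}. (theta :: 'a poly) - theta ^ (q ^ i))"
  define U where "U n = (\<Prod>i\<in>{Suc n..j + k}. 1 - (theta :: 'a poly) ^ (q ^ i - 1))" for n
  have cD: "c n * to_fract M = to_fract (Dn n)" if "n \<le> j + k" for n
  proof -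
    have "M = (\<Prod>i\<in>{1..n}. (theta :: 'a poly) - theta ^ (q ^ i)) * Dn n"
      unfolding M_def Dn_def by (subst prod.union_disjoint[symmetric]) (use that in \<open>auto intro!: prod.cong\<close>)
    thus ?thesis using al_at_0[of n] by (simp only: to_fract_mult c_def mult.assoc[symmetric] mult_1_left)
  qed
  have DU: "Dn n = theta ^ (j + k - n) * U n" for n
  proof -
    have "(theta :: 'a poly) - theta ^ (q ^ i) = theta * (1 - theta ^ (q ^ i - 1))" for i
    proof -
      have "theta * (theta :: 'a poly) ^ (q ^ i - 1) = theta ^ (q ^ i)"
        using q_power_ge_1[of i] by (simp flip: power_Suc)
      thus ?thesis by (simp add: right_diff_distrib)
    qed
    thus ?thesis unfolding Dn_def U_def by (simp only: prod.distrib) simp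
  qed
  have U0: "poly (U n) 0 = 1" for n
  proof -
    have "poly (1 - (theta :: 'a poly) ^ (q ^ i - 1)) 0 = 1" if "i \<ge> Suc n" for i
      using lt_q_power[of i] that by (simp add: theta_def)
    thus ?thesis unfolding U_def poly_prod by (intro prod.neutral) auto
  qed
  let ?P = "{r. r permutes {..<k}}"
  have lt: "r a < k" if "r permutes {..<k}" "a < k" for r a
    using permutes_in_image[OF that(1), of a] that(2) by simp
  \<comment> \<open>Since k \<le> j, every index satisfies a \<le> j + r a. So each entry is a
    q^a-th power of some \<open>eP\<close>, and its coefficient at \<epsilon>^(q^a) is the same
    power of \<open>al\<close>.\<close>
  have top: "coeff (\<Prod>a<k. EP a (j + r a)) (q_geom k) = (\<Prod>a<k. al (j + r a - a) ^ (q ^ a))" for r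
  proof -
    have "coeff (EP a (j + r a)) (q ^ a) = al (j + r a - a) ^ (q ^ a)" if "a < k" for a
    proof -
      have "coeff (\<Prod>i<q ^ a. eP (j + r a - a)) (\<Sum>i<q ^ a. 1) = (\<Prod>i<q ^ a. coeff (eP (j + r a - a)) 1)"
        by (rule conjunct1[OF coeff_prod_top]) (auto intro: eP_degree[unfolded One_nat_def])
      thus ?thesis using that jk by (simp add: EP_def eP_def)
    qed
    thus ?thesis unfolding q_geom_def by (subst conjunct1[OF coeff_prod_top]) (auto intro: EP_degree)
  qed
  have "coeff (of_int (sign r) * f) n = of_int (sign r) * coeff f n" for r :: "nat \<Rightarrow> nat" and f :: "'a ratfun poly poly" and n
    by (cases r rule: sign_cases) simp_all
  hence "(\<Sum>r\<in>?P. of_int (sign r) * (\<Prod>a<k. al (j + r a - a) ^ (q ^ a))) = 0"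
    using z unfolding QP_def det_expand coeff_sum by (simp only: top)
  hence "poly (\<Sum>r\<in>?P. of_int (sign r) * (\<Prod>a<k. al (j + r a - a) ^ (q ^ a))) 0 = 0" by simp
  hence "(\<Sum>r\<in>?P. of_int (sign r) * (\<Prod>a<k. c (j + r a - a) ^ (q ^ a))) = 0"
    by (simp add: poly_sum poly_prod c_def)
  hence "(\<Sum>r\<in>?P. of_int (sign r) * (\<Prod>a<k. c (j + r a - a) ^ (q ^ a))) * (\<Prod>a<k. to_fract M ^ (q ^ a)) = 0" by simp
  moreover have "(\<Sum>r\<in>?P. of_int (sign r) * (\<Prod>a<k. c (j + r a - a) ^ (q ^ a))) * (\<Prod>a<k. to_fract M ^ (q ^ a)) =
     to_fract (\<Sum>r\<in>?P. of_int (sign r) * (\<Prod>a<k. Dn (j + r a - a) ^ (q ^ a)))"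
    unfolding kap.hom_sum to_fract_hom.hom_sum sum_distrib_right
  proof (intro sum.cong refl)
    fix r assume "r \<in> ?P"
    hence r: "r permutes {..<k}" by simp
    have "(\<Prod>a<k. c (j + r a - a) ^ (q ^ a)) * (\<Prod>a<k. to_fract M ^ (q ^ a)) = (\<Prod>a<k. (c (j + r a - a) * to_fract M) ^ (q ^ a))"
      by (simp only: prod.distrib power_mult_distrib)
    also have "\<dots> = (\<Prod>a<k. to_fract (Dn (j + r a - a)) ^ (q ^ a))"
      by (intro prod.cong refl arg_cong2[where f = "(^)"] cD) (use lt[OF r] in fastforce)
    finally show "of_int (sign r) * (\<Prod>a<k. c (j + r a - a) ^ (q ^ a)) * (\<Prod>a<k. to_fract M ^ (q ^ a)) =
        to_fract (of_int (sign r) * (\<Prod>a<k. Dn (j + r a - a) ^ (q ^ a)))"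
      by (simp only: to_fract_hom.hom_mult to_fract_hom.hom_prod to_fract_hom.hom_power to_fract_hom.hom_of_int mult.assoc)
  qed
  ultimately have "to_fract (\<Sum>r\<in>?P. of_int (sign r) * (\<Prod>a<k. Dn (j + r a - a) ^ (q ^ a))) = 0" by (simp only:)
  hence S0: "(\<Sum>r\<in>?P. of_int (sign r) * (\<Prod>a<k. Dn (j + r a - a) ^ (q ^ a))) = 0" by (simp only: to_fract_eq_0_iff)
  define m where "m = (\<Sum>a<k. k * q ^ a)"
  have "coeff (of_int (sign r) * (\<Prod>a<k. Dn (j + r a - a) ^ (q ^ a))) m = (if r = id then 1 else 0)" if "r \<in> ?P" for r
  proof -
    have r: "r permutes {..<k}" using that by simp
    define e' where "e' = (\<Sum>a<k. (k + a - r a) * q ^ a)"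
    define V where "V = (\<Prod>a<k. U (j + r a - a) ^ (q ^ a))"
    have V0: "coeff V 0 = 1" unfolding poly_0_coeff_0[symmetric] V_def by (simp add: poly_prod U0)
    have "(\<Prod>a<k. Dn (j + r a - a) ^ (q ^ a)) = (\<Prod>a<k. theta ^ ((k + a - r a) * q ^ a) * U (j + r a - a) ^ (q ^ a))"
    proof (intro prod.cong refl)
      fix a assume "a \<in> {..<k}"
      hence "j + k - (j + r a - a) = k + a - r a" using lt[OF r, of a] jk by simp
      thus "Dn (j + r a - a) ^ (q ^ a) = theta ^ ((k + a - r a) * q ^ a) * U (j + r a - a) ^ (q ^ a)"
        by (simp only: DU power_mult_distrib power_mult)
    qed
    also have "\<dots> = monom 1 e' * V" unfolding e'_def V_def theta_monom[symmetric] prod.distrib power_sum by (rule refl)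
    finally have eq: "(\<Prod>a<k. Dn (j + r a - a) ^ (q ^ a)) = monom 1 e' * V" .
    show ?thesis
    proof (cases "r = id")
      case True
      have "e' = m" unfolding e'_def m_def True by simp
      thus ?thesis unfolding eq using V0 True by (simp add: coeff_monom_mult)
    next
      case False
      \<comment> \<open>The valuation of a term falls as the sum of q^a r(a) grows, and by
        rearrangement that sum is largest for the identity alone.\<close>
      have "(\<Sum>a<k. int (q ^ a) * int (r a)) < (\<Sum>a<k. int (q ^ a) * int a)"
        by (rule rearrangement(2)[OF _ _ r False]) (use q2 in \<open>auto intro: power_strict_increasing\<close>)
      hence "(\<Sum>a<k. q ^ a * r a) < (\<Sum>a<k. q ^ a * a)" by (simp only: of_nat_mult[symmetric] of_nat_sum[symmetric] of_nat_less_iff)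
      moreover have "e' + (\<Sum>a<k. q ^ a * r a) = m + (\<Sum>a<k. q ^ a * a)"
        unfolding e'_def m_def sum.distrib[symmetric]
      proof (intro sum.cong refl)
        fix a assume "a \<in> {..<k}"
        hence "(k + a - r a) + r a = k + a" using lt[OF r, of a] by simp
        hence "((k + a - r a) + r a) * q ^ a = (k + a) * q ^ a" by (rule arg_cong)
        thus "(k + a - r a) * q ^ a + q ^ a * r a = k * q ^ a + q ^ a * a" by (simp only: add_mult_distrib mult.commute[of "q ^ a"])
      qed
      ultimately have "m < e'" by linarith
      hence "coeff (monom 1 e' * V) m = 0" by (simp add: coeff_monom_mult)
      thus ?thesis unfolding eq using False by (cases r rule: sign_cases) simp_all
    qed
  qed
  hence "(\<Sum>r\<in>?P. coeff (of_int (sign r) * (\<Prod>a<k. Dn (j + r a - a) ^ (q ^ a))) m) = (\<Sum>r\<in>?P. if r = id then 1 else 0)"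
    by (rule sum.cong[OF refl])
  also have "\<dots> = 1" unfolding sum.delta[OF finite_permutations[OF finite_lessThan]] by (simp add: permutes_id)
  finally show False using S0 unfolding coeff_sum[symmetric] by simp
qed

lemma le_q_geom: "k \<le> q_geom k"
proof -
  have "(\<Sum>a<k. 1) \<le> (\<Sum>a<k. q ^ a)" by (rule sum_mono) simp
  thus ?thesis by (simp add: q_geom_def)
qed

text \<open>As \<open>ev2\<close> is injective, the polynomial that represents a form is unique, and
  the one of the determinant has degree exactly \<open>q_geom k\<close>.\<close>

lemma det_Gmat_depth:
  assumes "k \<le> j" "l < q_geom k"
  shows "det (Gmat j k) \<notin> QM l (int (q_geom k * (q ^ j + 1))) m"
proof
  assume "det (Gmat j k) \<in> QM l (int (q_geom k * (q ^ j + 1))) m"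
  then obtain P where P: "det (Gmat j k) = g_root ^ (q_geom k * (q ^ j + 1)) * ev2 P" "degree P \<le> l"
    using QM_repr by blast
  define b where "b = to_fract (B_poly k :: 'a poly)"
  have "g_root ^ (q_geom k * (q ^ j + 1)) * ev2 (QP j k) = g_root ^ (q_geom k * (q ^ j + 1)) * ev2 ([:[:b:]:] * P)"
    using ev2_QP[of k j] assms(1) unfolding P(1) ev2.hom_mult ev2_const evx_const b_def kc_def
    by (simp only: mult.left_commute)
  hence "ev2 (QP j k) = ev2 ([:[:b:]:] * P)" using g_root_nz by simp
  hence "QP j k = [:[:b:]:] * P" by (rule ev2_inj)
  hence "degree (QP j k) \<le> l" using P(2) degree_mult_le[of "[:[:b:]:]" P] by simp
  hence "coeff (QP j k) (q_geom k) = 0" using assms(2) by (intro coeff_eq_0) simp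
  thus False using QP_top[OF assms(1)] by simp
qed

subsection \<open>Extremality\<close>

lemma frob_q:
  fixes x y :: "'b::comm_ring_1"
  assumes "CHAR('b) = p"
  shows "(x + y) ^ q = x ^ q + y ^ q" "(- x) ^ q = - (x ^ q)" "(x - y) ^ q = x ^ q - y ^ q"
  using frob_gen[OF assms, of x y 1] frob_gen_minus[OF assms, of x 1] frob_gen_diff[OF assms, of x y 1]
  by simp_all

lemma CHAR_Kx: "CHAR('a ratfun poly) = p" by (simp add: CHAR_K)
lemma CHAR_Kxy: "CHAR('a ratfun poly poly) = p" by (simp add: CHAR_K)

lemma dvd_monom_const:
  fixes d :: "'a ratfun poly"
  assumes "poly d 0 \<noteq> 0" "d dvd monom c N" "c \<noteq> 0"
  shows "degree d = 0"
  using assms(2)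
proof (induction N)
  case 0
  hence "d dvd [:c:]" by (simp add: monom_0)
  thus ?case using dvd_imp_degree_le[of d "[:c:]"] assms(3) by simp
next
  case (Suc N)
  then obtain r where r: "monom c (Suc N) = d * r" by (elim dvdE)
  have "poly (d * r) 0 = 0" unfolding r[symmetric] by (simp add: poly_monom)
  hence "poly r 0 = 0" using assms(1) by simp
  then obtain s where s: "r = pCons 0 s" by (cases r) auto
  have "pCons 0 (monom c N) = pCons 0 (d * s)" using r unfolding s monom_Suc by simp
  hence "d dvd monom c N" by simp
  thus ?case by (rule Suc.IH)
qed

section \<open>The Wronskian of the recursion and coprimality of consecutive forms\<close>

definition wronskian :: "nat \<Rightarrow> 'a ratfun poly" where
  "wronskian n = al n * be (Suc n) - al (Suc n) * be n"

text \<open>Each step of the recursion multiplies the Wronskian by a nonzero scalar and a power of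
  \<eta>. Hence a common divisor of \<open>al n\<close> and \<open>be n\<close> that does not vanish
  at \<eta> = 0 is constant.\<close>

lemma wronskian_monom: "\<exists>c. c \<noteq> 0 \<and> wronskian n = monom c (q ^ n)"
proof (induction n)
  case 0
  have "wronskian 0 = monom (- inverse (br 1)) 1" by (simp add: wronskian_def monom_Suc monom_0)
  moreover have "- inverse (br 1) \<noteq> 0" using br_nz[of 1] by simp
  ultimately show ?case by (metis power_0)
next
  case (Suc n)
  then obtain c where c: "c \<noteq> 0" "wronskian n = monom c (q ^ n)" by blast
  define b where "b = inverse (br (Suc (Suc n)))"
  define x where "x = monom (1 :: 'a ratfun) ((q - 1) * q ^ n)"
  have "wronskian (Suc n) = al (Suc n) * ([:b:] * (x * be n - be (Suc n))) - ([:b:] * (x * al n - al (Suc n))) * be (Suc n)"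
    unfolding wronskian_def al_simps(3) be_simps(3) b_def x_def by (rule refl)
  also have "\<dots> = - ([:b:] * (x * wronskian n))"
  proof -
    have "A * (B * (x * c' - D)) - (B * (x * a' - A)) * D = - (B * (x * (a' * D - A * c')))" for A B D a' c' :: "'a ratfun poly"
      by (simp add: algebra_simps)
    thus ?thesis unfolding wronskian_def .
  qed
  also have "\<dots> = monom (- (b * c)) ((q - 1) * q ^ n + q ^ n)"
    unfolding c(2) x_def by (simp add: mult_monom smult_monom minus_monom)
  also have "(q - 1) * q ^ n + q ^ n = q ^ Suc n" using q2 by (cases q) simp_all
  finally have "wronskian (Suc n) = monom (- (b * c)) (q ^ Suc n)" .
  moreover have "- (b * c) \<noteq> 0" using c(1) br_nz[of "Suc (Suc n)"] by (simp add: b_def)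
  ultimately show ?case by blast
qed

lemma wronskian_nz: "wronskian n \<noteq> 0" using wronskian_monom[of n] by (metis monom_eq_0_iff)

lemma wronskian_eP: "[:al n:] * eP (Suc n) - [:al (Suc n):] * eP n = [:wronskian n:]"
  by (simp add: eP_def wronskian_def mult.commute)

lemma wronskian_power: "\<exists>c N. c \<noteq> 0 \<and> wronskian n ^ i = monom c N"
proof -
  obtain c where "c \<noteq> 0" "wronskian n = monom c (q ^ n)" using wronskian_monom by blast
  hence "c ^ i \<noteq> 0" "wronskian n ^ i = monom (c ^ i) (q ^ n * i)" by (simp_all add: monom_power)
  thus ?thesis by blast
qed

text \<open>A combination of the two consecutive forms is the Wronskian, which is free of
  \<epsilon>. Modulo \<open>C\<close> the multiple \<open>v\<close> of \<open>eP n\<close> is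
  therefore minus the Wronskian, and if a power of it vanishes then \<open>C\<close> divides a power
  of the Wronskian.\<close>

lemma consecutive_coprime:
  assumes "C dvd eP (Suc n)" "C dvd eP n ^ N"
  shows "degree C = 0"
proof -
  define u where "u = [:al n:] * eP (Suc n)"
  define v where "v = [:al (Suc n):] * eP n"
  have uv: "v - (- [:wronskian n:]) = u" unfolding wronskian_eP[of n, symmetric] u_def v_def by simp
  have "C dvd v ^ N" unfolding v_def power_mult_distrib using assms(2) by (rule dvd_mult)
  moreover have "C dvd v ^ N - (- [:wronskian n:]) ^ N"
    unfolding power_diff_sumr2 uv by (rule dvd_mult2) (simp only: u_def dvd_mult[OF assms(1)])
  ultimately have "C dvd v ^ N - (v ^ N - (- [:wronskian n:]) ^ N)" by (rule dvd_diff)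
  hence "C dvd (- [:wronskian n:]) ^ N" by simp
  moreover have "(- [:wronskian n:]) ^ N \<noteq> 0" using wronskian_nz[of n] by simp
  ultimately have "degree C \<le> degree ((- [:wronskian n:]) ^ N)" by (rule dvd_imp_degree_le)
  also have "\<dots> \<le> degree (- [:wronskian n:]) * N" by (rule degree_power_le)
  finally show ?thesis by simp
qed

text \<open>A nonzero resultant of P with \<open>QP j k\<close> would violate its bound, by
  \<open>big\<close>. A common factor must be \<open>QP j k\<close> up to a scalar, by
  \<open>factors\<close> and \<open>primitive\<close>. As \<open>QP j k\<close> has the full weight
  by \<open>exact\<close>, no weight or degree is left for the cofactor in P, so P is a scalar
  multiple of \<open>QP j k\<close> and has the same order.\<close>

lemma extremal_bound:
  assumes k: "1 \<le> k" "k \<le> j + 2" and big: "2 * q_geom k \<le> q ^ k"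
    and top: "coeff (QP j k) (q_geom k) \<noteq> 0"
    and exact: "q_geom k * (q ^ j + 1) \<le> weight (QP j k)"
    and primitive: "\<And>C d. QP j k = C * [:d:] \<Longrightarrow> degree d = 0"
    and factors: "\<And>C D. QP j k = C * D \<Longrightarrow> degree C \<noteq> 0 \<Longrightarrow> degree D \<noteq> 0 \<Longrightarrow> False"
    and P: "P \<noteq> 0" "degree P \<le> q_geom k" "weight P \<le> q_geom k * (q ^ j + 1)"
  shows "subdegree (ev2 P) \<le> subdegree (det (Gmat j k))"
proof (rule ccontr)
  assume gt: "\<not> ?thesis"
  define N where "N = subdegree (det (Gmat j k))"
  define Q where "Q = QP j k"
  have Q: "ev2 Q \<noteq> 0" "subdegree (ev2 Q) = N" using QP_order[OF k(2)] by (simp_all add: N_def Q_def)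
  have degQ: "degree Q = q_geom k"
    using QP_degree[of j k] le_degree[OF top] by (simp add: Q_def)
  have dpos: "q_geom k > 0" using le_q_geom[of k] k(1) by linarith
  have evP: "ev2 P \<noteq> 0" using P(1) ev2_eq_0 by blast
  have "resultant P Q = 0"
  proof (rule ccontr)
    assume res: "resultant P Q \<noteq> 0"
    have "(q + 1) * N + 2 * (degree P * degree Q) \<le> degree Q * (q_geom k * (q ^ j + 1)) + degree P * (q_geom k * (q ^ j + 1))"
    proof (rule resultant_order[OF res _ P(3)])
      show "degree P + degree Q \<noteq> 0" using degQ dpos by simp
      show "weight Q \<le> q_geom k * (q ^ j + 1)" unfolding Q_def by (rule QP_weight[OF k(2)])
      show "fps_X ^ N dvd ev2 P" using gt evP by (simp add: X_power_dvd N_def)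
      show "fps_X ^ N dvd ev2 Q" using Q by (simp add: X_power_dvd)
    qed
    hence "q_geom k * (q ^ j * (q ^ k + 1) + 2 * degree P) \<le> q_geom k * ((q_geom k + degree P) * (q ^ j + 1))"
      unfolding N_def det_Gmat_order_q_geom degQ by (simp only: algebra_simps)
    hence *: "q ^ j * (q ^ k + 1) + 2 * degree P \<le> (q_geom k + degree P) * (q ^ j + 1)" using dpos by simp
    \<comment> \<open>With the gap t between \<open>q_geom k\<close> and \<open>degree P\<close>,
      the inequality reduces to q^j t + q^j \<le> t.\<close>
    obtain t where t: "q_geom k = degree P + t" using P(2) le_Suc_ex by blast
    have t2: "q_geom k + degree P = 2 * degree P + t" using t by simp
    have "q ^ j * (2 * (degree P + t) + 1) \<le> q ^ j * (q ^ k + 1)" using big t by (intro mult_le_mono2) simp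
    hence "q ^ j * (2 * (degree P + t) + 1) + 2 * degree P \<le> (2 * degree P + t) * (q ^ j + 1)"
      using *[unfolded t2] by linarith
    hence "q ^ j * t + q ^ j \<le> t" by (simp add: algebra_simps)
    moreover have "1 * t \<le> q ^ j * t" by (rule mult_le_mono1) simp
    ultimately show False using q_power_ge_1[of j] by linarith
  qed
  then obtain C B D where f: "P = C * B" "Q = C * D" "degree C \<noteq> 0" using resultant_0_factor by blast
  have nz: "C \<noteq> 0" "B \<noteq> 0" "D \<noteq> 0" using P(1) Q(1) f by auto
  have "degree D = 0" using factors f(2,3) unfolding Q_def by blast
  then obtain d where d: "D = [:d:]" by (rule degree_eq_zeroE)
  have "degree d = 0" using primitive f(2) unfolding Q_def d by blast
  then obtain d0 where d0: "d = [:d0:]" by (rule degree_eq_zeroE)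
  have d0nz: "d0 \<noteq> 0" using nz(3) d d0 by auto
  have "degree Q = degree C" unfolding f(2) d by (subst degree_mult_eq) (use nz d in auto)
  hence "degree B = 0" using P(2) degQ degree_mult_eq[OF nz(1,2)] unfolding f(1) by simp
  then obtain b where b: "B = [:b:]" by (rule degree_eq_zeroE)
  have bnz: "b \<noteq> 0" using nz(2) b by auto
  have WTc: "weight [:r:] \<le> w \<longleftrightarrow> (q + 1) * degree r \<le> w" for r w
  proof
    assume "weight [:r:] \<le> w"
    thus "(q + 1) * degree r \<le> w" using weight_coeff[of "[:r:]" 0] by (cases "r = 0") auto
  next
    assume "(q + 1) * degree r \<le> w"
    thus "weight [:r:] \<le> w" by (intro weight_leI) (auto simp: coeff_pCons split: nat.splits)
  qed
  have "weight D = 0" unfolding d using WTc[of d 0] d0 by simp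
  hence "weight Q = weight C" unfolding f(2) weight_mult[OF nz(1,3)] by simp
  moreover have "weight P = weight C + weight B" unfolding f(1) by (rule weight_mult[OF nz(1,2)])
  ultimately have "weight [:b:] \<le> 0" using exact P(3) b by (simp add: Q_def)
  hence "degree b = 0" using WTc[of b 0] by simp
  then obtain b0 where b0: "b = [:b0:]" by (rule degree_eq_zeroE)
  have b0nz: "b0 \<noteq> 0" using bnz b0 by auto
  have "ev2 C \<noteq> 0" using Q(1) unfolding f(2) ev2.hom_mult by auto
  hence "subdegree (ev2 P) = subdegree (ev2 C)" "subdegree (ev2 Q) = subdegree (ev2 C)"
    unfolding f d d0 b b0 ev2.hom_mult ev2_const evx_const using d0nz b0nz by simp_all
  thus False using gt Q(2) by (simp add: N_def)
qed

text \<open>If the degree bound is attained at n, the summand with the monomial attains it at n + 2,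
  while the other summand stays within the bound for n + 1; nothing can cancel the leading
  term.\<close>

lemma two_step_top:
  assumes u: "(q + 1) * degree u + c \<le> 1 + d" and v: "(q + 1) * degree v + c \<le> q + d"
    and n: "two_step u v n \<noteq> 0" "(q + 1) * degree (two_step u v n) + c = q ^ n + d"
  shows "two_step u v (Suc (Suc n)) \<noteq> 0 \<and> (q + 1) * degree (two_step u v (Suc (Suc n))) + c = q ^ Suc (Suc n) + d"
proof -
  define A B where "A = monom 1 ((q - 1) * q ^ n) * two_step u v n" and "B = two_step u v (Suc n)"
  have "degree A = (q - 1) * q ^ n + degree (two_step u v n)"
    unfolding A_def by (subst degree_mult_eq) (use n(1) in \<open>simp_all add: degree_monom_eq\<close>)
  hence A: "(q + 1) * degree A + c = q ^ Suc (Suc n) + d"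
    using n(2) weight_step(1)[of n] by (simp only: distrib_left)
  have "(q + 1) * degree B + c \<le> q ^ Suc n + d" unfolding B_def by (rule two_step_degree[OF u v])
  moreover have "q ^ Suc n < q ^ Suc (Suc n)" using q2 by (intro power_strict_increasing) auto
  ultimately have "(q + 1) * degree B < (q + 1) * degree A" using A by linarith
  hence lt: "degree B < degree A" by (simp only: mult_less_cancel1)
  hence AB: "degree (A - B) = degree A" using degree_add_eq_left[of "- B" A] by simp
  hence "A - B \<noteq> 0" using lt by auto
  have eq: "two_step u v (Suc (Suc n)) = [:inverse (br (Suc (Suc n))):] * (A - B)"
    unfolding two_step.simps A_def B_def by (rule refl)
  have i: "inverse (br (Suc (Suc n))) \<noteq> 0" using br_nz[of "Suc (Suc n)"] by simp
  hence "degree (two_step u v (Suc (Suc n))) = degree A"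
    unfolding eq using AB by simp
  thus ?thesis using A \<open>A - B \<noteq> 0\<close> i unfolding eq by simp
qed

lemma al_even: "even n \<Longrightarrow> al n \<noteq> 0 \<and> (q + 1) * degree (al n) + 1 = q ^ n"
proof -
  have "al (2 * m) \<noteq> 0 \<and> (q + 1) * degree (al (2 * m)) + 1 = q ^ (2 * m) + 0" for m
  proof (induction m)
    case (Suc m)
    have 2: "2 * Suc m = Suc (Suc (2 * m))" by simp
    have IH: "al (2 * m) \<noteq> 0" "(q + 1) * degree (al (2 * m)) + 1 = q ^ (2 * m) + 0" using Suc by blast+
    have u: "(q + 1) * degree (1 :: 'a ratfun poly) + 1 \<le> 1 + 0" "(q + 1) * degree [:- inverse (br 1):] + 1 \<le> q + 0"
      using q2 by simp_all
    show ?case unfolding 2 al_def by (rule two_step_top[OF u IH[unfolded al_def]])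
  qed simp
  thus "even n \<Longrightarrow> ?thesis" by (auto elim!: evenE)
qed

lemma be_odd: "odd n \<Longrightarrow> be n \<noteq> 0 \<and> (q + 1) * degree (be n) = q ^ n + 1"
proof -
  have d: "degree [:0, - inverse (br 1):] = 1" using br_nz[of 1] by simp
  have "be (Suc (2 * m)) \<noteq> 0 \<and> (q + 1) * degree (be (Suc (2 * m))) + 0 = q ^ Suc (2 * m) + 1" for m
  proof (induction m)
    case 0
    show ?case using br_nz[of 1] by simp
  next
    case (Suc m)
    have 2: "Suc (2 * Suc m) = Suc (Suc (Suc (2 * m)))" by simp
    have IH: "be (Suc (2 * m)) \<noteq> 0" "(q + 1) * degree (be (Suc (2 * m))) + 0 = q ^ Suc (2 * m) + 1" using Suc by blast+
    have u: "(q + 1) * degree (0 :: 'a ratfun poly) + 0 \<le> 1 + 1" "(q + 1) * degree [:0, - inverse (br 1):] + 0 \<le> q + 1"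
      unfolding d by simp_all
    show ?case unfolding 2 be_def by (rule two_step_top[OF u IH[unfolded be_def]])
  qed
  thus "odd n \<Longrightarrow> ?thesis" by (auto elim!: oddE)
qed

text \<open>For odd n the number q + 1 divides q^n + 1, so equality in \<open>al_degree\<close>
  would make it divide 2.\<close>

lemma al_odd: "odd n \<Longrightarrow> (q + 1) * degree (al n) + 1 < q ^ n"
proof (rule ccontr)
  assume "odd n" and "\<not> (q + 1) * degree (al n) + 1 < q ^ n"
  hence "(q + 1) * degree (al n) + 1 = q ^ n" using al_degree[of n] by linarith
  moreover obtain i where "n = 2 * i + 1" using \<open>odd n\<close> by (rule oddE)
  ultimately have "(q + 1) * \<rho> i = (q + 1) * degree (al n) + 2" using \<rho>_eq[of i] by simp
  hence "(q + 1) dvd (q + 1) * degree (al n) + 2" by (metis dvd_triv_left)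
  from dvd_diff_nat[OF this dvd_triv_left[of "q + 1" "degree (al n)"]] have "(q + 1) dvd 2" by (simp only: add_diff_cancel_left')
  hence "q + 1 \<le> 2" by (rule dvd_imp_le) simp
  thus False using q2 by linarith
qed

lemma al_0_nz: "poly (al n) 0 \<noteq> 0"
  using al_at_0[of n] by auto

lemma al_nz: "al n \<noteq> 0" using al_0_nz[of n] by auto

lemma QP_1: "QP j 1 = eP j"
proof -
  have "QP j 1 = (\<Sum>r\<in>{r. r permutes {..<1 :: nat}}. of_int (sign r) * (\<Prod>a<1. EP a (j + r a)))"
    unfolding QP_def by (rule det_expand)
  also have "{r. r permutes {..<1 :: nat}} = {id}" by (auto simp: lessThan_Suc)
  finally show ?thesis by (simp add: EP_def)
qed

lemma q_geom_1: "q_geom 1 = 1" and q_geom_2: "q_geom 2 = q + 1"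
  by (simp_all add: q_geom_def numeral_2_eq_2)

text \<open>The full weight q^j + 1 is attained by the coefficient \<open>al j\<close> for even j
  and by \<open>be j\<close> for odd j. The two have no common divisor, because it would divide the
  Wronskian, a monomial, while \<open>al j\<close> does not vanish at \<eta> = 0.\<close>

lemma extremal_bound_1:
  assumes "P \<noteq> 0" "degree P \<le> q_geom 1" "weight P \<le> q_geom 1 * (q ^ j + 1)"
  shows "subdegree (ev2 P) \<le> subdegree (det (Gmat j 1))"
proof (rule extremal_bound[OF _ _ _ _ _ _ _ assms])
  show "2 * q_geom 1 \<le> q ^ 1" unfolding q_geom_1 using q2 by simp
  show "coeff (QP j 1) (q_geom 1) \<noteq> 0" unfolding QP_1 q_geom_1 using al_nz by (simp add: eP_def)
  show "q_geom 1 * (q ^ j + 1) \<le> weight (QP j 1)"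
  proof (cases "even j")
    case True
    thus ?thesis unfolding QP_1 q_geom_1 using al_even[of j] weight_coeff[of "eP j" 1] by (simp add: eP_def)
  next
    case False
    thus ?thesis unfolding QP_1 q_geom_1 using be_odd[of j] weight_coeff[of "eP j" 0] by (simp add: eP_def)
  qed
next
  fix C d assume eq: "QP j 1 = C * [:d:]"
  have "[:d:] dvd QP j 1" unfolding eq by (rule dvd_triv_right)
  hence dv: "d dvd coeff (eP j) i" for i unfolding QP_1 by (simp only: const_poly_dvd_iff)
  have da: "d dvd al j" "d dvd be j" using dv[of 1] dv[of 0] by (simp_all add: eP_def)
  obtain r where "al j = d * r" using da(1) by (elim dvdE)
  hence "poly d 0 \<noteq> 0" using al_0_nz[of j] by auto
  moreover obtain c where "c \<noteq> 0" "wronskian j = monom c (q ^ j)" using wronskian_monom by blast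
  moreover have "d dvd wronskian j" unfolding wronskian_def by (intro dvd_diff dvd_mult dvd_mult2 da)
  ultimately show "degree d = 0" using dvd_monom_const by metis
next
  fix C D assume eq: "QP j 1 = C * D" and deg: "degree C \<noteq> 0" "degree D \<noteq> 0"
  have "eP j \<noteq> 0" using al_nz[of j] by (simp add: eP_def)
  hence "C \<noteq> 0" "D \<noteq> 0" using eq unfolding QP_1 by auto
  hence "degree (eP j) = degree C + degree D" using eq degree_mult_eq unfolding QP_1 by metis
  thus False using deg eP_degree[of j] by linarith
qed simp_all

subsection \<open>Extremality for determinants of size two\<close>

text \<open>Together with \<open>be_prev\<close>, the coefficients of the q-th power of
  \<open>eP (j - 1)\<close>; at j = 0 that power is replaced by -\<eta>, in accordance with
  E_(-1,1)^q = -h.\<close>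

definition al_prev :: "nat \<Rightarrow> 'a ratfun poly" where "al_prev j = (if j = 0 then 0 else al (j - 1) ^ q)"
definition be_prev :: "nat \<Rightarrow> 'a ratfun poly" where "be_prev j = (if j = 0 then - [:0, 1:] else be (j - 1) ^ q)"

lemma eP_power_q: "eP n ^ q = monom (al n ^ q) q + monom (be n ^ q) 0"
proof -
  have "eP n = monom (al n) 1 + monom (be n) 0" by (simp add: eP_def monom_Suc monom_0)
  hence "eP n ^ q = monom (al n) 1 ^ q + monom (be n) 0 ^ q" by (simp only: frob_q(1)[OF CHAR_Kxy])
  thus ?thesis by (simp only: monom_power mult_1 mult_zero_left)
qed

lemma EP_1: "EP 1 j = monom (al_prev j) q + monom (be_prev j) 0"
proof (cases j)
  case 0
  thus ?thesis by (simp add: EP_def al_prev_def be_prev_def monom_0)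
next
  case (Suc n)
  thus ?thesis using eP_power_q[of n] by (simp add: EP_def al_prev_def be_prev_def)
qed

lemma QP_2: "QP j 2 = eP j * eP j ^ q - eP (Suc j) * EP 1 j"
proof -
  have "QP j 2 = (\<Sum>r\<in>{r. r permutes {..<2 :: nat}}. of_int (sign r) * (\<Prod>a<2. EP a (j + r a)))"
    unfolding QP_def by (rule det_expand)
  also have "{r. r permutes {..<2 :: nat}} = {id, Transposition.transpose 0 1}"
  proof -
    have "{..<2 :: nat} = {0, 1}" by auto
    thus ?thesis by (simp only: permutes_doubleton_iff) auto
  qed
  also have "(\<Sum>r\<in>{id, Transposition.transpose 0 1}. of_int (sign r) * (\<Prod>a<2. EP a (j + r a))) =
    EP 0 j * EP 1 (Suc j) - EP 0 (Suc j) * EP 1 j"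
  proof -
    have "id \<noteq> Transposition.transpose 0 (1 :: nat)" by (metis id_apply transpose_apply_first zero_neq_one)
    thus ?thesis by (simp add: numeral_2_eq_2 sign_swap_id)
  qed
  finally have "QP j 2 = EP 0 j * EP 1 (Suc j) - EP 0 (Suc j) * EP 1 j" .
  moreover have "EP 0 n = eP n" "EP 1 (Suc n) = eP n ^ q" for n by (simp_all add: EP_def)
  ultimately show ?thesis by (simp only:)
qed

lemma linear_mult:
  "eP n * (monom a q + monom b 0) = monom (al n * a) (q + 1) + monom (be n * a) q + monom (al n * b) 1 + monom (be n * b) 0"
proof -
  have "eP n = monom (al n) 1 + monom (be n) 0" by (simp add: eP_def monom_Suc monom_0)
  thus ?thesis by (simp only: distrib_left distrib_right mult_monom add_ac) simp
qed

lemma QP_2_coeffs: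
  "coeff (QP j 2) (q + 1) = al j * al j ^ q - al (Suc j) * al_prev j"
  "coeff (QP j 2) q = be j * al j ^ q - be (Suc j) * al_prev j"
  "coeff (QP j 2) 1 = al j * be j ^ q - al (Suc j) * be_prev j"
  "coeff (QP j 2) 0 = be j * be j ^ q - be (Suc j) * be_prev j"
proof -
  have eq: "QP j 2 = (monom (al j * al j ^ q) (q + 1) + monom (be j * al j ^ q) q + monom (al j * be j ^ q) 1 + monom (be j * be j ^ q) 0)
     - (monom (al (Suc j) * al_prev j) (q + 1) + monom (be (Suc j) * al_prev j) q + monom (al (Suc j) * be_prev j) 1 + monom (be (Suc j) * be_prev j) 0)"
    unfolding QP_2 EP_1 eP_power_q linear_mult by (rule refl)
  have n: "q + 1 \<noteq> q" "1 \<noteq> q + 1" "0 \<noteq> q + 1" "1 \<noteq> q" "0 \<noteq> q" "(0::nat) \<noteq> 1" using q2 by auto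
  show
    "coeff (QP j 2) (q + 1) = al j * al j ^ q - al (Suc j) * al_prev j"
    "coeff (QP j 2) q = be j * al j ^ q - be (Suc j) * al_prev j"
    "coeff (QP j 2) 1 = al j * be j ^ q - al (Suc j) * be_prev j"
    "coeff (QP j 2) 0 = be j * be j ^ q - be (Suc j) * be_prev j"
    unfolding eq coeff_add coeff_diff coeff_monom using n n[symmetric] by simp_all
qed

lemma br_power: "br n ^ q - br (Suc n) = - br 1"
proof -
  have "br n ^ q = to_fract theta ^ (q ^ Suc n) - to_fract theta ^ q"
    unfolding br_def to_fract_hom.hom_minus to_fract_hom.hom_power frob_q(3)[OF CHAR_K]
    by (simp only: power_mult[symmetric] power_Suc mult.commute)
  thus ?thesis unfolding br_def by (simp add: to_fract_hom.hom_minus to_fract_hom.hom_power)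
qed

text \<open>At \<eta> = 0 the values of \<open>al\<close> satisfy a two-term recursion, which lets
  both products be expressed by the value at j. Up to nonzero factors their difference is [j]^q -
  [j+1] = -[1].\<close>

lemma QP_2_top_0: "poly (coeff (QP j 2) (q + 1)) 0 \<noteq> 0"
proof (cases j)
  case 0
  thus ?thesis unfolding QP_2_coeffs by (simp add: al_prev_def)
next
  case (Suc n)
  define c where "c n = poly (al n) 0" for n
  have c: "c (Suc n) * - br (Suc n) = c n" for n unfolding c_def by (rule al_0_rec)
  have cn: "c n ^ q = c j ^ q * - (br j ^ q)"
    unfolding c[of n, symmetric] Suc power_mult_distrib frob_q(2)[OF CHAR_K] by (rule refl)
  have "poly (coeff (QP j 2) (q + 1)) 0 * - br (Suc j) = c j * c j ^ q * - br (Suc j) - (c (Suc j) * - br (Suc j)) * c n ^ q"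
    unfolding QP_2_coeffs by (simp add: c_def al_prev_def Suc algebra_simps)
  also have "\<dots> = c j * c j ^ q * (br j ^ q - br (Suc j))"
    unfolding c[of j] cn by (simp add: algebra_simps)
  also have "\<dots> \<noteq> 0" unfolding br_power using al_0_nz[of j] br_nz[of 1] by (simp add: c_def)
  finally show ?thesis by auto
qed

lemma degree_al_mult: "(q + 1) * degree (al m * al n ^ q) = (q + 1) * degree (al m) + q * ((q + 1) * degree (al n))"
proof -
  have "degree (al m * al n ^ q) = degree (al m) + q * degree (al n)"
    using al_nz by (simp add: degree_mult_eq degree_power_eq)
  thus ?thesis by (simp only: distrib_left mult.left_commute)
qed

text \<open>For j > 0 exactly one of the two products attains its degree bound,
  \<open>al j * al j ^ q\<close> for even j and the other for odd j, so there is no cancellation. It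
  follows that the top coefficient alone gives \<open>QP j 2\<close> its full weight.\<close>

lemma QP_2_top_degree: "degree (coeff (QP j 2) (q + 1)) + 1 = q ^ j"
proof (cases j)
  case 0
  thus ?thesis unfolding QP_2_coeffs by (simp add: al_prev_def)
next
  case (Suc n)
  define u v where "u = al j * al j ^ q" and "v = al (Suc j) * al n ^ q"
  have A: "coeff (QP j 2) (q + 1) = u - v" unfolding QP_2_coeffs by (simp add: al_prev_def Suc u_def v_def)
  have W: "(q + 1) * q ^ j = q ^ Suc j + q * q ^ n" using Suc by simp
  have du: "(q + 1) * degree u = (q + 1) * degree (al j) + q * ((q + 1) * degree (al j))"
    and dv: "(q + 1) * degree v = (q + 1) * degree (al (Suc j)) + q * ((q + 1) * degree (al n))"
    unfolding u_def v_def by (rule degree_al_mult)+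
  have key: "degree r + 1 = q ^ j" if "(q + 1) * degree r + (q + 1) = (q + 1) * q ^ j" for r :: "'a ratfun poly"
  proof -
    have "(q + 1) * (degree r + 1) = (q + 1) * q ^ j" using that by simp
    thus ?thesis by (simp only: mult_cancel1) simp
  qed
  show ?thesis
  proof (cases "even j")
    case True
    hence odd: "odd n" using Suc by simp
    have e: "(q + 1) * degree (al j) + 1 = q ^ j" using al_even True by blast
    have e2: "q * ((q + 1) * degree (al j)) + q = q * q ^ j" unfolding e[symmetric] by simp
    have "(q + 1) * degree u + (q + 1) = (q + 1) * q ^ j" unfolding du using e e2 by simp
    hence u: "degree u + 1 = q ^ j" by (rule key)
    have "(q + 1) * degree (al (Suc j)) + 1 < q ^ Suc j" by (rule al_odd) (use True in simp)
    moreover have "q * ((q + 1) * degree (al n) + 1) \<le> q * q ^ n" using al_degree[of n] by (rule mult_le_mono2)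
    ultimately have "(q + 1) * degree v + (q + 1) < (q + 1) * q ^ j" unfolding dv W by simp
    hence "(q + 1) * (degree v + 1) < (q + 1) * q ^ j" by simp
    hence "degree v + 1 < q ^ j" by (simp only: mult_less_cancel1)
    hence "degree v < degree u" using u by linarith
    hence "degree (u - v) = degree u" using degree_add_eq_left[of "- v" u] by simp
    thus ?thesis using u A by simp
  next
    case False
    hence even: "even n" "even (Suc j)" using Suc by simp_all
    have e: "(q + 1) * degree (al n) + 1 = q ^ n" "(q + 1) * degree (al (Suc j)) + 1 = q ^ Suc j"
      using al_even even by blast+
    have e2: "q * ((q + 1) * degree (al n)) + q = q * q ^ n" unfolding e(1)[symmetric] by simp
    have "(q + 1) * degree v + (q + 1) = (q + 1) * q ^ j" unfolding dv W using e(2) e2 by simp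
    hence v: "degree v + 1 = q ^ j" by (rule key)
    have o: "(q + 1) * degree (al j) + 1 < q ^ j" using al_odd False by blast
    moreover have "q * ((q + 1) * degree (al j) + 1) \<le> q * q ^ j" using o by (intro mult_le_mono2) simp
    ultimately have "(q + 1) * degree u + (q + 1) < (q + 1) * q ^ j" unfolding du by simp
    hence "(q + 1) * (degree u + 1) < (q + 1) * q ^ j" by simp
    hence "degree u + 1 < q ^ j" by (simp only: mult_less_cancel1)
    hence "degree u < degree v" using v by linarith
    hence "degree (u - v) = degree v" using degree_add_eq_right[of u "- v"] by simp
    thus ?thesis using v A by simp
  qed
qed

text \<open>Eliminating within the coefficients of \<epsilon>^(q+1) and \<epsilon>^q, and within
  those of \<epsilon> and 1, gives the Wronskian times \<open>al j ^ q\<close> and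
  \<open>be j ^ q\<close>. A further elimination gives the power q + 1 of the Wronskian, a monomial
  in \<eta>, and the top coefficient excludes the divisor \<eta>.\<close>

lemma QP_2_primitive:
  assumes "QP j 2 = C * [:d:]"
  shows "degree d = 0"
proof -
  have "[:d:] dvd QP j 2" unfolding assms by (rule dvd_triv_right)
  hence dv: "d dvd coeff (QP j 2) i" for i by (simp only: const_poly_dvd_iff)
  obtain r where "coeff (QP j 2) (q + 1) = d * r" using dv[of "q + 1"] by (elim dvdE)
  hence d0: "poly d 0 \<noteq> 0" using QP_2_top_0[of j] by auto
  have "al j ^ q * wronskian j = be (Suc j) * coeff (QP j 2) (q + 1) - al (Suc j) * coeff (QP j 2) q"
    unfolding QP_2_coeffs wronskian_def by (simp add: algebra_simps)
  hence 1: "d dvd al j ^ q * wronskian j" by (simp only: dvd_diff dvd_mult dv)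
  have "be j ^ q * wronskian j = be (Suc j) * coeff (QP j 2) 1 - al (Suc j) * coeff (QP j 2) 0"
    unfolding QP_2_coeffs wronskian_def by (simp add: algebra_simps)
  hence 2: "d dvd be j ^ q * wronskian j" by (simp only: dvd_diff dvd_mult dv)
  have "d dvd be (Suc j) ^ q * (al j ^ q * wronskian j) - al (Suc j) ^ q * (be j ^ q * wronskian j)"
    by (intro dvd_diff dvd_mult 1 2)
  also have "be (Suc j) ^ q * (al j ^ q * wronskian j) - al (Suc j) ^ q * (be j ^ q * wronskian j) = wronskian j ^ q * wronskian j"
    unfolding wronskian_def frob_q(3)[OF CHAR_Kx] power_mult_distrib by (simp add: algebra_simps)
  also have "\<dots> = wronskian j ^ Suc q" by simp
  finally have "d dvd wronskian j ^ Suc q" .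
  moreover obtain c N where "c \<noteq> 0" "wronskian j ^ Suc q = monom c N" using wronskian_power by blast
  ultimately show ?thesis using dvd_monom_const[OF d0] by metis
qed

lemma eP_rec: "[:[:br (Suc (Suc j)):]:] * eP (Suc (Suc j)) = [:monom 1 ((q - 1) * q ^ j):] * eP j - eP (Suc j)"
proof -
  have br: "[:br (Suc (Suc j)):] * [:inverse (br (Suc (Suc j))):] = (1 :: 'a ratfun poly)"
    using br_nz[of "Suc (Suc j)"] by (simp flip: one_pCons)
  have "[:br (Suc (Suc j)):] * ([:inverse (br (Suc (Suc j))):] * r) = r" for r by (simp only: mult.assoc[symmetric] br mult_1)
  hence "[:br (Suc (Suc j)):] * al (Suc (Suc j)) = monom 1 ((q - 1) * q ^ j) * al j - al (Suc j)"
    "[:br (Suc (Suc j)):] * be (Suc (Suc j)) = monom 1 ((q - 1) * q ^ j) * be j - be (Suc j)"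
    unfolding al_simps(3) be_simps(3) by (simp_all only:)
  thus ?thesis by (simp add: eP_def)
qed

lemma neg_one_poly: "[:- 1 :: 'a ratfun:] = - 1"
  by (rule poly_eqI) (auto simp: coeff_pCons split: nat.splits)

text \<open>For j \<ge> 1 this is the q-th power of \<open>eP_rec\<close> one step earlier. At j = 0
  it is checked directly and shows that -\<eta> continues the recursion backwards.\<close>

lemma EP_1_rec: "[:monom 1 ((q - 1) * q ^ j):] * EP 1 j = [:[:br (Suc j):]:] ^ q * eP (Suc j) ^ q + eP j ^ q"
proof (cases j)
  case 0
  have c: "br 1 ^ q * (- inverse (br 1)) ^ q = - 1"
    using br_nz[of 1] neg_one_q by (simp flip: power_mult_distrib)
  have a: "[:br 1:] ^ q * al 1 ^ q = - 1"
  proof -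
    have "[:br 1:] * al 1 = - 1" using br_nz[of 1] by (simp add: neg_one_poly)
    thus ?thesis unfolding power_mult_distrib[symmetric] by (simp add: frob_q(2)[OF CHAR_Kx])
  qed
  have b: "[:br 1:] ^ q * be 1 ^ q = - monom 1 q"
  proof -
    have "be 1 = monom (- inverse (br 1)) 1" by (simp add: monom_Suc monom_0)
    hence "[:br 1:] ^ q * be 1 ^ q = monom (br 1 ^ q * (- inverse (br 1)) ^ q) q"
      by (simp add: poly_const_pow monom_power smult_monom)
    thus ?thesis unfolding c by (simp add: minus_monom)
  qed
  have "[:[:br (Suc j):]:] ^ q * eP (Suc j) ^ q + eP j ^ q = monom ([:br 1:] ^ q * al 1 ^ q + 1) q + monom ([:br 1:] ^ q * be 1 ^ q) 0"
    unfolding 0 eP_power_q using q2 by (simp add: poly_const_pow distrib_left smult_monom add_monom power_0_left flip: One_nat_def)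
  also have "\<dots> = monom (- monom 1 q) 0" unfolding a b by simp
  also have "\<dots> = [:monom 1 ((q - 1) * q ^ j):] * EP 1 j"
  proof -
    have "monom (1 :: 'a ratfun) q = pCons 0 (monom 1 (q - 1))"
      using q2 by (cases q) (simp_all add: monom_Suc)
    thus ?thesis unfolding 0 by (simp add: EP_def monom_0)
  qed
  finally show ?thesis by (rule sym)
next
  case (Suc n)
  have "[:[:br (Suc j):]:] * eP (Suc j) = [:monom 1 ((q - 1) * q ^ n):] * eP n - eP j"
    unfolding Suc by (rule eP_rec)
  hence "([:[:br (Suc j):]:] * eP (Suc j)) ^ q = ([:monom 1 ((q - 1) * q ^ n):] * eP n - eP j) ^ q" by (rule arg_cong)
  hence "[:[:br (Suc j):]:] ^ q * eP (Suc j) ^ q = [:monom 1 ((q - 1) * q ^ n):] ^ q * eP n ^ q - eP j ^ q"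
    by (simp only: frob_q(3)[OF CHAR_Kxy] power_mult_distrib)
  moreover have "[:monom (1 :: 'a ratfun) ((q - 1) * q ^ n):] ^ q = [:monom 1 ((q - 1) * q ^ j):]"
    unfolding Suc by (simp add: poly_const_pow monom_power mult_ac)
  moreover have "EP 1 j = eP n ^ q" unfolding Suc by (simp add: EP_def)
  ultimately show ?thesis by simp
qed

text \<open>Modulo \<open>eP (Suc j)\<close> only the power \<open>eP j ^ Suc q\<close> of the
  neighbouring form remains.\<close>

lemma QP_2_coprime_Suc:
  assumes "C dvd QP j 2" "C dvd eP (Suc j)"
  shows "degree C = 0"
proof -
  have "C dvd QP j 2 + eP (Suc j) * EP 1 j" using assms by (intro dvd_add dvd_mult2)
  hence "C dvd eP j ^ Suc q" unfolding QP_2 by simp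
  thus ?thesis using consecutive_coprime assms(2) by blast
qed

text \<open>After multiplication by a power of \<eta>, both recursions rewrite \<open>QP j 2\<close>
  through \<open>eP (Suc (Suc j))\<close> and \<open>eP (Suc j) ^ Suc q\<close>. A common factor
  with the former divides the latter, a power of its neighbour.\<close>

lemma QP_2_coprime_Suc_Suc:
  assumes "C dvd QP j 2" "C dvd eP (Suc (Suc j))"
  shows "degree C = 0"
proof -
  define b where "b = [:[:br (Suc j):]:] ^ q"
  define x where "x = [:monom (1 :: 'a ratfun) ((q - 1) * q ^ j):]"
  have "x * QP j 2 = eP j ^ q * (x * eP j - eP (Suc j)) - b * eP (Suc j) ^ Suc q"
  proof -
    have "x * QP j 2 = x * (eP j * eP j ^ q) - eP (Suc j) * (x * EP 1 j)"
      unfolding QP_2 by (simp only: right_diff_distrib mult.left_commute)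
    also have "x * EP 1 j = b * eP (Suc j) ^ q + eP j ^ q" unfolding x_def b_def by (rule EP_1_rec)
    finally show ?thesis by (simp add: algebra_simps)
  qed
  hence "b * eP (Suc j) ^ Suc q = eP j ^ q * ([:[:br (Suc (Suc j)):]:] * eP (Suc (Suc j))) - x * QP j 2"
    unfolding eP_rec x_def[symmetric] by simp
  hence *: "C dvd b * eP (Suc j) ^ Suc q" using assms by (simp only: dvd_diff dvd_mult)
  have b: "[:[:inverse (br (Suc j)):]:] ^ q * b = 1"
  proof -
    have "[:[:inverse (br (Suc j)):]:] * [:[:br (Suc j):]:] = (1 :: 'a ratfun poly poly)" using br_nz[of "Suc j"] by (simp flip: one_pCons)
    thus ?thesis unfolding b_def power_mult_distrib[symmetric] by simp
  qed
  have "C dvd [:[:inverse (br (Suc j)):]:] ^ q * (b * eP (Suc j) ^ Suc q)" using * by (rule dvd_mult)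
  hence "C dvd eP (Suc j) ^ Suc q" by (simp only: mult.assoc[symmetric] b mult_1)
  thus ?thesis by (rule consecutive_coprime[OF assms(2)])
qed

lemma QP_2_factor:
  assumes Q: "QP j 2 = C * D"
  shows "C \<noteq> 0" "D \<noteq> 0" "ev2 C \<noteq> 0" "ev2 D \<noteq> 0"
    and "degree C + degree D = q + 1" "weight C + weight D \<le> (q + 1) * (q ^ j + 1)"
proof -
  have evQ: "ev2 (QP j 2) \<noteq> 0" using QP_order(1)[of 2 j] by simp
  show "ev2 C \<noteq> 0" "ev2 D \<noteq> 0" using evQ unfolding Q ev2.hom_mult by auto
  show nz: "C \<noteq> 0" "D \<noteq> 0" using evQ Q by auto
  have "coeff (QP j 2) (q + 1) \<noteq> 0" using QP_2_top_0[of j] by auto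
  hence "degree (QP j 2) = q + 1" using QP_degree[of j 2] le_degree q_geom_2 by (metis antisym)
  thus "degree C + degree D = q + 1" unfolding Q degree_mult_eq[OF nz] .
  show "weight C + weight D \<le> (q + 1) * (q ^ j + 1)"
    using QP_weight[of 2 j] unfolding Q weight_mult[OF nz] q_geom_2 by simp
qed

text \<open>
  The assumption on \<open>J\<close> forces the order of \<open>C\<close> to be at most \<open>q^J\<close>, the order of \<open>eP J\<close>.
\<close>

lemma QP_2_factor_order:
  assumes Q: "QP j 2 = C * D" and c: "degree C \<noteq> 0"
    and J: "J = Suc j \<or> J = Suc (Suc j)" and big: "(q + 1) * q ^ j < degree D * q ^ J"
  shows "(q + 1) * subdegree (ev2 C) + degree C \<le> weight C + degree C * q ^ J"
proof -
  note nz = QP_2_factor(1,2)[OF Q] and evC = QP_2_factor(3)[OF Q]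
  note degQ = QP_2_factor(5)[OF Q] and wt = QP_2_factor(6)[OF Q]
  have "lead_coeff D \<noteq> 0" using nz by simp
  hence wD: "2 * degree D \<le> weight D" using weight_coeff[of D "degree D"] by linarith
  have alJ: "al J \<noteq> 0" by (rule al_nz)
  have degJ: "degree (eP J) = 1" using alJ by (simp add: eP_def)
  have res: "resultant C (eP J) \<noteq> 0"
  proof
    assume "resultant C (eP J) = 0"
    then obtain F B D' where f: "C = F * B" "eP J = F * D'" "degree F \<noteq> 0" using resultant_0_factor by blast
    have "F dvd QP j 2" "F dvd eP J" unfolding Q f by simp_all
    hence "degree F = 0" using J QP_2_coprime_Suc QP_2_coprime_Suc_Suc by blast
    thus False using f(3) by simp
  qed
  have evJ: "ev2 (eP J) \<noteq> 0" "subdegree (ev2 (eP J)) = q ^ J"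
  proof -
    show "ev2 (eP J) \<noteq> 0" using QP_order(1)[of 1 J] unfolding QP_1 by simp
    have "(q + 1) * subdegree (ev2 (eP J)) = q ^ J * (q ^ 1 + 1) * q_geom 1"
      using det_Gmat_order_q_geom[of J 1] QP_order(2)[of 1 J] unfolding QP_1 by simp
    hence "(q + 1) * subdegree (ev2 (eP J)) = (q + 1) * q ^ J"
      unfolding q_geom_1 power_one_right mult_1_right by (simp only: mult.commute)
    thus "subdegree (ev2 (eP J)) = q ^ J" by (simp only: mult_cancel1) simp
  qed
  have bound: "(q + 1) * N + degree C \<le> weight C + degree C * q ^ J"
    if "N \<le> subdegree (ev2 C)" "N \<le> q ^ J" for N
  proof -
    have "(q + 1) * N + 2 * (degree C * degree (eP J)) \<le> degree (eP J) * weight C + degree C * (q ^ J + 1)"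
      by (rule resultant_order[OF res _ order.refl eP_weight]) (use c that evC evJ in \<open>simp_all add: X_power_dvd\<close>)
    thus ?thesis unfolding degJ by simp
  qed
  have "subdegree (ev2 C) \<le> q ^ J"
  proof (rule ccontr)
    assume "\<not> subdegree (ev2 C) \<le> q ^ J"
    hence b: "(q + 1) * q ^ J + degree C \<le> weight C + degree C * q ^ J" by (intro bound) simp_all
    have "(q + 1) * q ^ J = degree C * q ^ J + degree D * q ^ J" unfolding degQ[symmetric] by (rule add_mult_distrib)
    hence "degree D * q ^ J + degree C \<le> weight C" using b by linarith
    moreover have "(q + 1) * (q ^ j + 1) = (q + 1) * q ^ j + (degree C + degree D)" unfolding degQ by simp
    ultimately show False using wt wD big by linarith
  qed
  thus ?thesis by (intro bound) simp_all
qed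

text \<open>The orders of the factors add up to the order of the determinant, while
  \<open>QP_2_factor_order\<close> bounds each of them from above. If \<open>degree D\<close> is at
  least 2, the index j + 1 serves both factors. If it is 1, the condition fails for \<open>C\<close>
  at j + 1, and the index j + 2 is taken instead. In both cases q^2 q^j \<le> q q^j results, which
  is absurd.\<close>

lemma QP_2_no_factor:
  assumes Q: "QP j 2 = C * D" and c: "degree C \<noteq> 0" and d: "degree D \<noteq> 0" and "degree D \<le> degree C"
  shows False
proof -
  note ev = QP_2_factor(3,4)[OF Q]
  note degQ = QP_2_factor(5)[OF Q] and wt = QP_2_factor(6)[OF Q]
  have Q': "QP j 2 = D * C" unfolding Q by (rule mult.commute)
  define a where "a = q ^ j"
  have a1: "a \<ge> 1" unfolding a_def by simp
  have ord: "(q + 1) * subdegree (ev2 C) + (q + 1) * subdegree (ev2 D) = a * (q ^ 2 + 1) * (q + 1)"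
  proof -
    have "subdegree (det (Gmat j 2)) = subdegree (ev2 C) + subdegree (ev2 D)"
      using QP_order(2)[of 2 j] subdegree_mult[OF ev] unfolding Q ev2.hom_mult by simp
    thus ?thesis using det_Gmat_order_q_geom[of j 2] unfolding q_geom_2 a_def by (simp only: distrib_left)
  qed
  have p1: "q ^ Suc j = q * a" and p2: "q ^ Suc (Suc j) = q * (q * a)" by (simp_all add: a_def)
  have qq: "2 * q \<le> q * q" using q2 by (rule mult_le_mono1)
  have qa: "1 * a \<le> q * a" using q2 by (intro mult_le_mono1) simp
  have qqa: "2 * (q * a) \<le> q * (q * a)" using q2 by (rule mult_le_mono1)
  have D1: "(q + 1) * subdegree (ev2 D) + degree D \<le> weight D + degree D * q ^ Suc j"
  proof (rule QP_2_factor_order[OF Q' d])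
    have "2 \<le> degree C" using degQ q2 assms(4) by linarith
    hence "2 * (q * a) \<le> degree C * (q * a)" by (rule mult_le_mono1)
    moreover have "q * a > a" using q2 a1 by (cases q) simp_all
    ultimately show "(q + 1) * q ^ j < degree C * q ^ Suc j"
      unfolding p1 a_def[symmetric] add_mult_distrib mult_1 by linarith
  qed simp
  show False
  proof (cases "degree D = 1")
    case False
    have C1: "(q + 1) * subdegree (ev2 C) + degree C \<le> weight C + degree C * q ^ Suc j"
    proof (rule QP_2_factor_order[OF Q c])
      have "2 \<le> degree D" using False d by linarith
      hence "2 * (q * a) \<le> degree D * (q * a)" by (rule mult_le_mono1)
      moreover have "q * a > a" using q2 a1 by (cases q) simp_all
      ultimately show "(q + 1) * q ^ j < degree D * q ^ Suc j"
        unfolding p1 a_def[symmetric] add_mult_distrib mult_1 by linarith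
    qed simp
    have "degree C * q ^ Suc j + degree D * q ^ Suc j = (q + 1) * (q * a)"
      unfolding p1 add_mult_distrib[symmetric] degQ by (rule refl)
    hence "a * (q ^ 2 + 1) * (q + 1) + (q + 1) \<le> (q + 1) * (a + 1) + (q + 1) * (q * a)"
      using C1 D1 wt ord degQ unfolding a_def[symmetric] by linarith
    hence "(q + 1) * (a * (q ^ 2 + 1)) \<le> (q + 1) * (a + q * a)" by (simp add: algebra_simps)
    hence "a * (q ^ 2 + 1) \<le> a + q * a" by (rule mult_left_le_imp_le) simp
    hence "q * (q * a) \<le> q * a" by (simp add: algebra_simps power2_eq_square)
    thus False using qqa qa a1 by linarith
  next
    case True
    hence Cq: "degree C = q" using degQ by simp
    have C1: "(q + 1) * subdegree (ev2 C) + degree C \<le> weight C + degree C * q ^ Suc (Suc j)"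
    proof (rule QP_2_factor_order[OF Q c])
      have "q * a > a" using q2 a1 by (cases q) simp_all
      thus "(q + 1) * q ^ j < degree D * q ^ Suc (Suc j)"
        unfolding p2 True a_def[symmetric] add_mult_distrib mult_1 using qqa by linarith
    qed simp
    have "a * (q ^ 2 + 1) * (q + 1) + (q + 1) \<le> (q + 1) * (a + 1) + q * (q * (q * a)) + q * a"
      using C1 D1 wt ord degQ unfolding a_def[symmetric] True Cq p1 p2 by linarith
    moreover have "a * (q ^ 2 + 1) * (q + 1) = q * (q * (q * a)) + q * (q * a) + q * a + a"
      by (simp add: algebra_simps power2_eq_square)
    ultimately have "q * (q * a) \<le> q * a" by (simp add: algebra_simps)
    thus False using qqa qa a1 by linarith
  qed
qed

lemma extremal_bound_2:
  assumes q3: "q \<ge> 3" and P: "P \<noteq> 0" "degree P \<le> q_geom 2" "weight P \<le> q_geom 2 * (q ^ j + 1)"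
  shows "subdegree (ev2 P) \<le> subdegree (det (Gmat j 2))"
proof (rule extremal_bound[OF _ _ _ _ _ _ _ P])
  \<comment> \<open>The required inequality 2 (q + 1) \<le> q^2 holds exactly for q \<ge> 3.\<close>
  have "3 * q \<le> q * q" using q3 by (rule mult_le_mono1)
  moreover have "2 * (q + 1) \<le> 3 * q" using q3 by presburger
  ultimately show "2 * q_geom 2 \<le> q ^ 2" unfolding q_geom_2 power2_eq_square by (rule order.trans[rotated])
  show nz: "coeff (QP j 2) (q_geom 2) \<noteq> 0" unfolding q_geom_2 using QP_2_top_0[of j] by auto
  have "(q + 1) * degree (coeff (QP j 2) (q + 1)) + 2 * (q + 1) \<le> weight (QP j 2)"
    using weight_coeff[OF nz] unfolding q_geom_2 .
  moreover have "(q + 1) * degree (coeff (QP j 2) (q + 1)) + 2 * (q + 1) = (q + 1) * (q ^ j + 1)"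
    unfolding QP_2_top_degree[symmetric] by simp
  ultimately show "q_geom 2 * (q ^ j + 1) \<le> weight (QP j 2)" unfolding q_geom_2 by simp
next
  fix C d show "QP j 2 = C * [:d:] \<Longrightarrow> degree d = 0" by (rule QP_2_primitive)
next
  fix C D assume *: "QP j 2 = C * D" "degree C \<noteq> 0" "degree D \<noteq> 0"
  show False
  proof (cases "degree D \<le> degree C")
    case True
    thus ?thesis using QP_2_no_factor * by blast
  next
    case False
    moreover have "QP j 2 = D * C" unfolding *(1) by (rule mult.commute)
    ultimately show ?thesis using QP_2_no_factor[of j D C] * by simp
  qed
qed simp_all

lemma extremal_det_Gmat:
  assumes "k = 1 \<or> k = 2 \<and> q \<ge> 3"
  shows "QM (q_geom k) (int (q_geom k * (q ^ j + 1))) (int k) \<noteq> {0}"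
    and "det (Gmat j k) = extremal_form (q_geom k) (int (q_geom k * (q ^ j + 1))) (int k)"
proof -
  define V where "V = QM (q_geom k) (int (q_geom k * (q ^ j + 1))) (int k)"
  have G: "det (Gmat j k) \<in> V" unfolding V_def by (rule QM_det_Gmat) (use assms in auto)
  hence V: "V \<noteq> {0}" using det_Gmat_nz[of j k] by auto
  thus "QM (q_geom k) (int (q_geom k * (q ^ j + 1))) (int k) \<noteq> {0}" unfolding V_def .
  have "subdegree f \<le> subdegree (det (Gmat j k))" if f: "f \<in> V" "f \<noteq> 0" for f
  proof -
    obtain P where P: "f = g_root ^ (q_geom k * (q ^ j + 1)) * ev2 P" "degree P \<le> q_geom k" "weight P \<le> q_geom k * (q ^ j + 1)"
      using QM_repr f(1) unfolding V_def by blast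
    have nz: "P \<noteq> 0" "ev2 P \<noteq> 0" using f(2) P(1) by auto
    have g: "g_root ^ (q_geom k * (q ^ j + 1)) \<noteq> 0" using g_root_nz by simp
    have "subdegree f = subdegree (ev2 P)" unfolding P(1) subdegree_mult[OF g nz(2)] g_root_subdegree by simp
    also have "\<dots> \<le> subdegree (det (Gmat j k))"
      using assms extremal_bound_1[OF nz(1)] extremal_bound_2[OF _ nz(1)] P(2,3) by blast
    finally show ?thesis .
  qed
  hence "extremal (q_geom k) (int (q_geom k * (q ^ j + 1))) (int k) (det (Gmat j k))"
    unfolding extremal_def using G det_Gmat_nz[of j k] unfolding V_def by blast
  hence *: "extremal (q_geom k) (int (q_geom k * (q ^ j + 1))) (int k) (det (Gmat j k)) \<and> normalised (det (Gmat j k))"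
    using det_Gmat_normalised by blast
  show "det (Gmat j k) = extremal_form (q_geom k) (int (q_geom k * (q ^ j + 1))) (int k)"
    unfolding extremal_form_def
    by (rule the1_equality[symmetric, OF ex1_extremal_form *]) (use V in \<open>simp add: V_def\<close>)
qed

end

theorem theorem1:
  fixes p e q :: nat
  assumes "prime p" and "e \<ge> 1" and "q = p ^ e" and "CARD('a::finite_field) = q"
  shows
    "(\<exists>(C :: nat \<Rightarrow> nat) (l :: nat \<Rightarrow> nat).
        filterlim l at_top sequentially \<and>
        (\<forall>k\<ge>1. \<forall>j\<ge>C k.
           (E_form (int j) k :: 'a closure_field) \<in>
             emb ` quasi_modular_forms ((q ^ k - 1) div (q - 1))
                     (int ((q ^ k - 1) * (q ^ j + 1) div (q - 1))) (int k) -
             emb ` quasi_modular_forms (l k)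
                     (int ((q ^ k - 1) * (q ^ j + 1) div (q - 1))) (int k))) \<and>
     (\<forall>j. \<forall>k\<ge>1. \<exists>f. (E_form (int j) k :: 'a closure_field) = emb f \<and> f \<noteq> 0 \<and>
        subdegree f = q ^ j * (q ^ (2 * k) - 1) div (q\<^sup>2 - 1)) \<and>
     (\<forall>j. \<forall>k\<ge>1. \<exists>f\<in>integral_series. (E_form (int j) k :: 'a closure_field) = emb f \<and> normalised f) \<and>
     (\<forall>j k. k = 1 \<or> (k = 2 \<and> q \<ge> 3) \<longrightarrow>
        (quasi_modular_forms ((q ^ k - 1) div (q - 1))
           (int ((q ^ k - 1) * (q ^ j + 1) div (q - 1))) (int k) :: 'a ratfun fps set) \<noteq> {0} \<and>
        (E_form (int j) k :: 'a closure_field) =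
          emb (extremal_form ((q ^ k - 1) div (q - 1))
                 (int ((q ^ k - 1) * (q ^ j + 1) div (q - 1))) (int k)))"
proof -
  interpret drinfeld "TYPE('a)" p e q
    by unfold_locales (use assms in auto)
  have form: "(E_form (int j) k :: 'a closure_field) = emb (det (Gmat j k))" for j k by (rule E_form_eq)
  have 1: "filterlim (\<lambda>k. k - 1) at_top (sequentially :: nat filter)"
    by (rule filterlim_minus_const_nat_at_top)
  have 2: "(E_form (int j) k :: 'a closure_field) \<in>
      emb ` quasi_modular_forms (q_geom k) (int (q_geom k * (q ^ j + 1))) (int k) -
      emb ` quasi_modular_forms (k - 1) (int (q_geom k * (q ^ j + 1))) (int k)"
    if k: "k \<ge> 1" "j \<ge> k" for j k
  proof (rule DiffI)
    have "det (Gmat j k) \<in> quasi_modular_forms (q_geom k) (int (q_geom k * (q ^ j + 1))) (int k)"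
      by (rule QM_det_Gmat) (use k in simp)
    thus "(E_form (int j) k :: 'a closure_field) \<in> emb ` quasi_modular_forms (q_geom k) (int (q_geom k * (q ^ j + 1))) (int k)"
      unfolding form by (rule imageI)
    have "k - 1 < q_geom k" using le_q_geom[of k] k(1) by linarith
    from det_Gmat_depth[OF k(2) this]
    show "(E_form (int j) k :: 'a closure_field) \<notin> emb ` quasi_modular_forms (k - 1) (int (q_geom k * (q ^ j + 1))) (int k)"
      unfolding form by auto
  qed
  show ?thesis
    unfolding q_geom_eq q_geom_weight
  proof (intro conjI)
    \<comment> \<open>The choice C(k) = k is what makes the top coefficient of \<open>QP j k\<close>
      computable, and k - 1 tends to infinity while staying below the depth
      \<open>q_geom k\<close>.\<close>
    show "\<exists>(C :: nat \<Rightarrow> nat) (l :: nat \<Rightarrow> nat). filterlim l at_top sequentially \<and>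
        (\<forall>k\<ge>1. \<forall>j\<ge>C k. (E_form (int j) k :: 'a closure_field) \<in>
           emb ` quasi_modular_forms (q_geom k) (int (q_geom k * (q ^ j + 1))) (int k) -
           emb ` quasi_modular_forms (l k) (int (q_geom k * (q ^ j + 1))) (int k))"
      by (rule exI[of _ "\<lambda>k. k"], rule exI[of _ "\<lambda>k. k - 1"]) (use 1 2 in blast)
    show "\<forall>j. \<forall>k\<ge>1. \<exists>f. (E_form (int j) k :: 'a closure_field) = emb f \<and> f \<noteq> 0 \<and>
        subdegree f = q ^ j * (q ^ (2 * k) - 1) div (q\<^sup>2 - 1)"
      using form det_Gmat_nz det_Gmat_subdegree by blast
    show "\<forall>j. \<forall>k\<ge>1. \<exists>f\<in>integral_series. (E_form (int j) k :: 'a closure_field) = emb f \<and> normalised f"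
      using form integral_det_Gmat det_Gmat_normalised by blast
    show "\<forall>j k. k = 1 \<or> k = 2 \<and> 3 \<le> q \<longrightarrow>
        (quasi_modular_forms (q_geom k) (int (q_geom k * (q ^ j + 1))) (int k) :: 'a ratfun fps set) \<noteq> {0} \<and>
        (E_form (int j) k :: 'a closure_field) = emb (extremal_form (q_geom k) (int (q_geom k * (q ^ j + 1))) (int k))"
      using form extremal_det_Gmat by auto
  qed
qed

end
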